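(* Assume $g\in\mathcal G$, $\alpha\notin\mathbb Q$, $\alpha\in\mathrm{Int}(\rho(g))$, and $k>0$ is an integer. (a) In the weak topology there is a $(k-1)$-dimensional disk of kfsm semi-Denjoy minimal sets of $g$ with rotation number $\alpha$. (b) If $p_n/q_n$ is a sequence of rationals in lowest terms with $p_n/q_n\to\alpha$, then the number of distinct kfsm periodic orbits of $g$ with rotation number $p_n/q_n$ grows like $q_n^{k-1}$.
   Context: Covers: $S^1=\mathbb R/\mathbb Z$, $T(x)=x+1$ on $\mathbb R$, $\pi:\mathbb R\to S^1$ the projection. Class $\mathcal G$: $g:S^1\to S^1$ is in $\mathcal G$ if it has a lift $\tilde g:\mathbb R\to\mathbb R$ (fixed as the preferred lift) that is continuous, satisfies $\tilde g(x+1)=\tilde g(x)+1$, is piecewise smooth (on $[0,1]$ it is $C^2$ off finitely many points, at which one-sided derivatives exist), and for which there are $0=x_{\min}<x_{\max}<1$ with $\tilde g'>1$ on $[x_{\min},x_{\max}]$, $\tilde g$ monotone decreasing on $[x_{\max},x_{\min}+1]$, and $x_{\min}\le\tilde g(x_{\min})<\tilde g(x_{\max})\le x_{\max}+1$. Rotation: $\rho(x,g)=\lim_n(\tilde g^n(x')-x')/n$ for a lift $x'$ of $x$, when the limit exists; $\rho(g)$ is the set of all such values, a closed interval. An invariant set has rotation number $\omega$ if all its points do. kfsm sets: invariant means forward invariant. A compact $g$-invariant $Z\subset S^1$ is $k$-fold semi-monotone (kfsm) if there is a $\tilde g$-invariant $Z'\subset\mathbb R$ with $\pi(Z')=Z$,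 $T^k(Z')=Z'$, and $\tilde g(z_1)\le\tilde g(z_2)$ whenever $z_1<z_2$ in $Z'$. All kfsm sets are also required to lie in the positive slope region, that is, in the set of points whose forward orbit under $g$ stays in $\pi([0,x_{\max}])$. Semi-Denjoy: a continuous degree one circle map $h$ with a nondecreasing lift and irrational rotation number has exactly one minimal set; a minimal set is called semi-Denjoy if it is topologically conjugate to the minimal set of such an $h$. A semi-Denjoy minimal set carries a unique invariant Borel probability measure, and the collection of kfsm semi-Denjoy minimal sets is topologized by the weak topology on these unique invariant measures. *)

theory Defs
  imports "HOL-Probability.Probability" "HOL-Library.Landau_Symbols"
begin

section \<open>The circle as a quotient of the real line\<close>

quotient_type circle = real / "\<lambda>x y. x - y \<in> \<int>"
  morphisms circle_rep circle_proj
proof (rule equivpI)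
  show "reflp (\<lambda>x y::real. x - y \<in> \<int>)"
    by (simp add: reflp_def)
  show "symp (\<lambda>x y::real. x - y \<in> \<int>)"
    by (metis sympI Ints_minus minus_diff_eq)
  show "transp (\<lambda>x y::real. x - y \<in> \<int>)"
  proof (rule transpI)
    fix x y z :: real
    assume "x - y \<in> \<int>" "y - z \<in> \<int>"
    then have "(x - y) + (y - z) \<in> \<int>"
      by (rule Ints_add)
    then show "x - z \<in> \<int>"
      by simp
  qed
qed

lemma circle_proj_eq_iff: "circle_proj x = circle_proj y \<longleftrightarrow> x - y \<in> \<int>"
  by (rule circle.abs_eq_iff)

instantiation circle :: topological_space
begin

definition open_circle :: "circle set \<Rightarrow> bool"
  where "open_circle U \<longleftrightarrow> open (circle_proj -` U)"

instance
  by standard (auto simp: open_circle_def vimage_Union intro!: open_Int open_UN)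

end

section \<open>Circle maps and their lifts\<close>

text \<open>\<open>degree_one_lift f F\<close>: \<open>F\<close> is a continuous lift of the (then continuous) circle
  map \<open>f\<close>, and \<open>f\<close> has degree one.\<close>

definition degree_one_lift :: "(circle \<Rightarrow> circle) \<Rightarrow> (real \<Rightarrow> real) \<Rightarrow> bool"
  where "degree_one_lift f F \<longleftrightarrow>
    continuous_on UNIV F \<and>
    (\<forall>x. circle_proj (F x) = f (circle_proj x)) \<and>
    (\<forall>x. F (x + 1) = F x + 1)"

definition piecewise_smooth :: "(real \<Rightarrow> real) \<Rightarrow> bool"
  where "piecewise_smooth F \<longleftrightarrow> (\<exists>S F' F''.
    finite S \<and> S \<subseteq> {0..1} \<and>
    (\<forall>x\<in>{0..1} - S. (F has_real_derivative F' x) (at x) \<and>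
                     (F' has_real_derivative F'' x) (at x)) \<and>
    continuous_on ({0..1} - S) F'' \<and>
    (\<forall>x\<in>S. (\<exists>D. (F has_real_derivative D) (at_left x)) \<and>
           (\<exists>D. (F has_real_derivative D) (at_right x))))"

text \<open>The circle map \<open>g\<close> is in the class \<open>\<G>\<close> with preferred lift \<open>G\<close>, with \<open>x\<^sub>m\<^sub>i\<^sub>n = 0\<close> and
  \<open>x\<^sub>m\<^sub>a\<^sub>x = xm\<close>. The slope condition on \<open>[0, xm]\<close> is stated through the one-sided
  derivatives taken inside that interval: the two-sided derivative need not exist at the
  finitely many break points, and it does not exist at the turning points \<open>0\<close> and \<open>xm\<close>.\<close>

definition class_G :: "(circle \<Rightarrow> circle) \<Rightarrow> (real \<Rightarrow> real) \<Rightarrow> real \<Rightarrow> bool"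
  where "class_G g G xm \<longleftrightarrow>
    degree_one_lift g G \<and> piecewise_smooth G \<and>
    0 < xm \<and> xm < 1 \<and>
    (\<forall>x\<in>{0..<xm}. \<exists>D>1. (G has_real_derivative D) (at_right x)) \<and>
    (\<forall>x\<in>{0<..xm}. \<exists>D>1. (G has_real_derivative D) (at_left x)) \<and>
    antimono_on {xm..1} G \<and>
    0 \<le> G 0 \<and> G 0 < G xm \<and> G xm \<le> xm + 1"

section \<open>Rotation numbers\<close>

definition has_rotation_number :: "(real \<Rightarrow> real) \<Rightarrow> circle \<Rightarrow> real \<Rightarrow> bool"
  where "has_rotation_number F z \<omega> \<longleftrightarrow>
    (\<exists>x. circle_proj x = z \<and> (\<lambda>n. ((F ^^ n) x - x) / real n) \<longlonglongrightarrow> \<omega>)"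

definition rotation_set :: "(real \<Rightarrow> real) \<Rightarrow> real set"
  where "rotation_set F = {\<omega>. \<exists>z. has_rotation_number F z \<omega>}"

definition set_has_rotation_number :: "(real \<Rightarrow> real) \<Rightarrow> circle set \<Rightarrow> real \<Rightarrow> bool"
  where "set_has_rotation_number F Z \<omega> \<longleftrightarrow> (\<forall>z\<in>Z. has_rotation_number F z \<omega>)"

section \<open>k-fold semi-monotone sets\<close>

definition positive_slope_region :: "(circle \<Rightarrow> circle) \<Rightarrow> real \<Rightarrow> circle set"
  where "positive_slope_region g xm = {z. \<forall>n. (g ^^ n) z \<in> circle_proj ` {0..xm}}"

definition kfsm :: "(circle \<Rightarrow> circle) \<Rightarrow> (real \<Rightarrow> real) \<Rightarrow> real \<Rightarrow> nat \<Rightarrow> circle set \<Rightarrow> bool"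
  where "kfsm g G xm k Z \<longleftrightarrow>
    compact Z \<and> g ` Z \<subseteq> Z \<and> Z \<subseteq> positive_slope_region g xm \<and>
    (\<exists>Z'. G ` Z' \<subseteq> Z' \<and> circle_proj ` Z' = Z \<and> (\<lambda>x. x + real k) ` Z' = Z' \<and>
          (\<forall>z1\<in>Z'. \<forall>z2\<in>Z'. z1 < z2 \<longrightarrow> G z1 \<le> G z2))"

definition periodic_orbit :: "(circle \<Rightarrow> circle) \<Rightarrow> circle set \<Rightarrow> bool"
  where "periodic_orbit g P \<longleftrightarrow>
    (\<exists>z N. N > 0 \<and> (g ^^ N) z = z \<and> P = (\<lambda>i. (g ^^ i) z) ` {..<N})"

definition kfsm_periodic_orbits ::
    "(circle \<Rightarrow> circle) \<Rightarrow> (real \<Rightarrow> real) \<Rightarrow> real \<Rightarrow> nat \<Rightarrow> real \<Rightarrow> circle set set"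
  where "kfsm_periodic_orbits g G xm k \<omega> =
    {P. periodic_orbit g P \<and> kfsm g G xm k P \<and> set_has_rotation_number G P \<omega>}"

section \<open>Semi-Denjoy minimal sets\<close>

definition minimal_set :: "(circle \<Rightarrow> circle) \<Rightarrow> circle set \<Rightarrow> bool"
  where "minimal_set f Z \<longleftrightarrow>
    Z \<noteq> {} \<and> compact Z \<and> f ` Z \<subseteq> Z \<and>
    (\<forall>Y. Y \<noteq> {} \<and> compact Y \<and> Y \<subseteq> Z \<and> f ` Y \<subseteq> Y \<longrightarrow> Y = Z)"

definition semi_Denjoy_minimal_set :: "(circle \<Rightarrow> circle) \<Rightarrow> circle set \<Rightarrow> bool"
  where "semi_Denjoy_minimal_set g Z \<longleftrightarrow>
    minimal_set g Z \<and>
    (\<exists>h H \<omega> M \<phi> \<psi>.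
       degree_one_lift h H \<and> mono H \<and> \<omega> \<notin> \<rat> \<and> set_has_rotation_number H UNIV \<omega> \<and>
       minimal_set h M \<and>
       homeomorphism Z M \<phi> \<psi> \<and> (\<forall>z\<in>Z. \<phi> (g z) = h (\<phi> z)))"

definition kfsm_semi_Denjoy ::
    "(circle \<Rightarrow> circle) \<Rightarrow> (real \<Rightarrow> real) \<Rightarrow> real \<Rightarrow> nat \<Rightarrow> circle set set"
  where "kfsm_semi_Denjoy g G xm k =
    {Z. semi_Denjoy_minimal_set g Z \<and> kfsm g G xm k Z}"

section \<open>The weak topology\<close>

definition prob_measures :: "circle measure set"
  where "prob_measures = {M. prob_space M \<and> sets M = sets borel}"

text \<open>The coarsest topology making \<open>M \<mapsto> \<integral> u dM\<close> continuous for all continuous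
  \<open>u\<close> from the circle to the reals.\<close>

definition weak_topology :: "circle measure topology"
  where "weak_topology =
    pullback_topology prob_measures
      (\<lambda>M. \<lambda>u\<in>{u. continuous_on UNIV u}. integral\<^sup>L M u)
      (product_topology (\<lambda>_. euclideanreal) {u :: circle \<Rightarrow> real. continuous_on UNIV u})"

text \<open>The unique invariant Borel probability measure carried by \<open>Z\<close>; meaningful only if
  \<open>Z\<close> is uniquely ergodic, as semi-Denjoy minimal sets are.\<close>

definition invariant_measure :: "(circle \<Rightarrow> circle) \<Rightarrow> circle set \<Rightarrow> circle measure"
  where "invariant_measure g Z =
    (THE M. M \<in> prob_measures \<and> measure M Z = 1 \<and> distr M borel g = M)"

definition kfsm_semi_Denjoy_topology ::
    "(circle \<Rightarrow> circle) \<Rightarrow> (real \<Rightarrow> real) \<Rightarrow> real \<Rightarrow> nat \<Rightarrow> circle set topology"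
  where "kfsm_semi_Denjoy_topology g G xm k =
    pullback_topology (kfsm_semi_Denjoy g G xm k) (invariant_measure g) weak_topology"

text \<open>The closed unit ball of \<open>d\<close>-dimensional Euclidean space; a single point for \<open>d = 0\<close>.\<close>

definition closed_disk :: "nat \<Rightarrow> (nat \<Rightarrow> real) topology"
  where "closed_disk d = subtopology (Euclidean_space d) {x. (\<Sum>i<d. (x i)\<^sup>2) \<le> 1}"

end

theory Submission
  imports Defs
begin

text \<open>
  On \<open>[0, xm]\<close> the lift expands distances, so an orbit that stays in the positive slope region is
  determined by the integer parts of its points. Conversely a sequence of integers is realised by
  pulling back along the inverse branch of \<open>G\<close>, clamped outside the range of the branch. The point
  obtained is monotone in the sequence, so it suffices to check that no clamping occurs for the
  sequences \<open>\<lfloor>n a1\<rfloor>\<close> and \<open>\<lceil>n a2\<rceil>\<close>; this follows by comparison with true orbits of rotation numbers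
  below \<open>a1\<close> and above \<open>a2\<close>. Hence coding the rotation by \<open>b\<close>, where \<open>k b\<close> is close to \<open>\<alpha>\<close>, by a
  partition of the circle into \<open>k\<close> nearly equal arcs gives a kfsm set. The \<open>k - 1\<close> free arc lengths
  are the parameters of the disk in (a); those whose arc lengths are multiples of \<open>1 / M\<close>, for the
  denominator \<open>M\<close> of \<open>b\<close>, give the periodic orbits counted in (b). If the last arc is the longest, the arcs are recovered from a single orbit,
  because a coincidence of two codings shifts one partition onto the other.
\<close>

text \<open>A kfsm set is ordered only on the \<open>k\<close>-fold cover: raising the phase
  \<open>t\<close> of a coded point \<open>X t\<close> by one moves the point by \<open>k\<close>.
  The rotation to be coded is therefore by \<open>\<alpha> / k\<close> in (a) and by the reduced
  form \<open>r / M\<close> of \<open>p / (k q)\<close> in (b). Two points of the cover could also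
  have the same projection to the circle; the largest arc excludes this, by the same argument that
  recovers the parameters. The upper bound in (b) rests on the fact that a lifted kfsm periodic
  orbit is ordered like an orbit of a rotation. Its points can be numbered in increasing order, and
  expansion makes the orbit depend only on the \<open>k - 1\<close> numbers at which it passes the
  integers between 0 and \<open>k\<close>. The topology in (a) is defined through invariant
  measures, so unique ergodicity has to be proved: the phase carries every invariant measure to one
  that is invariant under an irrational rotation. The disk is compact and integrals against
  continuous functions take values in a Hausdorff product, so continuity and injectivity of the
  family of integrals give the embedding.\<close>

lemma circle_proj_eqE:
  assumes "circle_proj x = circle_proj y"
  obtains l :: int where "y = x + of_int l"
proof -
  have "y - x \<in> \<int>"
    using assms circle_proj_eq_iff by metis
  then obtain l where "y - x = of_int l"
    by (auto elim: Ints_cases)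
  then show thesis
    by (intro that[of l]) simp
qed

lemma circle_proj_add_int [simp]: "circle_proj (x + of_int l) = circle_proj x"
  by (simp add: circle_proj_eq_iff)

lemma circle_proj_rep [simp]: "circle_proj (circle_rep z) = z"
  by (rule Quotient3_abs_rep[OF Quotient3_circle])

lemma circle_rep_projE: obtains l :: int where "circle_rep (circle_proj x) = x + of_int l"
  using circle_proj_eqE[of x "circle_rep (circle_proj x)"] by auto

lemma continuous_circle_proj: "continuous_on UNIV circle_proj"
  by (auto simp: continuous_on_open_vimage open_circle_def)

lemma continuous_circle_lift:
  fixes f :: "circle \<Rightarrow> 'a::topological_space"
  assumes "continuous_on UNIV (\<lambda>x. f (circle_proj x))"
  shows "continuous_on UNIV f"
  using assms
  by (auto simp: continuous_on_open_vimage open_circle_def vimage_def)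

lemma int_period:
  fixes f :: "int \<Rightarrow> 'a::ring_1"
  assumes "\<And>i. f (i + p) = f i + d"
  shows "f (i + p * m) = f i + d * of_int m"
proof (induction m rule: int_induct[where k = 0])
  case (step1 m)
  then show ?case
    using assms[of "i + p * m"] by (simp add: algebra_simps)
next
  case (step2 m)
  then show ?case
    using assms[of "i + p * (m - 1)"] by (simp add: algebra_simps)
qed simp

section \<open>The increasing branch of the lift and its clamped inverse\<close>

locale circle_map =
  fixes g :: "circle \<Rightarrow> circle" and G :: "real \<Rightarrow> real" and xm :: real
  assumes class_G: "class_G g G xm"
begin

lemma lift: "degree_one_lift g G"
  and xm_pos: "0 < xm" and xm_less_1: "xm < 1"
  and antimono: "antimono_on {xm..1} G"
  and G_0: "0 \<le> G 0" and G_0_less: "G 0 < G xm" and G_xm: "G xm \<le> xm + 1"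
  using class_G by (auto simp: class_G_def)

lemma G_cont: "continuous_on UNIV G" and proj_G: "circle_proj (G x) = g (circle_proj x)"
  and G_add_1: "G (x + 1) = G x + 1"
  using lift by (auto simp: degree_one_lift_def)

lemma G_add_nat: "G (x + real n) = G x + real n"
proof (induction n)
  case (Suc n)
  have "G (x + real (Suc n)) = G (x + real n + 1)"
    by (simp add: algebra_simps)
  with Suc show ?case
    by (simp add: G_add_1)
qed simp

lemma G_add_int: "G (x + of_int n) = G x + of_int n"
proof (cases "n \<ge> 0")
  case True
  then show ?thesis
    using G_add_nat[of x "nat n"] by simp
next
  case False
  then show ?thesis
    using G_add_nat[of "x + of_int n" "nat (- n)"] by simp
qed

lemma G_1: "G 1 = G 0 + 1"
  using G_add_1[of 0] by simp

lemma G_pow_add_int: "(G ^^ n) (x + of_int l) = (G ^^ n) x + of_int l"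
  by (induction n) (auto simp: G_add_int)

lemma proj_G_pow: "circle_proj ((G ^^ n) x) = (g ^^ n) (circle_proj x)"
  by (induction n) (auto simp: proj_G)

text \<open>A continuous function with positive right derivative attains its maximum only at the
  right end point; this is applied to \<open>G x - x\<close>.\<close>

lemma expanding:
  assumes "0 \<le> x" "x < y" "y \<le> xm"
  shows "y - x < G y - G x"
proof -
  define h where "h t = G t - t" for t
  have "continuous_on {x..y} h"
    unfolding h_def by (intro continuous_intros continuous_on_subset[OF G_cont]) auto
  then obtain m where m: "m \<in> {x..y}" "\<And>t. t \<in> {x..y} \<Longrightarrow> h t \<le> h m"
    using continuous_attains_sup[of "{x..y}" h] assms by auto
  have no_max: "\<exists>t\<in>{x..y}. h s < h t" if s: "x \<le> s" "s < y" for s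
  proof -
    have "s \<in> {0..<xm}"
      using s assms by auto
    then obtain D where D: "D > 1" "(G has_real_derivative D) (at_right s)"
      using class_G unfolding class_G_def by blast
    have "(h has_real_derivative (D - 1)) (at_right s)"
      unfolding h_def by (intro derivative_intros D)
    then obtain d where d: "d > 0" "\<And>e. e > 0 \<Longrightarrow> s + e \<in> {s<..} \<Longrightarrow> e < d \<Longrightarrow> h s < h (s + e)"
      using has_real_derivative_pos_inc_right[of h "D - 1" s "{s<..}"] D by auto
    define e where "e = min (d / 2) (y - s)"
    have "e > 0" "e < d" "s + e \<in> {x..y}"
      using d s by (auto simp: e_def min_def)
    then show ?thesis
      using d(2)[of e] by (intro bexI[of _ "s + e"]) auto
  qed
  have "m = y"
    using no_max[of m] m by (force simp: not_less)
  moreover obtain t where "t \<in> {x..y}" "h x < h t"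
    using no_max[of x] assms by auto
  ultimately show ?thesis
    using m(2)[of t] by (auto simp: h_def)
qed

lemma G_mono: "0 \<le> x \<Longrightarrow> x \<le> y \<Longrightarrow> y \<le> xm \<Longrightarrow> G x \<le> G y"
  using expanding[of x y] by (cases "x = y") auto

text \<open>On \<open>{xm..1}\<close> the lift falls to \<open>G 1 = G 0 + 1\<close>, on
  \<open>{0..xm}\<close> it rises from \<open>G 0\<close>. The extra unit on the decreasing arc
  allows orbits that leave the positive slope region to be compared with coded ones.\<close>

lemma G_ge_0: assumes "0 \<le> v" "v \<le> 1" shows "G 0 \<le> G v" and "xm \<le> v \<Longrightarrow> G 0 + 1 \<le> G v"
proof -
  show *: "G 0 + 1 \<le> G v" if "xm \<le> v"
    using antimono that assms xm_less_1 by (auto simp: monotone_on_def G_1[symmetric])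
  show "G 0 \<le> G v"
    using * G_mono[of 0 v] assms by (cases "v \<le> xm") auto
qed

text \<open>The increasing branch covers a full unit, so a target below \<open>G 0 + 1\<close> is
  never clamped from above, and one beyond \<open>G xm - 1\<close> never from below.\<close>

lemma G_xm_ge: "G 0 + 1 \<le> G xm"
  using G_ge_0(2)[of xm] xm_pos xm_less_1 by simp

text \<open>Counterpart of \<open>G_ge_0\<close> in the period window that starts with the
  decreasing arc.\<close>

lemma G_le_xm: assumes "xm - 1 \<le> v" "v \<le> xm" shows "G v \<le> G xm" and "v \<le> 0 \<Longrightarrow> G v \<le> G xm - 1"
proof -
  show *: "G v \<le> G xm - 1" if "v \<le> 0"
  proof -
    have "G (v + 1) \<le> G xm"
      using antimono that assms xm_less_1 by (auto simp: monotone_on_def)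
    then show ?thesis
      by (simp add: G_add_1)
  qed
  show "G v \<le> G xm"
    using * G_mono[of v xm] assms by (cases "v \<le> 0") auto
qed

text \<open>Inverse of the increasing branch, made total by clamping the target to
  \<open>[G 0, G xm]\<close>. The choice is unique because \<open>G\<close> is strictly increasing
  on \<open>{0..xm}\<close>, and clamping does not increase distances, so the inverse remains
  contracting.\<close>

definition \<phi> :: "real \<Rightarrow> real"
  where "\<phi> u = (SOME t. 0 \<le> t \<and> t \<le> xm \<and> G t = max (G 0) (min (G xm) u))"

lemma phi: "0 \<le> \<phi> u" "\<phi> u \<le> xm" "G (\<phi> u) = max (G 0) (min (G xm) u)"
proof -
  have "\<exists>t\<ge>0. t \<le> xm \<and> G t = max (G 0) (min (G xm) u)"
    using G_0_less xm_pos by (intro IVT' continuous_on_subset[OF G_cont]) auto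
  then have "\<exists>t. 0 \<le> t \<and> t \<le> xm \<and> G t = max (G 0) (min (G xm) u)"
    by auto
  from someI_ex[OF this] show "0 \<le> \<phi> u" "\<phi> u \<le> xm" "G (\<phi> u) = max (G 0) (min (G xm) u)"
    unfolding \<phi>_def by auto
qed

lemma phi_mono: assumes "u \<le> v" shows "\<phi> u \<le> \<phi> v"
proof (rule ccontr)
  assume not_le: "\<not> \<phi> u \<le> \<phi> v"
  then have "\<phi> u - \<phi> v < G (\<phi> u) - G (\<phi> v)"
    by (intro expanding) (auto simp: phi)
  also have "\<dots> \<le> 0"
    using assms by (auto simp: phi)
  finally show False
    using not_le by auto
qed

lemma phi_contract: assumes "u < v" shows "\<phi> v - \<phi> u < v - u"
proof (cases "\<phi> u < \<phi> v")
  case True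
  then have "\<phi> v - \<phi> u < G (\<phi> v) - G (\<phi> u)"
    by (intro expanding) (auto simp: phi)
  also have "\<dots> \<le> v - u"
    using assms by (auto simp: phi)
  finally show ?thesis .
qed (use assms in auto)

lemma phi_contract_abs: "u \<noteq> v \<Longrightarrow> \<bar>\<phi> u - \<phi> v\<bar> < \<bar>u - v\<bar>"
  using phi_contract[of u v] phi_contract[of v u] phi_mono[of u v] phi_mono[of v u]
  by (cases "u < v") auto

lemma phi_cont: "continuous_on UNIV \<phi>"
proof (rule continuous_onI)
  fix x e :: real assume "0 < e"
  moreover have "dist (\<phi> y) (\<phi> x) \<le> dist y x" for y
    using phi_contract_abs[of y x] by (cases "x = y") (auto simp: dist_real_def)
  ultimately show "\<exists>d>0. \<forall>x'\<in>UNIV. dist x' x < d \<longrightarrow> dist (\<phi> x') (\<phi> x) \<le> e"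
    by (intro exI[of _ e]) (auto intro: order_trans less_imp_le)
qed

section \<open>Points with prescribed itinerary\<close>

text \<open>\<open>code a\<close> is the point whose \<open>n\<close>th image should lie in \<open>[a n, a n + xm]\<close>. It is an increasing
  limit, pulled back along the clamped inverse branches.\<close>

fun approx :: "nat \<Rightarrow> (nat \<Rightarrow> int) \<Rightarrow> real"
  where "approx 0 a = of_int (a 0)"
  | "approx (Suc n) a = of_int (a 0) + \<phi> (approx n (\<lambda>i. a (Suc i)) - of_int (a 0))"

definition code :: "(nat \<Rightarrow> int) \<Rightarrow> real"
  where "code a = lim (\<lambda>n. approx n a)"

lemma approx_bounds: "of_int (a 0) \<le> approx n a" "approx n a \<le> of_int (a 0) + xm"
  using phi xm_pos by (cases n; auto)+

text \<open>The initial value is the left end of the interval prescribed for the point, so one more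
  pull-back can only raise it; \<open>\<phi>\<close> preserves this order.\<close>

lemma approx_step: "approx n a \<le> approx (Suc n) a"
proof (induction n arbitrary: a)
  case 0
  then show ?case
    using phi by simp
next
  case (Suc n)
  then show ?case
    by (auto intro!: phi_mono)
qed

lemma code_LIMSEQ: "(\<lambda>n. approx n a) \<longlonglongrightarrow> code a"
proof -
  have "convergent (\<lambda>n. approx n a)"
  proof (rule Bseq_mono_convergent)
    show "Bseq (\<lambda>n. approx n a)"
    proof (rule BseqI')
      show "norm (approx n a) \<le> \<bar>of_int (a 0)\<bar> + xm" for n
        using approx_bounds[where a = a and n = n] by (auto simp: abs_if)
    qed
    have "approx m a \<le> approx n a" if "m \<le> n" for m n
      by (rule lift_Suc_mono_le[of "\<lambda>n. approx n a", OF _ that]) (rule approx_step)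
    then show "\<forall>m. \<forall>n\<ge>m. approx m a \<le> approx n a"
      by blast
  qed
  then show ?thesis
    by (simp add: code_def convergent_LIMSEQ_iff)
qed

lemma code_bounds: "of_int (a 0) \<le> code a" "code a \<le> of_int (a 0) + xm"
  by (rule LIMSEQ_le_const[OF code_LIMSEQ], use approx_bounds in auto)
    (rule LIMSEQ_le_const2[OF code_LIMSEQ], use approx_bounds in auto)

lemma code_unfold: "code a = of_int (a 0) + \<phi> (code (\<lambda>i. a (Suc i)) - of_int (a 0))"
proof (rule LIMSEQ_unique)
  show "(\<lambda>n. approx (Suc n) a) \<longlonglongrightarrow> code a"
    by (rule LIMSEQ_Suc[OF code_LIMSEQ])
  show "(\<lambda>n. approx (Suc n) a) \<longlonglongrightarrow> of_int (a 0) + \<phi> (code (\<lambda>i. a (Suc i)) - of_int (a 0))"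
    unfolding approx.simps
    by (intro tendsto_intros code_LIMSEQ continuous_on_tendsto_compose[OF phi_cont]) auto
qed

lemma approx_add: "approx n (\<lambda>i. a i + l) = approx n a + of_int l"
  by (induction n arbitrary: a) auto

lemma code_add: "code (\<lambda>i. a i + l) = code a + of_int l"
proof (rule LIMSEQ_unique[OF code_LIMSEQ])
  show "(\<lambda>n. approx n (\<lambda>i. a i + l)) \<longlonglongrightarrow> code a + of_int l"
    unfolding approx_add by (intro tendsto_intros code_LIMSEQ)
qed

text \<open>Raising the shift from \<open>s\<close> to \<open>t\<close> lowers the argument of
  \<open>\<phi>\<close> by \<open>t - s\<close>, but contraction limits the loss in value to
  \<open>t - s\<close>. This makes \<open>code\<close> monotone although each integer enters with
  both signs.\<close>

lemma shift_phi_mono: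
  assumes "u \<le> v" "s \<le> t"
  shows "s + \<phi> (u - s) \<le> t + \<phi> (v - t)"
proof -
  have "s + \<phi> (u - s) \<le> t + \<phi> (u - t)"
    using phi_contract[of "u - t" "u - s"] assms by (cases "s = t") auto
  also have "\<phi> (u - t) \<le> \<phi> (v - t)"
    using assms by (intro phi_mono) auto
  finally show ?thesis
    by simp
qed

lemma approx_mono: "(\<And>i. a i \<le> b i) \<Longrightarrow> approx n a \<le> approx n b"
  by (induction n arbitrary: a b) (auto intro!: shift_phi_mono)

lemma code_mono: "(\<And>i. a i \<le> b i) \<Longrightarrow> code a \<le> code b"
  by (rule LIMSEQ_le[OF code_LIMSEQ code_LIMSEQ]) (auto intro: approx_mono)

text \<open>The loss of distance under \<open>\<phi>\<close> is continuous and positive on the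
  compact set of pairs at distance at least \<open>e\<close>, and \<open>\<eta>\<close> is its
  minimum.\<close>

lemma uniform_contraction:
  assumes "0 < e"
  obtains \<eta> where "0 < \<eta>" "\<And>u v. u \<in> {0..xm + 1} \<Longrightarrow> v \<in> {0..xm + 1} \<Longrightarrow> e \<le> \<bar>u - v\<bar> \<Longrightarrow>
    \<bar>\<phi> u - \<phi> v\<bar> \<le> \<bar>u - v\<bar> - \<eta>"
proof -
  define S where "S = {0..xm + 1} \<times> {0..xm + 1} \<inter> {p. e \<le> \<bar>fst p - snd p\<bar>}"
  define f where "f p = \<bar>fst p - snd p\<bar> - \<bar>\<phi> (fst p) - \<phi> (snd p)\<bar>" for p
  have "compact S"
    unfolding S_def
    by (intro compact_Int_closed compact_Times compact_Icc closed_Collect_le continuous_intros)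
  have "continuous_on S f"
    unfolding f_def
    by (intro continuous_intros continuous_on_compose2[OF phi_cont]) auto
  have pos: "0 < f p" if "p \<in> S" for p
    using phi_contract_abs[of "fst p" "snd p"] that assms by (auto simp: f_def S_def)
  show thesis
  proof (cases "S = {}")
    case True
    have "\<not> e \<le> \<bar>u - v\<bar>" if "u \<in> {0..xm + 1}" "v \<in> {0..xm + 1}" for u v
    proof
      assume "e \<le> \<bar>u - v\<bar>"
      then have "(u, v) \<in> S"
        using that by (auto simp: S_def)
      with \<open>S = {}\<close> show False
        by simp
    qed
    then show thesis
      by (intro that[of 1]) auto
  next
    case False
    then obtain p where p: "p \<in> S" "\<And>q. q \<in> S \<Longrightarrow> f p \<le> f q"
      using continuous_attains_inf[OF \<open>compact S\<close> False \<open>continuous_on S f\<close>] by auto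
    show thesis
    proof (rule that[OF pos[OF p(1)]])
      fix u v assume "u \<in> {0..xm + 1}" "v \<in> {0..xm + 1}" "e \<le> \<bar>u - v\<bar>"
      then have "f p \<le> f (u, v)"
        by (intro p(2)) (auto simp: S_def)
      then show "\<bar>\<phi> u - \<phi> v\<bar> \<le> \<bar>u - v\<bar> - f p"
        by (auto simp: f_def)
    qed
  qed
qed

text \<open>Increments 0 or 1 keep the arguments of \<open>\<phi>\<close> in
  \<open>{0..xm + 1}\<close>, the interval treated in \<open>uniform_contraction\<close>.\<close>

definition unit_steps :: "(nat \<Rightarrow> int) \<Rightarrow> bool"
  where "unit_steps a \<longleftrightarrow> (\<forall>i. a (Suc i) - a i \<in> {0, 1})"

text \<open>There need not be a uniform expansion constant, but distances of at least \<open>e\<close> shrink by a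
  fixed amount under each inverse branch.\<close>

lemma code_close:
  assumes "0 < e"
  obtains N where
    "\<And>a b. unit_steps a \<Longrightarrow> unit_steps b \<Longrightarrow> (\<And>i. i \<le> N \<Longrightarrow> a i = b i) \<Longrightarrow> \<bar>code a - code b\<bar> < e"
proof -
  obtain \<eta> where \<eta>: "0 < \<eta>" "\<And>u v. u \<in> {0..xm + 1} \<Longrightarrow> v \<in> {0..xm + 1} \<Longrightarrow> e \<le> \<bar>u - v\<bar> \<Longrightarrow>
    \<bar>\<phi> u - \<phi> v\<bar> \<le> \<bar>u - v\<bar> - \<eta>"
    using uniform_contraction[OF assms] by blast
  \<comment> \<open>Each common symbol either leaves the distance below \<open>e\<close>, where it
    stays because \<open>\<phi>\<close> does not expand, or removes another \<open>\<eta>\<close>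
    from the initial bound 1.\<close>
  have key: "\<bar>code a - code b\<bar> < e \<or> \<bar>code a - code b\<bar> \<le> 1 - real N * \<eta>"
    if "unit_steps a" "unit_steps b" "\<And>i. i \<le> N \<Longrightarrow> a i = b i" for a b N
    using that
  proof (induction N arbitrary: a b)
    case 0
    then show ?case
      using code_bounds[of a] code_bounds[of b] xm_less_1 by auto
  next
    case (Suc N)
    define a' b' where "a' i = a (Suc i)" and "b' i = b (Suc i)" for i
    define u v where "u = code a' - of_int (a 0)" and "v = code b' - of_int (a 0)"
    have IH: "\<bar>code a' - code b'\<bar> < e \<or> \<bar>code a' - code b'\<bar> \<le> 1 - real N * \<eta>"
      using Suc.prems by (intro Suc.IH) (auto simp: a'_def b'_def unit_steps_def)
    have ab: "a 0 = b 0" "a' 0 - a 0 \<in> {0, 1}" "b' 0 - a 0 \<in> {0, 1}"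
      using Suc.prems(1,2)[unfolded unit_steps_def, rule_format, of 0] Suc.prems(3)[of 0]
      by (auto simp: a'_def b'_def)
    have codes: "code a = of_int (a 0) + \<phi> u" "code b = of_int (a 0) + \<phi> v"
      using code_unfold[of a] code_unfold[of b] ab(1) by (simp_all add: u_def v_def a'_def[abs_def] b'_def[abs_def])
    have "of_int (a' 0) - of_int (a 0) \<in> {0, 1::real}" "of_int (b' 0) - of_int (a 0) \<in> {0, 1::real}"
      using ab(2,3) by (auto simp flip: of_int_diff)
    then have uv: "u \<in> {0..xm + 1}" "v \<in> {0..xm + 1}"
      using code_bounds[of a'] code_bounds[of b'] by (auto simp: u_def v_def)
    have le: "\<bar>\<phi> u - \<phi> v\<bar> \<le> \<bar>u - v\<bar>"
      using phi_contract_abs[of u v] by (cases "u = v") auto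
    have uv_eq: "u - v = code a' - code b'" "code a - code b = \<phi> u - \<phi> v"
      by (auto simp: u_def v_def codes)
    show ?case
    proof (cases "\<bar>u - v\<bar> < e")
      case True
      then show ?thesis
        using le uv_eq by linarith
    next
      case False
      then show ?thesis
        using \<eta>(2)[OF uv] IH uv_eq by (auto simp: algebra_simps)
    qed
  qed
  obtain N where N: "1 < real N * \<eta>"
    using reals_Archimedean3[OF \<eta>(1)] by blast
  show thesis
  proof (rule that[of N])
    fix a b :: "nat \<Rightarrow> int"
    assume "unit_steps a" "unit_steps b" "\<And>i. i \<le> N \<Longrightarrow> a i = b i"
    then have "\<bar>code a - code b\<bar> < e \<or> \<bar>code a - code b\<bar> \<le> 1 - real N * \<eta>"
      by (intro key)
    then show "\<bar>code a - code b\<bar> < e"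
      using N by (auto split: if_splits)
  qed
qed

end

lemma LIMSEQ_affine_over_n: "(\<lambda>n. (C + real n * a) / real n) \<longlonglongrightarrow> a"
proof -
  have "(\<lambda>n. C / real n + a) \<longlonglongrightarrow> 0 + a"
    by (intro tendsto_intros lim_const_over_n)
  moreover have "eventually (\<lambda>n. C / real n + a = (C + real n * a) / real n) sequentially"
    using eventually_gt_at_top[of 0] by eventually_elim (auto simp: field_simps)
  ultimately show ?thesis
    using Lim_transform_eventually by fastforce
qed

lemma LIMSEQ_affine_sandwich:
  assumes "\<And>n. C + real n * a \<le> f n" "\<And>n. f n \<le> C' + real n * a"
  shows "(\<lambda>n. f n / real n) \<longlonglongrightarrow> a"
proof (rule real_tendsto_sandwich)
  show "\<forall>\<^sub>F n in sequentially. (C + real n * a) / real n \<le> f n / real n"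
    "\<forall>\<^sub>F n in sequentially. f n / real n \<le> (C' + real n * a) / real n"
    by (intro always_eventually allI divide_right_mono assms; simp)+
qed (rule LIMSEQ_affine_over_n)+

context circle_map
begin

lemma G_clamped_inverse: "G 0 \<le> u \<Longrightarrow> u \<le> G xm \<Longrightarrow> G (\<phi> u) = u"
  by (simp add: phi)

section \<open>Realising itineraries below and above a given rotation number\<close>

text \<open>If the clamping were active, the coded orbit of slope \<open>a\<close> would stay below every orbit of \<open>G\<close>
  that starts above it.\<close>

lemma code_floor_ge:
  assumes "w \<in> rotation_set G" "w < a"
  shows "G 0 \<le> code (\<lambda>n. \<lfloor>real (Suc n) * a\<rfloor>)"
proof (rule ccontr)
  \<comment> \<open>With a real phase \<open>t\<close>, one function contains all shifts of the
    sequence: \<open>X (t + a)\<close> codes the tail of the sequence of \<open>X t\<close>.\<close>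
  define X where "X t = code (\<lambda>n. \<lfloor>t + real n * a\<rfloor>)" for t
  assume "\<not> ?thesis"
  moreover have "code (\<lambda>n. \<lfloor>real (Suc n) * a\<rfloor>) = X a"
    by (simp add: X_def algebra_simps)
  ultimately have less: "X a < G 0"
    by simp
  have X_mono: "X s \<le> X t" if "s \<le> t" for s t
    unfolding X_def using that by (intro code_mono floor_mono) auto
  have X_int: "X (t + of_int l) = X t + of_int l" for t l
  proof -
    have "\<lfloor>t + of_int l + real n * a\<rfloor> = \<lfloor>t + real n * a\<rfloor> + l" for n
      using floor_add_int[of "t + real n * a" l] by (simp add: algebra_simps)
    then show ?thesis
      by (simp add: X_def code_add)
  qed
  have X_unfold: "X t = of_int \<lfloor>t\<rfloor> + \<phi> (X (t + a) - of_int \<lfloor>t\<rfloor>)" for t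
    unfolding X_def by (subst code_unfold) (simp add: algebra_simps)
  \<comment> \<open>Domination by \<open>y\<close> passes to the images. If \<open>y\<close> lies in
    the unit interval of \<open>X t\<close>, the increasing branch or the bound on the decreasing
    arc applies; if it lies in a later one, \<open>G y\<close> is at least
    \<open>of_int j + G 0 + 1\<close>.\<close>
  have step: "X (t + a) \<le> G y" if "X t \<le> y" for t y
  proof -
    define j where "j = \<lfloor>t\<rfloor>"
    define u where "u = X (t + a) - of_int j"
    have Xt: "X t = of_int j + \<phi> u"
      using X_unfold[of t] by (simp add: u_def j_def)
    \<comment> \<open>Here the assumption \<open>X a < G 0\<close> enters: it keeps the target below
      \<open>G 0 + 1\<close>, so only the lower clamp can be active.\<close>
    have "X (t + a) \<le> X (a + of_int (j + 1))"
      using floor_correct[of t] by (intro X_mono) (simp add: j_def)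
    then have u_less: "u < G 0 + 1"
      using less unfolding X_int by (simp add: u_def)
    define m v where "m = \<lfloor>y\<rfloor>" and "v = y - of_int \<lfloor>y\<rfloor>"
    have v: "0 \<le> v" "v < 1" and y: "y = v + of_int m"
      unfolding v_def m_def by linarith+
    have Gy: "G y = G v + of_int m"
      by (simp add: y G_add_int)
    have "of_int j \<le> y"
      using that Xt phi(1)[of u] by simp
    then have "j \<le> m"
      by (simp add: m_def le_floor_iff)
    show ?thesis
    proof (cases "j = m")
      case True
      have phi_le: "\<phi> u \<le> v"
        using that Xt y True by simp
      have "u \<le> G v"
      proof (cases "v \<le> xm")
        case True
        have "u \<le> G (\<phi> u)"
          using u_less G_xm_ge by (simp add: phi)
        also have "\<dots> \<le> G v"
          using phi phi_le True by (intro G_mono) auto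
        finally show ?thesis .
      next
        case False
        then show ?thesis
          using G_ge_0(2)[of v] v u_less by simp
      qed
      then show ?thesis
        using Gy True by (simp add: u_def)
    next
      case False
      then have "of_int j + 1 \<le> real_of_int m"
        using \<open>j \<le> m\<close> by linarith
      then show ?thesis
        using G_ge_0(1)[of v] v u_less Gy by (simp add: u_def)
    qed
  qed
  obtain z where z: "(\<lambda>n. ((G ^^ n) z - z) / real n) \<longlonglongrightarrow> w"
    using assms by (auto simp: rotation_set_def has_rotation_number_def)
  \<comment> \<open>The extra \<open>- 1\<close> makes room for \<open>X t0\<close>, which may lie
    anywhere in \<open>[t0, t0 + xm]\<close>.\<close>
  define t0 :: real where "t0 = of_int (\<lfloor>z\<rfloor> - 1)"
  have orbit: "X (t0 + real n * a) \<le> (G ^^ n) z" for n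
  proof (induction n)
    case 0
    have "X t0 \<le> of_int \<lfloor>t0\<rfloor> + xm"
      using code_bounds(2)[of "\<lambda>n. \<lfloor>t0 + real n * a\<rfloor>"] by (simp add: X_def)
    also have "\<dots> \<le> z"
      using xm_less_1 unfolding t0_def by simp linarith
    finally show ?case
      by simp
  next
    case (Suc n)
    from step[OF this] show ?case
      by (simp add: algebra_simps)
  qed
  have "(t0 - 1 - z) + real n * a \<le> (G ^^ n) z - z" for n
  proof -
    have "t0 + real n * a - 1 \<le> of_int \<lfloor>t0 + real n * a\<rfloor>"
      by linarith
    also have "\<dots> \<le> X (t0 + real n * a)"
      using code_bounds(1)[of "\<lambda>m. \<lfloor>t0 + real n * a + real m * a\<rfloor>"] by (simp add: X_def)
    finally show ?thesis
      using orbit[of n] by simp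
  qed
  then have "((t0 - 1 - z) + real n * a) / real n \<le> ((G ^^ n) z - z) / real n" for n
    by (intro divide_right_mono) auto
  then have "a \<le> w"
    by (intro LIMSEQ_le[OF LIMSEQ_affine_over_n z]) auto
  with assms show False
    by simp
qed

text \<open>Counterpart of \<open>code_floor_ge\<close>: if the upper clamp were active, the coded
  orbit of slope \<open>a\<close> would stay above an orbit of rotation number \<open>w > a\<close>.
  The pieces are now closed on the right, hence the index
  \<open>\<lceil>t\<rceil> - 1\<close>.\<close>

lemma code_ceiling_le:
  assumes "w \<in> rotation_set G" "a < w"
  shows "code (\<lambda>n. \<lceil>real (Suc n) * a\<rceil>) \<le> G xm"
proof (rule ccontr)
  define X where "X t = code (\<lambda>n. \<lceil>t + real n * a\<rceil> - 1)" for t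
  have X_mono: "X s \<le> X t" if "s \<le> t" for s t
    unfolding X_def using that by (intro code_mono diff_mono ceiling_mono) auto
  have X_int: "X (t + of_int l) = X t + of_int l" for t l
  proof -
    have "\<lceil>t + of_int l + real n * a\<rceil> - 1 = \<lceil>t + real n * a\<rceil> - 1 + l" for n
      using ceiling_add_of_int[of "t + real n * a" l] by (simp add: algebra_simps)
    then show ?thesis
      by (simp only: X_def code_add)
  qed
  have X_unfold: "X t = of_int (\<lceil>t\<rceil> - 1) + \<phi> (X (t + a) - of_int (\<lceil>t\<rceil> - 1))" for t
    unfolding X_def by (subst code_unfold) (simp add: algebra_simps)
  assume "\<not> ?thesis"
  moreover have "code (\<lambda>n. \<lceil>real (Suc n) * a\<rceil>) = X (a + of_int 1)"
  proof -
    have "\<lceil>a + of_int 1 + real n * a\<rceil> - 1 = \<lceil>real (Suc n) * a\<rceil>" for n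
      using ceiling_add_of_int[of "real (Suc n) * a" 1] by (simp add: algebra_simps)
    then show ?thesis
      by (simp only: X_def)
  qed
  ultimately have less: "G xm < X a + 1"
    unfolding X_int by simp
  have step: "G y \<le> X (t + a)" if "y \<le> X t" for t y
  proof -
    define j where "j = \<lceil>t\<rceil> - 1"
    define u where "u = X (t + a) - of_int j"
    have Xt: "X t = of_int j + \<phi> u"
      using X_unfold[of t] by (simp add: u_def j_def)
    have "X (a + of_int j) \<le> X (t + a)"
      using ceiling_correct[of t] by (intro X_mono) (simp add: j_def)
    then have u_less: "G xm - 1 < u"
      using less unfolding X_int by (simp add: u_def)
    \<comment> \<open>The representative \<open>v\<close> is taken in \<open>(xm - 1, xm]\<close>,
      so that a point of the decreasing arc counts as preceding the increasing branch.\<close>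
    define m v where "m = \<lceil>y - xm\<rceil>" and "v = y - of_int \<lceil>y - xm\<rceil>"
    have v: "xm - 1 < v" "v \<le> xm" and y: "y = v + of_int m"
      unfolding v_def m_def by linarith+
    have Gy: "G y = G v + of_int m"
      by (simp add: y G_add_int)
    have "y - xm \<le> of_int j"
      using that Xt phi(2)[of u] by simp
    then have "m \<le> j"
      by (simp add: m_def ceiling_le_iff)
    show ?thesis
    proof (cases "j = m")
      case True
      have phi_le: "v \<le> \<phi> u"
        using that Xt y True by simp
      have "G v \<le> u"
      proof (cases "0 \<le> v")
        case True
        have "G v \<le> G (\<phi> u)"
          using phi phi_le True by (intro G_mono) auto
        also have "\<dots> \<le> u"
          using u_less G_xm_ge by (simp add: phi)
        finally show ?thesis .
      next
        case False
        then show ?thesis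
          using G_le_xm(2)[of v] v u_less by simp
      qed
      then show ?thesis
        using Gy True by (simp add: u_def)
    next
      case False
      then have "real_of_int m + 1 \<le> of_int j"
        using \<open>m \<le> j\<close> by linarith
      then show ?thesis
        using G_le_xm(1)[of v] v u_less Gy by (simp add: u_def)
    qed
  qed
  obtain z where z: "(\<lambda>n. ((G ^^ n) z - z) / real n) \<longlonglongrightarrow> w"
    using assms by (auto simp: rotation_set_def has_rotation_number_def)
  define t0 :: real where "t0 = of_int (\<lceil>z\<rceil> + 1)"
  have orbit: "(G ^^ n) z \<le> X (t0 + real n * a)" for n
  proof (induction n)
    case 0
    have "z \<le> of_int (\<lceil>t0\<rceil> - 1)"
      unfolding t0_def by simp
    also have "\<dots> \<le> X t0"
      using code_bounds(1)[of "\<lambda>n. \<lceil>t0 + real n * a\<rceil> - 1"] by (simp add: X_def)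
    finally show ?case
      by simp
  next
    case (Suc n)
    from step[OF this] show ?case
      by (simp add: algebra_simps)
  qed
  have "(G ^^ n) z - z \<le> (t0 + 1 - z) + real n * a" for n
  proof -
    have "X (t0 + real n * a) \<le> of_int (\<lceil>t0 + real n * a\<rceil> - 1) + xm"
      using code_bounds(2)[of "\<lambda>m. \<lceil>t0 + real n * a + real m * a\<rceil> - 1"] by (simp add: X_def)
    also have "\<dots> \<le> t0 + real n * a + 1"
      using xm_less_1 by simp linarith
    finally show ?thesis
      using orbit[of n] by simp
  qed
  then have "((G ^^ n) z - z) / real n \<le> ((t0 + 1 - z) + real n * a) / real n" for n
    by (intro divide_right_mono) auto
  then have "w \<le> a"
    by (intro LIMSEQ_le[OF z LIMSEQ_affine_over_n]) auto
  with assms show False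
    by simp
qed

lemma G_floor_ge: "of_int j \<le> y \<Longrightarrow> of_int j \<le> G y"
proof -
  assume "of_int j \<le> y"
  then have "j \<le> \<lfloor>y\<rfloor>"
    by (simp add: le_floor_iff)
  moreover have "G y = G (y - of_int \<lfloor>y\<rfloor>) + of_int \<lfloor>y\<rfloor>"
    using G_add_int[of "y - of_int \<lfloor>y\<rfloor>" "\<lfloor>y\<rfloor>"] by simp
  moreover have "0 \<le> G (y - of_int \<lfloor>y\<rfloor>)"
    using G_ge_0(1)[of "y - of_int \<lfloor>y\<rfloor>"] G_0 by linarith
  ultimately show ?thesis
    by linarith
qed

lemma G_le_add_1: "y \<le> of_int j + xm \<Longrightarrow> G y \<le> of_int (j + 1) + xm"
proof -
  assume "y \<le> of_int j + xm"
  define m where "m = \<lceil>y - xm\<rceil>"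
  have "m \<le> j"
    using \<open>y \<le> of_int j + xm\<close> by (simp add: m_def ceiling_le_iff)
  moreover have "G y = G (y - of_int m) + of_int m"
    using G_add_int[of "y - of_int m" m] by simp
  moreover have "G (y - of_int m) \<le> xm + 1"
    using G_le_xm(1)[of "y - of_int m"] G_xm unfolding m_def by linarith
  ultimately show ?thesis
    by simp
qed

text \<open>No orbit crosses an integer downwards, and the bound \<open>of_int j + xm\<close> on an
  orbit point grows by at most one per step. Slopes confined to \<open>[0, 1]\<close> later give
  sequences with increments 0 and 1.\<close>

lemma rotation_set_bounds: assumes "w \<in> rotation_set G" shows "0 \<le> w" "w \<le> 1"
proof -
  obtain z where z: "(\<lambda>n. ((G ^^ n) z - z) / real n) \<longlonglongrightarrow> w"
    using assms by (auto simp: rotation_set_def has_rotation_number_def)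
  define j where "j = \<lfloor>z\<rfloor>"
  have lo: "of_int j \<le> (G ^^ n) z" for n
    by (induction n) (auto simp: j_def intro: G_floor_ge)
  have hi: "(G ^^ n) z \<le> of_int (j + 1 + int n) + xm" for n
  proof (induction n)
    case 0
    then show ?case
      using xm_pos by (simp add: j_def) linarith
  next
    case (Suc n)
    from G_le_add_1[OF this] show ?case
      by (simp add: algebra_simps)
  qed
  have "((of_int j - z) + real n * 0) / real n \<le> ((G ^^ n) z - z) / real n" for n
    using lo by (intro divide_right_mono) auto
  then show "0 \<le> w"
    by (intro LIMSEQ_le[OF LIMSEQ_affine_over_n z]) auto
  have "((G ^^ n) z - z) / real n \<le> ((of_int j + 1 + xm - z) + real n * 1) / real n" for n
    using hi[of n] by (intro divide_right_mono) (auto simp: algebra_simps)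
  then show "w \<le> 1"
    by (intro LIMSEQ_le[OF z LIMSEQ_affine_over_n]) auto
qed

text \<open>The two extreme sequences, slope \<open>a1\<close> rounded down and slope
  \<open>a2\<close> rounded up, avoid the clamps; by monotonicity so does every sequence squeezed
  between them.\<close>

definition slopes :: "real \<Rightarrow> real \<Rightarrow> bool"
  where "slopes a1 a2 \<longleftrightarrow> G 0 \<le> code (\<lambda>n. \<lfloor>real (Suc n) * a1\<rfloor>) \<and>
    code (\<lambda>n. \<lceil>real (Suc n) * a2\<rceil>) \<le> G xm \<and> 0 \<le> a1 \<and> a2 \<le> 1"

text \<open>Relative to \<open>a 0\<close>, the tail of \<open>a\<close> lies between the tails of
  \<open>L\<close> and \<open>U\<close>, so by \<open>code_mono\<close> its code lies in the range
  of the branch, where \<open>\<phi>\<close> is a genuine inverse.\<close>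

lemma G_code:
  assumes "G 0 \<le> code (\<lambda>n. L (Suc n))" "code (\<lambda>n. U (Suc n)) \<le> G xm"
    and "\<And>n. L n \<le> a n - a 0" "\<And>n. a n - a 0 \<le> U n"
  shows "G (code a) = code (\<lambda>n. a (Suc n))"
proof -
  define u where "u = code (\<lambda>n. a (Suc n)) - of_int (a 0)"
  have u: "u = code (\<lambda>n. a (Suc n) - a 0)"
    using code_add[of "\<lambda>n. a (Suc n)" "- a 0"] by (simp add: u_def)
  have "code (\<lambda>n. L (Suc n)) \<le> u" "u \<le> code (\<lambda>n. U (Suc n))"
    unfolding u using assms(3,4) by (intro code_mono; simp)+
  then have "G (\<phi> u) = u"
    using assms(1,2) by (intro G_clamped_inverse) auto
  then show ?thesis
    using code_unfold[of a] G_add_int[of "\<phi> u" "a 0"] by (simp add: u_def add.commute)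
qed

end

section \<open>Periodic partitions of the line\<close>

locale partition =
  fixes c :: "int \<Rightarrow> real" and k :: nat
  assumes c_mono: "strict_mono c" and k_pos: "k > 0" and c_add_k: "c (n + int k) = c n + 1"
begin

text \<open>Index of the piece \<open>[c n, c (n + 1))\<close> containing \<open>t\<close>; it takes
  the place of the floor function.\<close>

definition J :: "real \<Rightarrow> int"
  where "J t = Sup {n. c n \<le> t}"

lemma c_add_mult: "c (n + int k * m) = c n + of_int m"
  using int_period[of c "int k" 1 n m] by (simp add: c_add_k)

text \<open>A nonempty set of integers that is bounded above contains its supremum; the periodicity
  of \<open>c\<close> supplies an element and a bound. \<open>J\<close> is used almost only through
  this Galois property.\<close>

lemma le_J_iff: "n \<le> J t \<longleftrightarrow> c n \<le> t"
proof -
  define S where "S = {n. c n \<le> t}"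
  have "c (0 + int k * \<lfloor>t - c 0\<rfloor>) \<le> t"
    unfolding c_add_mult by linarith
  then have ne: "S \<noteq> {}"
    by (auto simp: S_def)
  have "n \<le> int k * (\<lfloor>t - c 0\<rfloor> + 1)" if "n \<in> S" for n
  proof (rule ccontr)
    assume "\<not> ?thesis"
    then have "c (0 + int k * (\<lfloor>t - c 0\<rfloor> + 1)) < c n"
      using c_mono by (simp add: strict_mono_def)
    then show False
      using that unfolding c_add_mult S_def by simp linarith
  qed
  then have bdd: "bdd_above S"
    by (auto simp: bdd_above_def)
  have "\<exists>n\<in>S. Sup S - 1 < n"
    using less_cSup_iff[OF ne bdd, of "Sup S - 1"] by simp
  then obtain n0 where n0: "n0 \<in> S" "Sup S - 1 < n0"
    by blast
  have "n0 \<le> Sup S"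
    using n0(1) bdd by (rule cSup_upper)
  with n0(2) have "n0 = Sup S"
    by linarith
  with n0(1) have "Sup S \<in> S"
    by simp
  then have J: "c (J t) \<le> t"
    by (simp add: J_def S_def)
  show ?thesis
  proof
    assume "n \<le> J t"
    then show "c n \<le> t"
      using J strict_mono_less_eq[OF c_mono, of n "J t"] by simp
  next
    assume "c n \<le> t"
    then show "n \<le> J t"
      using bdd by (auto simp: J_def S_def intro: cSup_upper)
  qed
qed

lemma J_eqI: "c n \<le> t \<Longrightarrow> t < c (n + 1) \<Longrightarrow> J t = n"
  using le_J_iff[of n t] le_J_iff[of "n + 1" t] by linarith

lemma J_bounds: "c (J t) \<le> t" "t < c (J t + 1)"
  using le_J_iff[of "J t" t] le_J_iff[of "J t + 1" t] by auto

lemma J_mono: "s \<le> t \<Longrightarrow> J s \<le> J t"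
  using le_J_iff[of "J s" t] J_bounds(1)[of s] by linarith

lemma J_add_int: "J (t + of_int m) = J t + int k * m"
  using J_bounds[of t] c_add_mult[of "J t" m] c_add_mult[of "J t + 1" m]
  by (intro J_eqI) (auto simp: algebra_simps)

lemma J_c: "J (c n) = n"
  using c_mono by (intro J_eqI) (auto simp: strict_mono_def)

lemma J_right_const: "t \<le> s \<Longrightarrow> s < c (J t + 1) \<Longrightarrow> J s = J t"
  using J_bounds(1)[of t] by (intro J_eqI) auto

end

section \<open>Coding a rotation by a partition\<close>

text \<open>The rotation by \<open>b\<close> of the circle of length one is coded by the partition \<open>c\<close>, whose \<open>k\<close> pieces
  per unit correspond to the consecutive unit intervals of the \<open>k\<close>-fold cover on which \<open>G\<close> acts.
  The constants \<open>a1\<close>, \<open>a2\<close> are realisable slopes on both sides of \<open>k b\<close>.\<close>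

locale coding = circle_map g G xm + partition c k
  for g :: "circle \<Rightarrow> circle" and G :: "real \<Rightarrow> real" and xm :: real
    and c :: "int \<Rightarrow> real" and k :: nat +
  fixes b a1 a2 e :: real
  assumes slopes: "slopes a1 a2"
    and near: "\<bar>c n - of_int n / real k\<bar> \<le> e"
    and slope: "a1 \<le> real k * b - 2 * real k * e" "real k * b + 2 * real k * e \<le> a2"
begin

lemma lower: "G 0 \<le> code (\<lambda>n. \<lfloor>real (Suc n) * a1\<rfloor>)"
  and upper: "code (\<lambda>n. \<lceil>real (Suc n) * a2\<rceil>) \<le> G xm"
  and a1_nonneg: "0 \<le> a1" and a2_le_1: "a2 \<le> 1"
  using slopes unfolding slopes_def by blast+

lemma e_nonneg: "0 \<le> e"
  using near[of 0] by linarith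

lemma near': "c n \<le> of_int n / real k + e" "of_int n / real k - e \<le> c n"
  using near[of n] by linarith+

text \<open>The two cuts involved differ from equally spaced ones by at most \<open>e\<close> each,
  which costs \<open>2 * real k * e\<close> in the index. The margin in \<open>slope\<close> pays
  this once per step, hence the separate case \<open>n = 0\<close>.\<close>

lemma J_diff_ge: "\<lfloor>real n * a1\<rfloor> \<le> J (t + real n * b) - J t"
proof (cases "n = 0")
  case False
  have "c (J t + \<lfloor>real n * a1\<rfloor>) \<le> of_int (J t + \<lfloor>real n * a1\<rfloor>) / real k + e"
    by (rule near')
  also have "\<dots> \<le> (of_int (J t) + real n * (real k * b - 2 * real k * e)) / real k + e"
  proof (intro add_mono divide_right_mono order_refl)
    have "of_int \<lfloor>real n * a1\<rfloor> \<le> real n * a1"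
      by linarith
    also have "\<dots> \<le> real n * (real k * b - 2 * real k * e)"
      using slope by (intro mult_left_mono) auto
    finally show "real_of_int (J t + \<lfloor>real n * a1\<rfloor>) \<le> real_of_int (J t) + real n * (real k * b - 2 * real k * e)"
      by simp
  qed auto
  also have "\<dots> = of_int (J t) / real k - e + real n * b + 2 * (1 - real n) * e"
    using k_pos by (simp add: field_simps)
  also have "2 * (1 - real n) * e \<le> 0"
    using mult_nonneg_nonneg[of "real n - 1" e] False e_nonneg by (simp add: algebra_simps)
  also have "of_int (J t) / real k - e + real n * b + 0 \<le> t + real n * b"
    using near'(2)[of "J t"] J_bounds(1)[of t] by simp
  finally show ?thesis
    using le_J_iff[of "J t + \<lfloor>real n * a1\<rfloor>" "t + real n * b"] by simp
qed simp

lemma J_diff_le: "J (t + real n * b) - J t \<le> \<lceil>real n * a2\<rceil>"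
proof (cases "n = 0")
  case False
  have "t + real n * b < of_int (J t + 1) / real k + e + real n * b"
    using near'(1)[of "J t + 1"] J_bounds(2)[of t] by simp
  also have "\<dots> \<le> of_int (J t + 1) / real k + e + real n * b + 2 * (real n - 1) * e"
    using False e_nonneg by simp
  also have "\<dots> = (of_int (J t + 1) + real n * (real k * b + 2 * real k * e)) / real k - e"
    using k_pos by (simp add: field_simps)
  also have "\<dots> \<le> of_int (J t + 1 + \<lceil>real n * a2\<rceil>) / real k - e"
  proof (intro diff_mono divide_right_mono order_refl)
    have "real n * (real k * b + 2 * real k * e) \<le> real n * a2"
      using slope by (intro mult_left_mono) auto
    also have "\<dots> \<le> of_int \<lceil>real n * a2\<rceil>"
      by linarith
    finally show "real_of_int (J t + 1) + real n * (real k * b + 2 * real k * e) \<le>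
        real_of_int (J t + 1 + \<lceil>real n * a2\<rceil>)"
      by simp
  qed auto
  also have "\<dots> \<le> c (J t + 1 + \<lceil>real n * a2\<rceil>)"
    by (rule near')
  finally show ?thesis
    using le_J_iff[of "J t + 1 + \<lceil>real n * a2\<rceil>" "t + real n * b"] by linarith
qed simp

lemma J_step: "J (t + b) - J t \<in> {0, 1}"
proof -
  have "0 \<le> \<lfloor>a1\<rfloor>" "\<lceil>a2\<rceil> \<le> 1"
    using a1_nonneg a2_le_1 by (auto simp: ceiling_le_iff)
  then have "0 \<le> J (t + b) - J t" "J (t + b) - J t \<le> 1"
    using J_diff_ge[of 1 t] J_diff_le[of t 1] by (simp_all, linarith+)
  then show ?thesis
    by auto
qed

lemma unit_steps_J: "unit_steps (\<lambda>i. J (t + real i * b))"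
  unfolding unit_steps_def
proof
  show "J (t + real (Suc i) * b) - J (t + real i * b) \<in> {0, 1}" for i
    using J_step[of "t + real i * b"] by (simp add: algebra_simps)
qed

text \<open>Semiconjugacy from the translation \<open>t \<mapsto> t + b\<close> to \<open>G\<close>,
  see \<open>G_X\<close>; translation by 1 in the phase becomes translation by
  \<open>k\<close>.\<close>

definition X :: "real \<Rightarrow> real"
  where "X t = code (\<lambda>n. J (t + real n * b))"

lemma X_bounds: "of_int (J t) \<le> X t" "X t \<le> of_int (J t) + xm"
  using code_bounds[of "\<lambda>n. J (t + real n * b)"] by (auto simp: X_def)

text \<open>As \<open>xm < 1\<close>, the piece index can be read off the point. Every later
  recovery of parameters starts from this.\<close>

lemma floor_X: "\<lfloor>X t\<rfloor> = J t"
  using X_bounds[of t] xm_less_1 by linarith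

lemma G_X: "G (X t) = X (t + b)"
proof -
  have "G (X t) = code (\<lambda>n. J (t + real (Suc n) * b))"
    unfolding X_def using J_diff_ge[of _ t] J_diff_le[of t]
    by (intro G_code[OF lower upper]) auto
  then show ?thesis
    by (simp add: X_def algebra_simps)
qed

lemma G_pow_X: "(G ^^ n) (X t) = X (t + real n * b)"
  by (induction n) (auto simp: G_X algebra_simps)

lemma X_mono: "s \<le> t \<Longrightarrow> X s \<le> X t"
  unfolding X_def by (intro code_mono J_mono) auto

lemma X_add_int: "X (t + of_int m) = X t + real k * of_int m"
proof -
  have "J (t + of_int m + real n * b) = J (t + real n * b) + int k * m" for n
    using J_add_int[of "t + real n * b" m] by (simp add: algebra_simps)
  then show ?thesis
    by (simp add: X_def code_add)
qed

text \<open>Pieces are closed on the left, so a small move of \<open>t\<close> to the right changes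
  none of the first \<open>N + 1\<close> indices. From the left, \<open>X\<close> may jump at phases
  whose rotation orbit meets a cut.\<close>

lemma X_right_cont:
  assumes "0 < \<epsilon>"
  obtains d where "0 < d" "\<And>s. t \<le> s \<Longrightarrow> s < t + d \<Longrightarrow> \<bar>X s - X t\<bar> < \<epsilon>"
proof -
  obtain N where N:
    "\<And>a b. unit_steps a \<Longrightarrow> unit_steps b \<Longrightarrow> (\<And>i. i \<le> N \<Longrightarrow> a i = b i) \<Longrightarrow> \<bar>code a - code b\<bar> < \<epsilon>"
    using code_close[OF assms] by blast
  define d where "d = Min ((\<lambda>i. c (J (t + real i * b) + 1) - (t + real i * b)) ` {..N})"
  show thesis
  proof (rule that[of d])
    show "0 < d"
      unfolding d_def using J_bounds(2) by (subst Min_gr_iff) auto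
    fix s assume s: "t \<le> s" "s < t + d"
    show "\<bar>X s - X t\<bar> < \<epsilon>"
      unfolding X_def
    proof (intro N unit_steps_J)
      fix i assume "i \<le> N"
      then have "d \<le> c (J (t + real i * b) + 1) - (t + real i * b)"
        unfolding d_def by (intro Min_le) auto
      with s show "J (s + real i * b) = J (t + real i * b)"
        by (intro J_right_const) auto
    qed
  qed
qed

lemma X_affine_bounds: "real k * (t - e) - 1 \<le> X t" "X t \<le> real k * (t + e) + 1"
proof -
  have "of_int (J t) / real k \<le> t + e" "t - e \<le> of_int (J t + 1) / real k"
    using near'(2)[of "J t"] near'(1)[of "J t + 1"] J_bounds[of t] by linarith+
  then have "of_int (J t) \<le> real k * (t + e)" "real k * (t - e) \<le> of_int (J t + 1)"
    using k_pos by (auto simp: field_simps)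
  then show "real k * (t - e) - 1 \<le> X t" "X t \<le> real k * (t + e) + 1"
    using X_bounds[of t] xm_less_1 by auto
qed

lemma X_rotation: "(\<lambda>n. ((G ^^ n) (X t) - X t) / real n) \<longlonglongrightarrow> real k * b"
proof (rule LIMSEQ_affine_sandwich)
  fix n
  show "(real k * (t - e) - 1 - X t) + real n * (real k * b) \<le> (G ^^ n) (X t) - X t"
    "(G ^^ n) (X t) - X t \<le> (real k * (t + e) + 1 - X t) + real n * (real k * b)"
    unfolding G_pow_X using X_affine_bounds[of "t + real n * b"] by (simp_all add: algebra_simps)
qed

lemma X_in_region: "(g ^^ n) (circle_proj (X t)) \<in> circle_proj ` {0..xm}"
proof -
  have "circle_proj (X s) \<in> circle_proj ` {0..xm}" for s
  proof
    show "circle_proj (X s) = circle_proj (X s - of_int (J s))"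
      by (simp add: circle_proj_eq_iff)
    show "X s - of_int (J s) \<in> {0..xm}"
      using X_bounds[of s] by simp
  qed
  then show ?thesis
    by (metis proj_G_pow G_pow_X)
qed

end

section \<open>Partitions with a largest last gap\<close>

text \<open>The gaps of the partition are \<open>v 0, \<dots>, v (k - 2)\<close> and a last one that makes the period one.
  Choosing all \<open>v i\<close> below \<open>1 / k\<close> breaks the cyclic symmetry of the parametrisation.\<close>

definition cuts :: "nat \<Rightarrow> (nat \<Rightarrow> real) \<Rightarrow> int \<Rightarrow> real"
  where "cuts k v n = of_int (n div int k) + (\<Sum>i<nat (n mod int k). v i)"

text \<open>The upper bound leaves the last gap as the largest; the width \<open>2 * \<eta>\<close>
  of the window is the freedom used for the disk and for the lattice count.\<close>

definition gaps :: "nat \<Rightarrow> real \<Rightarrow> (nat \<Rightarrow> real) set"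
  where "gaps k \<eta> = {v. \<forall>i<k - 1. v i \<in> {1 / real k - 3 * \<eta>..1 / real k - \<eta>}}"

lemma cuts_in_period: "i < k \<Longrightarrow> cuts k v (int k * m + int i) = of_int m + (\<Sum>j<i. v j)"
  by (simp add: cuts_def)

lemma cuts_decomp:
  assumes "k > 0"
  obtains m i where "i < k" "n = int k * m + int i"
proof
  show "nat (n mod int k) < k"
    using assms by (simp add: nat_less_iff)
  show "n = int k * (n div int k) + int (nat (n mod int k))"
    using assms by simp
qed

lemma gaps_sum:
  assumes "v \<in> gaps k \<eta>" "i < k"
  shows "(\<Sum>j<i. v j) \<in> {real i / real k - 3 * real i * \<eta>..real i / real k - real i * \<eta>}"
proof -
  have "(\<Sum>j<i. v j) \<le> (\<Sum>j<i. 1 / real k - \<eta>)" "(\<Sum>j<i. 1 / real k - 3 * \<eta>) \<le> (\<Sum>j<i. v j)"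
    using assms by (intro sum_mono; auto simp: gaps_def)+
  then show ?thesis
    by (simp add: algebra_simps)
qed

lemma cuts_gap_inner:
  assumes "i < k - 1"
  shows "cuts k v (int k * m + int i + 1) - cuts k v (int k * m + int i) = v i"
  using assms cuts_in_period[of i k v m] cuts_in_period[of "Suc i" k v m] by (simp add: algebra_simps)

lemma cuts_gap_last:
  assumes "k > 0" "v \<in> gaps k \<eta>" "\<eta> > 0"
  shows "1 / real k \<le> cuts k v (int k * m + int k) - cuts k v (int k * m + int (k - 1))"
proof -
  have "cuts k v (int k * m + int k) = of_int m + 1"
    using assms cuts_in_period[of 0 k v "m + 1"] by (simp add: algebra_simps)
  moreover have "cuts k v (int k * m + int (k - 1)) = of_int m + (\<Sum>j<k - 1. v j)"
    using assms by (intro cuts_in_period) auto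
  moreover have "(\<Sum>j<k - 1. v j) \<le> real (k - 1) / real k - real (k - 1) * \<eta>"
    using gaps_sum[OF assms(2), of "k - 1"] assms(1) by simp
  moreover have "0 \<le> real (k - 1) * \<eta>"
    using assms by simp
  moreover have "real (k - 1) / real k = 1 - 1 / real k"
    using assms by (simp add: of_nat_diff field_simps)
  ultimately show ?thesis
    by linarith
qed

text \<open>Fewer than \<open>k\<close> free gaps precede a cut within its period, each off by at
  most \<open>3 * \<eta>\<close>. The error does not accumulate over periods because every
  \<open>k\<close>th cut is an integer.\<close>

lemma cuts_near:
  assumes "k > 0" "v \<in> gaps k \<eta>" "\<eta> > 0"
  shows "\<bar>cuts k v n - of_int n / real k\<bar> \<le> 3 * real k * \<eta>"
proof -
  obtain m i where i: "i < k" "n = int k * m + int i"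
    using cuts_decomp[OF assms(1)] by blast
  have "of_int n / real k = of_int m + real i / real k"
    using assms by (simp add: i field_simps)
  moreover have "cuts k v n = of_int m + (\<Sum>j<i. v j)"
    using i by (simp add: cuts_in_period)
  moreover have "real i * \<eta> \<le> real k * \<eta>" "0 \<le> real i * \<eta>"
    using i assms by auto
  ultimately show ?thesis
    using gaps_sum[OF assms(2) i(1)] by (auto simp: abs_le_iff)
qed

lemma partition_cuts:
  assumes "k > 0" "v \<in> gaps k \<eta>" "\<eta> > 0" "3 * real k * \<eta> < 1"
  shows "partition (cuts k v) k"
proof
  have step: "cuts k v n < cuts k v (n + 1)" for n
  proof -
    obtain m i where i: "i < k" "n = int k * m + int i"
      using cuts_decomp[OF assms(1)] by blast
    show ?thesis
    proof (cases "i < k - 1")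
      case True
      have "0 < 1 / real k - 3 * \<eta>"
        using assms by (simp add: field_simps)
      also have "\<dots> \<le> v i"
        using assms True by (auto simp: gaps_def)
      finally show ?thesis
        using cuts_gap_inner[OF True, of v m] i by simp
    next
      case False
      then have "i = k - 1"
        using i by simp
      then have "n = int k * m + int (k - 1)" "n + 1 = int k * m + int k"
        using i assms(1) by auto
      moreover have "cuts k v (int k * m + int (k - 1)) < cuts k v (int k * m + int k)"
        using cuts_gap_last[OF assms(1-3), of m] assms(1)
          divide_pos_pos[of 1 "real k"] by linarith
      ultimately show ?thesis
        by simp
    qed
  qed
  show "strict_mono (cuts k v)"
  proof (rule strict_monoI)
    fix m n :: int assume "m < n"
    then show "cuts k v m < cuts k v n"
      by (induction n rule: int_gr_induct) (auto intro: step less_trans)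
  qed
  show "cuts k v (n + int k) = cuts k v n + 1" for n
    using assms(1) by (simp add: cuts_def)
qed (fact assms)

text \<open>With \<open>e = 3 * real k * \<eta>\<close> from \<open>cuts_near\<close>, the margin
  \<open>2 * real k * e\<close> required by \<open>coding\<close> is
  \<open>6 * (real k)\<^sup>2 * \<eta>\<close>.\<close>

lemma (in circle_map) coding_cuts:
  assumes "slopes a1 a2" "k > 0" "v \<in> gaps k \<eta>" "\<eta> > 0" "3 * real k * \<eta> < 1"
    and "a1 \<le> real k * b - 6 * (real k)\<^sup>2 * \<eta>" "real k * b + 6 * (real k)\<^sup>2 * \<eta> \<le> a2"
  shows "coding g G xm (cuts k v) k b a1 a2 (3 * real k * \<eta>)"
proof -
  interpret partition "cuts k v" k
    by (rule partition_cuts[OF assms(2-5)])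
  show ?thesis
    using assms(6,7) by unfold_locales
      (use assms(1) cuts_near[OF assms(2-4)] in \<open>simp_all add: power2_eq_square algebra_simps\<close>)
qed

text \<open>The position of the largest gap rules out a nontrivial cyclic shift.\<close>

lemma cuts_unique:
  assumes "k > 0" "v \<in> gaps k \<eta>" "v' \<in> gaps k \<eta>" "\<eta> > 0"
    and shift: "\<And>n. cuts k v' (n + l) = cuts k v n + d"
  shows "int k dvd l" and "\<And>i. i < k - 1 \<Longrightarrow> v i = v' i"
proof -
  have gap: "cuts k v' (n + l + 1) - cuts k v' (n + l) = cuts k v (n + 1) - cuts k v n" for n
    using shift[of n] shift[of "n + 1"] by (simp add: algebra_simps)
  obtain m i where i: "i < k" "int (k - 1) + l = int k * m + int i"
    using cuts_decomp[OF assms(1)] by blast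
  have "i = k - 1"
  proof (rule ccontr)
    assume "i \<noteq> k - 1"
    then have "i < k - 1"
      using i by simp
    then have "cuts k v' (int (k - 1) + l + 1) - cuts k v' (int (k - 1) + l) = v' i"
      using cuts_gap_inner[of i k v' m] i by simp
    also have "\<dots> < 1 / real k"
      using assms(3,4) \<open>i < k - 1\<close> by (auto simp: gaps_def)
    also have "\<dots> \<le> cuts k v (int (k - 1) + 1) - cuts k v (int (k - 1))"
      using cuts_gap_last[OF assms(1,2,4), of 0] assms(1) by (simp add: of_nat_diff)
    finally show False
      using gap[of "int (k - 1)"] by simp
  qed
  then have l: "l = int k * m"
    using i by simp
  then show "int k dvd l"
    by simp
  fix i assume "i < k - 1"
  then show "v i = v' i"
    using gap[of "int i"] cuts_gap_inner[of i k v 0] cuts_gap_inner[of i k v' m] l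
    by (simp add: algebra_simps)
qed

text \<open>An index function determines its cuts: evaluating \<open>le_J_iff\<close> at the cuts
  themselves gives both inequalities between corresponding cuts, up to the translation
  \<open>d\<close>.\<close>

lemma coding_shift_unique:
  assumes "k > 0" "v \<in> gaps k \<eta>" "v' \<in> gaps k \<eta>" "\<eta> > 0" "3 * real k * \<eta> < 1"
    and shift: "\<And>t. partition.J (cuts k v') (t + d) = partition.J (cuts k v) t + l"
  shows "int k dvd l" and "\<And>i. i < k - 1 \<Longrightarrow> v i = v' i"
proof -
  interpret v: partition "cuts k v" k
    by (rule partition_cuts[OF assms(1,2,4,5)])
  interpret v': partition "cuts k v'" k
    by (rule partition_cuts[OF assms(1,3,4,5)])
  have iff: "cuts k v' (n + l) \<le> t + d \<longleftrightarrow> cuts k v n \<le> t" for n t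
    using v.le_J_iff[of n t] v'.le_J_iff[of "n + l" "t + d"] shift[of t] by simp
  have eq: "cuts k v' (n + l) = cuts k v n + d" for n
    using iff[of n "cuts k v n"] iff[of n "cuts k v' (n + l) - d"] by simp
  show "int k dvd l" "\<And>i. i < k - 1 \<Longrightarrow> v i = v' i"
    using cuts_unique[OF assms(1-4) eq] by auto
qed

section \<open>Counting periodic orbits from above\<close>

text \<open>\<open>r\<close> is invertible modulo \<open>M\<close>: the residue of
  \<open>i * u\<close> serves as \<open>n\<close>, and the quotient is absorbed into
  \<open>l\<close>.\<close>

lemma bezout_index:
  assumes "coprime r (int M)" "M > 0"
  obtains n l where "n < M" "i = int n * r + l * int M"
proof -
  obtain u v where uv: "u * r + v * int M = 1"
    using bezout_int[of r "int M"] assms by auto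
  define n l where "n = nat ((i * u) mod int M)" and "l = i * v + ((i * u) div int M) * r"
  have n: "int n = (i * u) mod int M"
    using assms by (simp add: n_def)
  have "int n * r + l * int M = (int n + (i * u) div int M * int M) * r + i * v * int M"
    by (simp add: l_def algebra_simps)
  also have "int n + (i * u) div int M * int M = i * u"
    by (simp add: n)
  also have "i * u * r + i * v * int M = i * (u * r + v * int M)"
    by (simp add: algebra_simps)
  finally have "i = int n * r + l * int M"
    by (simp add: uv)
  moreover have "n < M"
    using assms by (simp add: n_def nat_less_iff)
  ultimately show thesis
    by (intro that)
qed

text \<open>The phase rotates by \<open>p / (k q)\<close>, which is not in lowest terms when
  \<open>p\<close> and \<open>k\<close> share a factor; \<open>r / M\<close> is the reduced form.
  Since \<open>q \<le> M \<le> k q\<close>, counts in terms of \<open>M\<close> and of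
  \<open>q\<close> agree up to constants.\<close>

lemma reduced_slope:
  fixes p q :: int and k :: nat
  assumes "k > 0" "q > 0" "coprime p q"
  obtains d r :: int and M :: nat where "d > 0" "r * d = p" "int M * d = int k * q" "M > 0"
    "coprime r (int M)" "q \<le> int M" "int M \<le> int k * q"
proof -
  define d where "d = gcd p (int k)"
  define M where "M = nat (int k * q div d)"
  define r where "r = p div d"
  have d: "d > 0" "d dvd p" "d dvd int k"
    using assms by (auto simp: d_def)
  have rd: "r * d = p"
    unfolding r_def using d(2) by simp
  have Md: "int M * d = int k * q"
  proof -
    have "0 \<le> int k * q div d"
      using d(1) assms(2) by (simp add: pos_imp_zdiv_nonneg_iff)
    then show ?thesis
      unfolding M_def using d(3) by simp
  qed
  have M_pos: "M > 0"
  proof -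
    have "int M * d > 0"
      unfolding Md using assms by simp
    with d show ?thesis
      by (simp add: zero_less_mult_iff)
  qed
  have coprime: "coprime r (int M)"
  proof -
    have "coprime r (int k div d)"
      using assms(1) div_gcd_coprime[of p "int k"] by (simp add: r_def d_def)
    moreover have "coprime r q"
      using assms(3) unfolding rd[symmetric] coprime_mult_left_iff by simp
    moreover have "int M = int k div d * q"
    proof -
      have "int M = int M * d div d"
        using d by simp
      also have "\<dots> = int k div d * q"
        unfolding Md by (rule dvd_div_mult[OF d(3), symmetric])
      finally show ?thesis .
    qed
    ultimately show ?thesis
      by simp
  qed
  have "q \<le> int M"
  proof -
    have "d \<le> int k"
      using d(3) assms(1) by (intro zdvd_imp_le) auto
    then have "q * d \<le> int M * d"
      unfolding Md using assms(2) by (simp add: mult.commute)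
    with d show ?thesis
      by simp
  qed
  moreover have "int M \<le> int k * q"
    unfolding Md[symmetric] using d(1) mult_left_mono[of 1 d "int M"] by simp
  ultimately show thesis
    using d(1) rd Md M_pos coprime by (intro that)
qed

text \<open>Along multiples of the period the displacement is exactly linear, so the limit along
  this subsequence is \<open>a / N\<close>.\<close>

lemma (in circle_map) periodic_shift:
  assumes "(g ^^ N) (circle_proj y) = circle_proj y" "N > 0"
    and "has_rotation_number G (circle_proj y) \<omega>"
  obtains a :: int where "(G ^^ N) y = y + of_int a" "of_int a = real N * \<omega>"
proof -
  have "circle_proj y = circle_proj ((G ^^ N) y)"
    using assms by (simp add: proj_G_pow)
  then obtain a where a: "(G ^^ N) y = y + of_int a"
    by (rule circle_proj_eqE)
  obtain x where x: "circle_proj x = circle_proj y" "(\<lambda>n. ((G ^^ n) x - x) / real n) \<longlonglongrightarrow> \<omega>"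
    using assms by (auto simp: has_rotation_number_def)
  then obtain l where l: "x = y + of_int l"
    using circle_proj_eqE[of y x] by metis
  \<comment> \<open>\<open>Suc m\<close> keeps the denominators of the subsequence nonzero.\<close>
  have "strict_mono (\<lambda>m. N * Suc m)"
    using assms by (auto simp: strict_mono_def)
  from LIMSEQ_subseq_LIMSEQ[OF x(2) this]
  have lim: "(\<lambda>m. ((G ^^ (N * Suc m)) x - x) / real (N * Suc m)) \<longlonglongrightarrow> \<omega>"
    by (simp add: o_def)
  have pow: "(G ^^ (N * m)) y = y + of_int (int m * a)" for m
  proof (induction m)
    case (Suc m)
    have "(G ^^ (N * Suc m)) y = (G ^^ (N * m)) ((G ^^ N) y)"
      by (simp add: funpow_add[symmetric] add.commute flip: o_apply[of "G ^^ (N * m)"])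
    then show ?case
      using Suc by (simp only: a G_pow_add_int) (simp add: algebra_simps)
  qed simp
  have "((G ^^ (N * Suc m)) x - x) / real (N * Suc m) = of_int a / real N" for m
  proof -
    have "(G ^^ (N * Suc m)) x - x = of_int (int (Suc m) * a)"
      unfolding l G_pow_add_int pow by simp
    also have "\<dots> = real (Suc m) * of_int a"
      by (simp only: of_int_mult of_int_of_nat_eq)
    finally have "((G ^^ (N * Suc m)) x - x) / real (N * Suc m) = (real (Suc m) * of_int a) / (real (Suc m) * real N)"
      by (simp only: of_nat_mult mult.commute)
    then show ?thesis
      by (simp only: mult_divide_mult_cancel_left[of "real (Suc m)"] of_nat_neq_0 not_False_eq_True)
  qed
  then have "(\<lambda>m. of_int a / real N) \<longlonglongrightarrow> \<omega>"
    using lim by simp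
  then have "of_int a / real N = \<omega>"
    by (simp add: LIMSEQ_const_iff)
  then have "of_int a = real N * \<omega>"
    using assms(2) by (simp add: field_simps)
  with a show thesis
    by (rule that)
qed

section \<open>The order of a lifted periodic orbit and its translates by multiples of
  \<open>k\<close>\<close>

locale monotone_orbit = circle_map +
  fixes y :: real and k N :: nat and a r :: int and M :: nat
  assumes k_pos: "k > 0" and N_pos: "N > 0" and M_pos: "M > 0"
    and period: "(G ^^ N) y = y + of_int a"
    and mono_orbit: "\<And>n l n' l'. (G ^^ n) y + real k * of_int l < (G ^^ n') y + real k * of_int l' \<Longrightarrow>
      G ((G ^^ n) y + real k * of_int l) \<le> G ((G ^^ n') y + real k * of_int l')"
    and coprime: "coprime r (int M)"
    and slope: "int N * r * int k = int M * a"
begin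

definition pt :: "nat \<Rightarrow> int \<Rightarrow> real"
  where "pt n l = (G ^^ n) y + real k * of_int l"

lemma G_pow_pt: "(G ^^ m) (pt n l) = pt (m + n) l"
  using G_pow_add_int[of m "(G ^^ n) y" "int k * l"] by (simp add: pt_def funpow_add)

lemma G_pt: "G (pt n l) = pt (Suc n) l"
  using G_pow_pt[of 1 n l] by simp

lemma pt_add: "pt n (l + l') = pt n l + real k * of_int l'"
  by (simp add: pt_def algebra_simps)

lemma G_pow_N_pt: "(G ^^ N) (pt n l) = pt n l + of_int a"
proof -
  have "(G ^^ N) (pt n l) = (G ^^ n) ((G ^^ N) y) + real k * of_int l"
    unfolding G_pow_pt by (simp add: pt_def add.commute[of N] funpow_add)
  then show ?thesis
    by (simp add: period G_pow_add_int pt_def)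
qed

text \<open>\<open>G ^^ N\<close> acts on these points as a translation and is hence injective on
  them, so \<open>G\<close> cannot merge two of them.\<close>

lemma G_pt_strict: assumes "pt n l < pt n' l'" shows "G (pt n l) < G (pt n' l')"
proof -
  have "G (pt n l) \<noteq> G (pt n' l')"
  proof
    assume eq: "G (pt n l) = G (pt n' l')"
    have "(G ^^ N) u = (G ^^ (N - 1)) (G u)" for u
      using N_pos by (metis Suc_diff_1 comp_apply funpow_Suc_right)
    with eq have "(G ^^ N) (pt n l) = (G ^^ N) (pt n' l')"
      by simp
    with assms show False
      by (simp add: G_pow_N_pt)
  qed
  with mono_orbit[of n l n' l'] assms show ?thesis
    by (simp add: pt_def)
qed

lemma G_pow_pt_strict: "pt n l < pt n' l' \<Longrightarrow> pt (m + n) l < pt (m + n') l'"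
  by (induction m) (auto dest: G_pt_strict simp: G_pt)

lemma G_pow_pt_cancel: "pt (m + n) l < pt (m + n') l' \<Longrightarrow> pt n l < pt n' l'"
  using G_pow_pt_strict[of n' l' n l m] by (cases "pt n l" "pt n' l'" rule: linorder_cases)
    (auto simp: G_pow_pt[symmetric])

text \<open>\<open>G ^^ m\<close> preserves strict order and commutes with translation by
  \<open>k\<close>, so one inequality can be applied repeatedly to its own result.\<close>

lemma iterate_less: "pt m 0 < pt 0 l \<Longrightarrow> pt (Suc t * m) 0 < pt 0 (int (Suc t) * l)"
proof (induction t)
  case (Suc t)
  have "pt (Suc (Suc t) * m) 0 = pt (m + Suc t * m) 0"
    by (simp add: algebra_simps)
  also have "\<dots> < pt (m + 0) (int (Suc t) * l)"
    by (intro G_pow_pt_strict Suc)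
  also have "\<dots> = pt m 0 + real k * of_int (int (Suc t) * l)"
    by (simp add: pt_def)
  also have "\<dots> < pt 0 l + real k * of_int (int (Suc t) * l)"
    using Suc.prems by simp
  also have "\<dots> = pt 0 (int (Suc (Suc t)) * l)"
    by (simp add: pt_def algebra_simps)
  finally show ?case .
qed simp

lemma iterate_greater: "pt 0 l < pt m 0 \<Longrightarrow> pt 0 (int (Suc t) * l) < pt (Suc t * m) 0"
proof (induction t)
  case (Suc t)
  have "pt 0 (int (Suc (Suc t)) * l) = pt 0 l + real k * of_int (int (Suc t) * l)"
    by (simp add: pt_def algebra_simps)
  also have "\<dots> < pt m 0 + real k * of_int (int (Suc t) * l)"
    using Suc.prems by simp
  also have "\<dots> = pt (m + 0) (int (Suc t) * l)"
    by (simp add: pt_def)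
  also have "\<dots> < pt (m + Suc t * m) 0"
    by (intro G_pow_pt_strict Suc)
  also have "\<dots> = pt (Suc (Suc t) * m) 0"
    by (simp add: algebra_simps)
  finally show ?case .
qed simp

lemma iterate_eq: "pt m 0 = pt 0 l \<Longrightarrow> pt (t * m) 0 = pt 0 (int t * l)"
proof (induction t)
  case (Suc t)
  have "pt (Suc t * m) 0 = (G ^^ m) (pt (t * m) 0)"
    by (simp add: G_pow_pt)
  also have "\<dots> = pt m (int t * l)"
    using Suc by (simp add: G_pow_pt)
  also have "\<dots> = pt m 0 + real k * of_int (int t * l)"
    by (simp add: pt_def)
  also have "\<dots> = pt 0 (int (Suc t) * l)"
    unfolding Suc.prems by (simp add: pt_def algebra_simps)
  finally show ?case .
qed simp

lemma pt_0_less_iff: "pt 0 l < pt 0 l' \<longleftrightarrow> l < l'"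
  using k_pos by (simp add: pt_def)

lemma pt_0_eq_iff: "pt 0 l = pt 0 l' \<longleftrightarrow> l = l'"
  using k_pos by (simp add: pt_def)

lemma pt_N_mult: "pt (t * N) 0 = y + of_int (int t * a)"
proof (induction t)
  case (Suc t)
  have "pt (Suc t * N) 0 = (G ^^ N) (pt (t * N) 0)"
    by (simp add: G_pow_pt)
  also have "\<dots> = pt (t * N) 0 + of_int a"
    by (rule G_pow_N_pt)
  finally show ?case
    using Suc by (simp add: algebra_simps)
qed (simp add: pt_def)

text \<open>By \<open>slope\<close>, \<open>N * M\<close> steps equal exactly \<open>N * r\<close>
  translations by \<open>k\<close>. A strict discrepancy after \<open>M\<close> steps would persist
  when iterated \<open>N\<close> times.\<close>

lemma pt_M: "pt M 0 = pt 0 r"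
proof -
  have N: "pt (N * M) 0 = pt 0 (int N * r)"
  proof -
    have "real_of_int (int M * a) = real_of_int (int N * r * int k)"
      by (simp only: slope)
    then show ?thesis
      using pt_N_mult[of M] by (simp add: pt_def mult.commute algebra_simps)
  qed
  obtain t where t: "N = Suc t"
    using N_pos by (cases N) auto
  show ?thesis
    using iterate_less[of M r t] iterate_greater[of r M t] N unfolding t
    by (cases "pt M 0" "pt 0 r" rule: linorder_cases) auto
qed

lemma pt_mult_M: "pt (M * m) 0 = pt 0 (r * int m)"
  using iterate_eq[OF pt_M, of m] by (simp add: mult.commute)

text \<open>Iterating each relation \<open>M\<close> times and inserting \<open>pt_mult_M\<close>
  leaves a comparison of integers.\<close>

lemma pt_compare:
  "pt m 0 < pt 0 l \<Longrightarrow> r * int m < l * int M"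
  "pt 0 l < pt m 0 \<Longrightarrow> l * int M < r * int m"
  "pt m 0 = pt 0 l \<Longrightarrow> r * int m = l * int M"
proof -
  obtain t where t: "M = Suc t"
    using M_pos by (cases M) auto
  show "r * int m < l * int M" if "pt m 0 < pt 0 l"
    using iterate_less[OF that, of t] unfolding t[symmetric] pt_mult_M pt_0_less_iff
    by (simp add: mult.commute)
  show "l * int M < r * int m" if "pt 0 l < pt m 0"
    using iterate_greater[OF that, of t] unfolding t[symmetric] pt_mult_M pt_0_less_iff
    by (simp add: mult.commute)
  show "r * int m = l * int M" if "pt m 0 = pt 0 l"
    using iterate_eq[OF that, of M] unfolding pt_mult_M pt_0_eq_iff
    by (simp add: mult.commute)
qed

lemma pt_diff:
  assumes "n \<le> n'"
  shows "pt n l < pt n' l' \<longleftrightarrow> pt 0 (l - l') < pt (n' - n) 0"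
    and "pt n' l' < pt n l \<longleftrightarrow> pt (n' - n) 0 < pt 0 (l - l')"
proof -
  have 1: "pt n l < pt n' l' \<longleftrightarrow> pt 0 l < pt (n' - n) l'"
    using G_pow_pt_cancel[of n 0 l "n' - n" l'] G_pow_pt_strict[of 0 l "n' - n" l' n] assms by auto
  have 2: "pt n' l' < pt n l \<longleftrightarrow> pt (n' - n) l' < pt 0 l"
    using G_pow_pt_cancel[of n "n' - n" l' 0 l] G_pow_pt_strict[of "n' - n" l' 0 l n] assms by auto
  show "pt n l < pt n' l' \<longleftrightarrow> pt 0 (l - l') < pt (n' - n) 0"
    "pt n' l' < pt n l \<longleftrightarrow> pt (n' - n) 0 < pt 0 (l - l')"
    unfolding 1 2 by (auto simp: pt_def algebra_simps)
qed

text \<open>\<open>n r + l M\<close> is the position of the corresponding point of the rotation by \<open>r / M\<close>.\<close>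

lemma pt_less_iff:
  "pt n l < pt n' l' \<longleftrightarrow> int n * r + l * int M < int n' * r + l' * int M"
proof -
  have *: "pt n l < pt n' l' \<longleftrightarrow> int n * r + l * int M < int n' * r + l' * int M"
    "pt n' l' < pt n l \<longleftrightarrow> int n' * r + l' * int M < int n * r + l * int M"
    if "n \<le> n'" for n n' l l'
  proof -
    have "r * int (n' - n) = int n' * r - int n * r"
      using that by (simp add: of_nat_diff algebra_simps)
    then show "pt n l < pt n' l' \<longleftrightarrow> int n * r + l * int M < int n' * r + l' * int M"
      "pt n' l' < pt n l \<longleftrightarrow> int n' * r + l' * int M < int n * r + l * int M"
      unfolding pt_diff[OF that] using pt_compare[where m = "n' - n" and l = "l - l'"]
      by (cases "pt (n' - n) 0" "pt 0 (l - l')" rule: linorder_cases; simp add: algebra_simps)+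
  qed
  show ?thesis
    using *(1)[where n = n and n' = n' and l = l and l' = l']
      *(2)[where n = n' and n' = n and l = l' and l' = l] by (cases "n \<le> n'") auto
qed

lemma pt_eqI:
  assumes "int n * r + l * int M = int n' * r + l' * int M"
  shows "pt n l = pt n' l'"
  using pt_less_iff[of n l n' l'] pt_less_iff[of n' l' n l] assms by simp

lemma index_ex: "\<exists>n l. int n * r + l * int M = i"
  using bezout_index[OF coprime M_pos, of i] by metis

text \<open>By coprimality every integer has the form \<open>n * r + l * M\<close>, and by
  \<open>pt_eqI\<close> points with the same index coincide, so the choice does not matter.\<close>

definition enum :: "int \<Rightarrow> real"
  where "enum i = (SOME x. \<exists>n l. int n * r + l * int M = i \<and> x = pt n l)"

lemma pt_eq_enum: "pt n l = enum (int n * r + l * int M)"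
proof -
  have "\<exists>n' l'. int n' * r + l' * int M = int n * r + l * int M \<and> enum (int n * r + l * int M) = pt n' l'"
    unfolding enum_def by (rule someI_ex) auto
  then show ?thesis
    using pt_eqI by metis
qed

lemma enum_cases: obtains n l where "i = int n * r + l * int M" "enum i = pt n l"
  using index_ex[of i] pt_eq_enum by metis

lemma enum_strict_mono: "strict_mono enum"
proof (rule strict_monoI)
  fix i j :: int assume "i < j"
  obtain n l where nl: "i = int n * r + l * int M" "enum i = pt n l"
    by (rule enum_cases)
  obtain n' l' where nl': "j = int n' * r + l' * int M" "enum j = pt n' l'"
    by (rule enum_cases)
  show "enum i < enum j"
    using \<open>i < j\<close> unfolding nl(2) nl'(2) pt_less_iff nl(1)[symmetric] nl'(1)[symmetric] .
qed

lemma G_enum: "G (enum i) = enum (i + r)"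
proof -
  obtain n l where nl: "i = int n * r + l * int M" "enum i = pt n l"
    by (rule enum_cases)
  have "G (enum i) = pt (Suc n) l"
    by (simp only: nl(2) G_pt)
  also have "\<dots> = enum (int (Suc n) * r + l * int M)"
    by (rule pt_eq_enum)
  finally show ?thesis
    by (simp add: nl(1) algebra_simps)
qed

lemma enum_add_M: "enum (i + int M) = enum i + real k"
proof -
  obtain n l where nl: "i = int n * r + l * int M" "enum i = pt n l"
    by (rule enum_cases)
  have "enum (i + int M) = pt n (l + 1)"
    by (simp add: nl(1) pt_eq_enum algebra_simps)
  then show ?thesis
    by (simp add: nl(2) pt_add)
qed

end

text \<open>\<open>z\<close> enumerates the lift of a periodic orbit in increasing order, and \<open>D j\<close> is the last index
  below the unit interval number \<open>j\<close>.\<close>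

definition (in circle_map) enumerates ::
    "nat \<Rightarrow> nat \<Rightarrow> int \<Rightarrow> circle set \<Rightarrow> (int \<Rightarrow> real) \<Rightarrow> (int \<Rightarrow> int) \<Rightarrow> bool"
  where "enumerates k M r P z D \<longleftrightarrow>
    P = circle_proj ` range z \<and>
    (\<forall>i. G (z i) = z (i + r)) \<and> (\<forall>i. z (i + int M) = z i + real k) \<and>
    (\<forall>i. \<exists>j. z i \<in> {of_int j..of_int j + xm}) \<and>
    (\<forall>i j. of_int j \<le> z i \<longleftrightarrow> D j < i) \<and> D 0 = 0 \<and> mono D \<and> (\<forall>j. D (j + int k) = D j + int M)"

context circle_map
begin

lemma in_unit_intervalE:
  assumes "circle_proj x \<in> circle_proj ` {0..xm}"
  obtains j :: int where "x \<in> {of_int j..of_int j + xm}"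
proof -
  obtain t where t: "t \<in> {0..xm}" "circle_proj t = circle_proj x"
    using assms by (metis imageE)
  obtain l where "x = t + of_int l"
    using circle_proj_eqE[OF t(2)] by blast
  with t show thesis
    by (intro that[of l]) auto
qed

text \<open>It suffices to follow one point \<open>y\<close> of \<open>Z'\<close> together with its
  translates by multiples of \<open>k\<close>: they stay in \<open>Z'\<close> and already project
  onto \<open>P\<close>, even if \<open>Z'\<close> contains further lifts.\<close>

lemma kfsm_periodic_orbit_enumerates:
  fixes p q d r :: int
  assumes "k > 0" "q > 0" and d: "d > 0" and rd: "r * d = p" and Md: "int M * d = int k * q"
    and M_pos: "M > 0" and coprime: "coprime r (int M)"
    and P: "P \<in> kfsm_periodic_orbits g G xm k (of_int p / of_int q)"
  obtains z D where "enumerates k M r P z D"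
proof -
  obtain w N where w: "N > 0" "(g ^^ N) w = w" "P = (\<lambda>i. (g ^^ i) w) ` {..<N}"
    using P by (auto simp: kfsm_periodic_orbits_def periodic_orbit_def)
  have kf: "kfsm g G xm k P" and rot: "set_has_rotation_number G P (of_int p / of_int q)"
    using P by (auto simp: kfsm_periodic_orbits_def)
  obtain Z' where Z': "G ` Z' \<subseteq> Z'" "circle_proj ` Z' = P" "(\<lambda>x. x + real k) ` Z' = Z'"
    "\<And>z1 z2. z1 \<in> Z' \<Longrightarrow> z2 \<in> Z' \<Longrightarrow> z1 < z2 \<Longrightarrow> G z1 \<le> G z2"
    using kf unfolding kfsm_def by (elim conjE exE) 
      (rule that, assumption, assumption, assumption, drule (1) bspec, drule (1) bspec, erule (1) mp)
  have "w \<in> P"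
    using w by (auto intro!: image_eqI[of _ _ 0])
  then obtain y where y: "y \<in> Z'" "circle_proj y = w"
    using Z'(2) by blast
  have "has_rotation_number G (circle_proj y) (of_int p / of_int q)"
    using rot \<open>w \<in> P\<close> y(2) by (simp add: set_has_rotation_number_def)
  moreover have "(g ^^ N) (circle_proj y) = circle_proj y"
    using w(2) y(2) by simp
  ultimately obtain a where a: "(G ^^ N) y = y + of_int a" "of_int a = real N * (of_int p / of_int q)"
    using periodic_shift[OF _ w(1)] by blast
  have "real_of_int (a * q) = real_of_int (int N * p)"
    using a(2) assms(2) by (simp add: field_simps)
  then have aq: "a * q = int N * p"
    by (simp only: of_int_eq_iff)
  have "d * (int N * r * int k) = d * (int M * a)"
  proof -
    have "d * (int N * r * int k) = (int N * (r * d)) * int k"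
      by (simp add: algebra_simps)
    also have "\<dots> = (a * q) * int k"
      unfolding rd aq ..
    also have "\<dots> = a * (int k * q)"
      by (simp add: algebra_simps)
    also have "\<dots> = d * (int M * a)"
      unfolding Md[symmetric] by (simp add: algebra_simps)
    finally show ?thesis .
  qed
  then have slope: "int N * r * int k = int M * a"
    using d by simp
  have Z'_k: "x + real k * of_int l \<in> Z'" if "x \<in> Z'" for x l
  proof -
    have up: "x + real k \<in> Z'" if "x \<in> Z'" for x
    proof -
      have "x + real k \<in> (\<lambda>x. x + real k) ` Z'"
        using that by (rule imageI)
      then show ?thesis
        by (simp only: Z'(3))
    qed
    have down: "x - real k \<in> Z'" if "x \<in> Z'" for x
    proof -
      have "x \<in> (\<lambda>x. x + real k) ` Z'"
        using that by (simp only: Z'(3))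
      then obtain x' where "x = x' + real k" "x' \<in> Z'"
        by (rule imageE)
      then show ?thesis
        by simp
    qed
    show ?thesis
    proof (induction l rule: int_induct[where k = 0])
      case (step1 l)
      have eq: "x + real k * of_int (l + 1) = x + real k * of_int l + real k"
        by (simp add: algebra_simps)
      show ?case
        unfolding eq by (rule up[OF step1(2)])
    next
      case (step2 l)
      have eq: "x + real k * of_int (l - 1) = x + real k * of_int l - real k"
        by (simp add: algebra_simps)
      show ?case
        unfolding eq by (rule down[OF step2(2)])
    qed (use that in simp)
  qed
  have Z'_G: "(G ^^ n) y \<in> Z'" for n
    using y Z'(1) by (induction n) auto
  interpret monotone_orbit g G xm y k N a r M
  proof
    show "G ((G ^^ n) y + real k * of_int l) \<le> G ((G ^^ n') y + real k * of_int l')"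
      if "(G ^^ n) y + real k * of_int l < (G ^^ n') y + real k * of_int l'" for n l n' l'
      using that by (intro Z'(4) Z'_k Z'_G)
  qed fact+
  have enum_Z': "enum i \<in> Z'" for i
  proof -
    obtain n l where "enum i = pt n l"
      by (rule enum_cases[of i])
    then show ?thesis
      unfolding pt_def using Z'_k[OF Z'_G] by simp
  qed
  have enum_unit: "\<exists>j. enum i \<in> {of_int j..of_int j + xm}" for i
  proof -
    have "circle_proj (enum i) \<in> positive_slope_region g xm"
      using enum_Z'[of i] Z'(2) kf by (auto simp: kfsm_def)
    then have "circle_proj (enum i) \<in> circle_proj ` {0..xm}"
      unfolding positive_slope_region_def by (auto dest: spec[of _ 0])
    then show ?thesis
      by (elim in_unit_intervalE) blast
  qed
  have P_enum: "P = circle_proj ` range enum"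
  proof (intro equalityI subsetI)
    fix z assume "z \<in> P"
    then obtain i where "z = (g ^^ i) w"
      using w by auto
    then have "z = circle_proj (pt i 0)"
      by (simp add: pt_def proj_G_pow y)
    then show "z \<in> circle_proj ` range enum"
      by (simp add: pt_eq_enum)
  next
    fix z assume "z \<in> circle_proj ` range enum"
    then show "z \<in> P"
      using enum_Z' Z'(2) by auto
  qed
  interpret part: partition "\<lambda>i. enum i / real k" M
  proof
    show "strict_mono (\<lambda>i. enum i / real k)"
      using enum_strict_mono k_pos by (auto simp: strict_mono_def divide_strict_right_mono)
    show "enum (n + int M) / real k = enum n / real k + 1" for n
      unfolding enum_add_M using k_pos by (simp add: add_divide_distrib)
  qed (fact M_pos)
  \<comment> \<open>No orbit point lies strictly between \<open>j - 1 + xm\<close> and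
    \<open>j\<close>, so the points below \<open>j\<close> are those up to
    \<open>j - 1 + xm\<close>. This turns a strict bound into the weak one that \<open>J\<close>
    handles.\<close>
  define D where "D j = part.J ((of_int j - 1 + xm) / real k)" for j :: int
  have D_iff: "of_int j \<le> enum i \<longleftrightarrow> D j < i" for i j
  proof -
    obtain j' where j': "enum i \<in> {of_int j'..of_int j' + xm}"
      using enum_unit by blast
    have "of_int j \<le> enum i \<longleftrightarrow> \<not> enum i \<le> of_int j - 1 + xm"
    proof (cases "j \<le> j'")
      case True
      then show ?thesis
        using j' xm_less_1 by auto
    next
      case False
      then have "real_of_int j' \<le> of_int j - 1"
        by linarith
      then show ?thesis
        using j' xm_less_1 by auto
    qed
    also have "\<dots> \<longleftrightarrow> D j < i"
      using part.le_J_iff[of i "(of_int j - 1 + xm) / real k"] k_pos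
      by (auto simp: D_def divide_le_cancel)
    finally show ?thesis .
  qed
  have D_mono: "D j \<le> D j'" if "j \<le> j'" for j j'
    unfolding D_def using that by (intro part.J_mono divide_right_mono) auto
  have D_add: "D (j + int k) = D j + int M" for j
    using part.J_add_int[of "(of_int j - 1 + xm) / real k" 1] k_pos
    by (simp add: D_def add_divide_distrib diff_divide_distrib algebra_simps)
  \<comment> \<open>Renumbering makes \<open>z 1\<close> the first nonnegative point, which gives
    the normalisation \<open>D 0 = 0\<close>.\<close>
  define z where "z i = enum (i + D 0)" for i
  have "enumerates k M r P z (\<lambda>j. D j - D 0)"
    unfolding enumerates_def
  proof (intro conjI allI)
    have "range z = range enum"
    proof (intro equalityI subsetI)
      fix x assume "x \<in> range enum"
      then obtain i where "x = enum i"
        by auto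
      then have "x = z (i - D 0)"
        by (simp add: z_def)
      then show "x \<in> range z"
        by simp
    qed (auto simp: z_def)
    then show "P = circle_proj ` range z"
      using P_enum by simp
    show "G (z i) = z (i + r)" "z (i + int M) = z i + real k" for i
      using enum_add_M[of "i + D 0"] by (auto simp: z_def G_enum algebra_simps)
    show "\<exists>j. z i \<in> {of_int j..of_int j + xm}" for i
      unfolding z_def by (rule enum_unit)
    show "of_int j \<le> z i \<longleftrightarrow> D j - D 0 < i" for i j
      unfolding z_def D_iff by auto
    show "mono (\<lambda>j. D j - D 0)"
      by (intro monoI diff_mono D_mono) auto
  qed (auto simp: D_add)
  then show thesis
    by (rule that)
qed

text \<open>Equal thresholds put \<open>z i\<close> and \<open>z' i\<close> into the same unit
  interval, where \<open>G\<close> strictly increases their distance if they differ. After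
  \<open>M\<close> steps both have moved by \<open>k * r\<close>, so the distance would exceed
  itself. Periodicity and \<open>D 0 = 0\<close> reduce the comparison of thresholds to
  \<open>{1..<int k}\<close>.\<close>

lemma enumerates_unique:
  assumes "enumerates k M r P z D" "enumerates k M r P' z' D'" "k > 0" "M > 0"
    and "\<And>j. j \<in> {1..<int k} \<Longrightarrow> D j = D' j"
  shows "P = P'"
proof -
  note E = assms(1,2)[unfolded enumerates_def]
  have DD': "D j = D' j" for j
  proof -
    define j0 where "j0 = j mod int k"
    have "D j0 = D' j0"
    proof (cases "j0 = 0")
      case True
      then show ?thesis
        using E by simp
    next
      case False
      moreover have "0 \<le> j0" "j0 < int k"
        using assms(3) by (simp_all add: j0_def)
      ultimately show ?thesis
        by (intro assms(5)) simp
    qed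
    moreover have "j = j0 + int k * (j div int k)"
      by (simp add: j0_def)
    ultimately show ?thesis
      using int_period[of D "int k" "int M" j0 "j div int k"]
        int_period[of D' "int k" "int M" j0 "j div int k"] E by auto
  qed
  have grow: "\<bar>z i - z' i\<bar> < \<bar>z (i + r) - z' (i + r)\<bar>" if "z i \<noteq> z' i" for i
  proof -
    obtain j j' where j: "z i \<in> {of_int j..of_int j + xm}" "z' i \<in> {of_int j'..of_int j' + xm}"
      using E by metis
    have "j = j'"
    proof -
      have iff: "of_int m \<le> z i \<longleftrightarrow> of_int m \<le> z' i" for m
        using E DD' by metis
      have "of_int j \<le> z' i" "of_int j' \<le> z i"
        using j iff[of j] iff[of j'] by auto
      with j have "real_of_int j < of_int j' + 1" "real_of_int j' < of_int j + 1"
        using xm_less_1 by auto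
      then show ?thesis
        by linarith
    qed
    have G_shift: "G t = G (t - of_int j) + of_int j" for t
      using G_add_int[of "t - of_int j" j] by simp
    have "\<bar>z i - z' i\<bar> < \<bar>G (z i) - G (z' i)\<bar>"
      using that j expanding[of "z i - of_int j" "z' i - of_int j"]
        expanding[of "z' i - of_int j" "z i - of_int j"] \<open>j = j'\<close>
      by (cases "z i < z' i") (auto simp: G_shift[of "z i"] G_shift[of "z' i"])
    then show ?thesis
      using E by simp
  qed
  have "z i = z' i" for i
  proof (rule ccontr)
    assume neq: "z i \<noteq> z' i"
    have it: "\<bar>z i - z' i\<bar> < \<bar>z (i + int (Suc n) * r) - z' (i + int (Suc n) * r)\<bar>" for n
    proof (induction n)
      case 0
      then show ?case
        using grow[OF neq] by simp
    next
      case (Suc n)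
      then have "z (i + int (Suc n) * r) \<noteq> z' (i + int (Suc n) * r)"
        by auto
      from grow[OF this] Suc show ?case
        by (simp add: algebra_simps)
    qed
    have "z (i + int M * r) - z' (i + int M * r) = z i - z' i"
      using int_period[of z "int M" "real k" i r] int_period[of z' "int M" "real k" i r] E by simp
    with it[of "M - 1"] assms(4) show False
      by simp
  qed
  then have "z = z'"
    by auto
  with E show ?thesis
    by simp
qed

text \<open>The orbit is determined by \<open>D 1, ..., D (k - 1)\<close>, each in
  \<open>{0..int M}\<close>, and \<open>M \<le> k q\<close>.\<close>

theorem card_kfsm_periodic_orbits_le:
  assumes "k > 0" "q > 0" "coprime p q"
  defines "S \<equiv> kfsm_periodic_orbits g G xm k (of_int p / of_int q)"
  shows "finite S" and "real (card S) \<le> (real k + 1) ^ (k - 1) * of_int q ^ (k - 1)"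
proof -
  obtain d r M where slope: "d > 0" "r * d = p" "int M * d = int k * q" and M_pos: "M > 0"
    and coprime: "coprime r (int M)" and "int M \<le> int k * q"
    using reduced_slope[OF assms(1-3)] by metis
  then have M_le: "real M \<le> real k * of_int q"
    by (metis of_int_le_iff of_int_mult of_int_of_nat_eq)
  have "\<forall>P\<in>S. \<exists>zD. enumerates k M r P (fst zD) (snd zD)"
  proof
    fix P assume "P \<in> S"
    then obtain z D where "enumerates k M r P z D"
      unfolding S_def by (rule kfsm_periodic_orbit_enumerates[OF assms(1,2) slope M_pos coprime])
    then show "\<exists>zD. enumerates k M r P (fst zD) (snd zD)"
      by (intro exI[of _ "(z, D)"]) simp
  qed
  from bchoice[OF this] obtain zD where "\<forall>P\<in>S. enumerates k M r P (fst (zD P)) (snd (zD P))" ..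
  then have zD: "enumerates k M r P (fst (zD P)) (snd (zD P))" if "P \<in> S" for P
    using that by blast
  define D where "D P = snd (zD P)" for P
  define F where "F P = restrict (D P) {1..<int k}" for P
  have inj: "inj_on F S"
  proof (rule inj_onI)
    fix P P' assume PP': "P \<in> S" "P' \<in> S" "F P = F P'"
    have "snd (zD P) j = snd (zD P') j" if "j \<in> {1..<int k}" for j
      using PP'(3) that by (auto simp: F_def D_def dest: fun_cong[of _ _ j])
    with zD[OF PP'(1)] zD[OF PP'(2)] assms(1) M_pos show "P = P'"
      by (rule enumerates_unique)
  qed
  define T where "T = PiE {1..<int k} (\<lambda>_. {0..int M})"
  have sub: "F ` S \<subseteq> T"
  proof (rule image_subsetI)
    fix P assume "P \<in> S"
    note E = zD[OF this, folded D_def, unfolded enumerates_def]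
    have "D P j \<in> {0..int M}" if "j \<in> {1..<int k}" for j
    proof -
      have "mono (D P)"
        using E by blast
      with that have "D P 0 \<le> D P j" "D P j \<le> D P (0 + int k)"
        by (auto elim: monoD)
      moreover have "D P 0 = 0" "D P (0 + int k) = D P 0 + int M"
        using E by blast+
      ultimately show ?thesis
        by simp
    qed
    then show "F P \<in> T"
      by (auto simp: F_def T_def)
  qed
  have "finite T"
    unfolding T_def by (intro finite_PiE) auto
  with sub show "finite S"
    using inj finite_imageD finite_subset by blast
  have "card S \<le> card T"
    using card_image[OF inj] card_mono[OF \<open>finite T\<close> sub] by simp
  also have "card T = (M + 1) ^ (k - 1)"
    using assms(1) by (simp add: T_def card_PiE nat_diff_distrib nat_add_distrib)
  finally have "real (card S) \<le> real ((M + 1) ^ (k - 1))"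
    by (simp only: of_nat_le_iff)
  also have "\<dots> = (real M + 1) ^ (k - 1)"
    by (simp add: algebra_simps)
  also have "\<dots> \<le> ((real k + 1) * of_int q) ^ (k - 1)"
  proof (rule power_mono)
    have "1 \<le> real_of_int q"
      using assms(2) by linarith
    with M_le show "real M + 1 \<le> (real k + 1) * of_int q"
      by (simp add: algebra_simps)
  qed simp
  finally show "real (card S) \<le> (real k + 1) ^ (k - 1) * of_int q ^ (k - 1)"
    by (simp add: power_mult_distrib)
qed

end

section \<open>Counting periodic orbits from below\<close>

text \<open>Comparison with a multiple of \<open>1 / M\<close> is not affected by rounding
  \<open>t\<close> down to such a multiple.\<close>

lemma (in partition) J_lattice:
  assumes "M > 0" "\<And>n. \<exists>m. c n = of_int m / real M"
  shows "J t = J (of_int \<lfloor>real M * t\<rfloor> / real M)"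
proof -
  have iff: "c n \<le> t \<longleftrightarrow> c n \<le> of_int \<lfloor>real M * t\<rfloor> / real M" for n
  proof -
    obtain m where m: "c n = of_int m / real M"
      using assms by blast
    have "c n \<le> t \<longleftrightarrow> of_int m \<le> real M * t"
      using assms by (simp add: m divide_le_eq mult.commute)
    also have "\<dots> \<longleftrightarrow> c n \<le> of_int \<lfloor>real M * t\<rfloor> / real M"
      using assms by (simp add: m divide_le_cancel le_floor_iff)
    finally show ?thesis .
  qed
  have "n \<le> J t \<longleftrightarrow> n \<le> J (of_int \<lfloor>real M * t\<rfloor> / real M)" for n
    unfolding le_J_iff by (rule iff)
  then show ?thesis
    by (intro order_antisym) blast+
qed

definition (in coding) rational_orbit :: "nat \<Rightarrow> circle set"
  where "rational_orbit M = range (\<lambda>i::int. circle_proj (X (of_int i / real M)))"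

text \<open>Rotation by \<open>r / M\<close> permutes the multiples of \<open>1 / M\<close> modulo
  one in a single cycle. \<open>X\<close> carries this cycle to a periodic orbit, and its
  monotonicity gives the kfsm property.\<close>

lemma (in coding) rational_orbit:
  assumes "M > 0" "coprime r (int M)" "b = of_int r / real M"
  shows "rational_orbit M \<in> kfsm_periodic_orbits g G xm k (real k * b)"
proof -
  define z where "z i = X (of_int i / real M)" for i :: int
  have P: "rational_orbit M = circle_proj ` range z"
    by (auto simp: rational_orbit_def z_def)
  have z_add: "z (i + l * int M) = z i + real k * of_int l" for i l
    using X_add_int[of "of_int i / real M" l] assms(1) by (simp add: z_def add_divide_distrib)
  have G_z: "G (z i) = z (i + r)" for i
  proof -
    have "of_int (i + r) / real M = of_int i / real M + b"
      by (simp add: assms(3) add_divide_distrib)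
    then show ?thesis
      by (simp only: z_def G_X)
  qed
  have orbit: "(g ^^ n) (circle_proj (z 0)) = circle_proj (z (int n * r))" for n
  proof -
    have "(G ^^ n) (z 0) = z (int n * r)"
      by (induction n) (auto simp: G_z algebra_simps)
    then show ?thesis
      by (simp flip: proj_G_pow)
  qed
  have proj_add: "circle_proj (z (i + l * int M)) = circle_proj (z i)" for i l
    using circle_proj_add_int[of "z i" "int k * l"] by (simp add: z_add)
  have P_eq: "rational_orbit M = (\<lambda>i. (g ^^ i) (circle_proj (z 0))) ` {..<M}"
  proof (intro equalityI subsetI)
    fix w assume "w \<in> rational_orbit M"
    then obtain i where i: "w = circle_proj (z i)"
      by (auto simp: P)
    obtain n l where nl: "n < M" "i = int n * r + l * int M"
      using bezout_index[OF assms(2,1)] by blast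
    then have "w = (g ^^ n) (circle_proj (z 0))"
      by (simp add: i orbit proj_add)
    with nl(1) show "w \<in> (\<lambda>i. (g ^^ i) (circle_proj (z 0))) ` {..<M}"
      by auto
  qed (auto simp: orbit P)
  have "periodic_orbit g (rational_orbit M)"
    unfolding periodic_orbit_def
  proof (intro exI conjI)
    show "(g ^^ M) (circle_proj (z 0)) = circle_proj (z 0)"
      using proj_add[of 0 r] by (simp add: orbit mult.commute)
  qed (fact assms P_eq)+
  moreover have "kfsm g G xm k (rational_orbit M)"
    unfolding kfsm_def
  proof (intro conjI exI)
    show "compact (rational_orbit M)"
      unfolding P_eq by (intro finite_imp_compact) auto
    show "g ` rational_orbit M \<subseteq> rational_orbit M"
      by (auto simp: P proj_G[symmetric] G_z)
    show "rational_orbit M \<subseteq> positive_slope_region g xm"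
      using X_in_region by (auto simp: positive_slope_region_def P z_def)
    show "G ` range z \<subseteq> range z"
      by (auto simp: G_z)
    show "(\<lambda>x. x + real k) ` range z = range z"
    proof (intro equalityI subsetI)
      fix x assume "x \<in> range z"
      then obtain i where "x = z i"
        by auto
      then have "x = z (i - int M) + real k"
        using z_add[of "i - int M" 1] by simp
      then show "x \<in> (\<lambda>x. x + real k) ` range z"
        by blast
    next
      fix x assume "x \<in> (\<lambda>x. x + real k) ` range z"
      then obtain i where "x = z i + real k"
        by auto
      then have "x = z (i + int M)"
        using z_add[of i 1] by simp
      then show "x \<in> range z"
        by blast
    qed
    show "\<forall>z1\<in>range z. \<forall>z2\<in>range z. z1 < z2 \<longrightarrow> G z1 \<le> G z2"
    proof (clarify)
      fix i j assume "z i < z j"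
      then have "of_int i / real M \<le> of_int j / real M"
        using X_mono[of "of_int j / real M" "of_int i / real M"] by (force simp: z_def)
      then show "G (z i) \<le> G (z j)"
        unfolding z_def G_X by (intro X_mono) simp
    qed
  qed (simp add: P)
  moreover have "set_has_rotation_number G (rational_orbit M) (real k * b)"
    using X_rotation by (auto simp: set_has_rotation_number_def has_rotation_number_def P z_def)
  ultimately show ?thesis
    by (simp add: kfsm_periodic_orbits_def)
qed

context circle_map
begin

text \<open>A common point aligns the two codings along its orbit. This orbit meets every phase on
  the lattice, and lattice cuts extend the agreement to all real phases, where
  \<open>coding_shift_unique\<close> applies.\<close>

lemma rational_orbit_inj:
  assumes coding: "coding g G xm (cuts k v) k b a1 a2 e" "coding g G xm (cuts k v') k b a1 a2 e"
    and gaps: "k > 0" "v \<in> gaps k \<eta>" "v' \<in> gaps k \<eta>" "\<eta> > 0" "3 * real k * \<eta> < 1"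
    and M: "M > 0" "coprime r (int M)" "b = of_int r / real M"
    and lattice: "\<And>n. \<exists>m. cuts k v n = of_int m / real M" "\<And>n. \<exists>m. cuts k v' n = of_int m / real M"
    and eq: "coding.rational_orbit G xm (cuts k v) b M = coding.rational_orbit G xm (cuts k v') b M"
    and "i < k - 1"
  shows "v i = v' i"
proof -
  interpret v: coding g G xm "cuts k v" k b a1 a2 e
    by fact
  interpret v': coding g G xm "cuts k v'" k b a1 a2 e
    by fact
  have "circle_proj (v.X (of_int 0 / real M)) \<in> v.rational_orbit M"
    unfolding v.rational_orbit_def by (rule image_eqI[of _ _ 0]) simp_all
  then have "circle_proj (v.X 0) \<in> v'.rational_orbit M"
    using eq by simp
  then obtain i0 :: int where "circle_proj (v.X 0) = circle_proj (v'.X (of_int i0 / real M))"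
    by (auto simp: v'.rational_orbit_def)
  then obtain l where l: "v'.X (of_int i0 / real M) = v.X 0 + of_int l"
    by (rule circle_proj_eqE)
  have orbit: "v'.J (of_int i0 / real M + real n * b) = v.J (real n * b) + l" for n
  proof -
    have "(G ^^ n) (v'.X (of_int i0 / real M)) = (G ^^ n) (v.X 0) + of_int l"
      unfolding l by (rule G_pow_add_int)
    then have "\<lfloor>v'.X (of_int i0 / real M + real n * b)\<rfloor> = \<lfloor>v.X (real n * b) + of_int l\<rfloor>"
      by (simp add: v.G_pow_X v'.G_pow_X)
    then show ?thesis
      by (simp add: v.floor_X v'.floor_X)
  qed
  have int: "v'.J (of_int (i0 + m) / real M) = v.J (of_int m / real M) + l" for m
  proof -
    obtain n s where ns: "m = int n * r + s * int M"
      using bezout_index[OF M(2,1), of m] by blast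
    have 1: "of_int m / real M = real n * b + of_int s"
      using M by (simp add: ns field_simps)
    have 2: "of_int (i0 + m) / real M = of_int i0 / real M + real n * b + of_int s"
      using 1 by (simp add: add_divide_distrib)
    show ?thesis
      unfolding 1 2 v.J_add_int v'.J_add_int orbit by simp
  qed
  have "v'.J (t + of_int i0 / real M) = v.J t + l" for t
  proof -
    have "\<lfloor>real M * (t + of_int i0 / real M)\<rfloor> = \<lfloor>real M * t + of_int i0\<rfloor>"
      using M by (simp add: distrib_left)
    also have "\<dots> = i0 + \<lfloor>real M * t\<rfloor>"
      by simp
    finally have "\<lfloor>real M * (t + of_int i0 / real M)\<rfloor> = i0 + \<lfloor>real M * t\<rfloor>" .
    then show ?thesis
      using v.J_lattice[OF M(1) lattice(1), of t] v'.J_lattice[OF M(1) lattice(2), of "t + of_int i0 / real M"]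
        int[of "\<lfloor>real M * t\<rfloor>"] by simp
  qed
  then show ?thesis
    using coding_shift_unique(2)[OF gaps] \<open>i < k - 1\<close> by blast
qed

text \<open>Each of the \<open>k - 1\<close> free gaps runs independently through the multiples of
  \<open>1 / M\<close> in its window, and different choices give different orbits.\<close>

lemma card_kfsm_periodic_orbits_ge:
  assumes "k > 0" "q > 0" "coprime p q" and slopes: "slopes a1 a2"
    and \<eta>: "\<eta> > 0" "3 * real k * \<eta> < 1" "1 \<le> \<eta> * of_int q"
    and slope: "a1 \<le> of_int p / of_int q - 6 * (real k)\<^sup>2 * \<eta>" "of_int p / of_int q + 6 * (real k)\<^sup>2 * \<eta> \<le> a2"
  shows "\<eta> ^ (k - 1) * of_int q ^ (k - 1) \<le>
    real (card (kfsm_periodic_orbits g G xm k (of_int p / of_int q)))"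
proof -
  define S where "S = kfsm_periodic_orbits g G xm k (of_int p / of_int q)"
  obtain d r M where d: "d > 0" and rd: "r * d = p" and Md: "int M * d = int k * q" and M_pos: "M > 0"
    and coprime: "coprime r (int M)" and "q \<le> int M"
    using reduced_slope[OF assms(1-3)] by metis
  then have q_le: "of_int q \<le> real M"
    by linarith
  define b where "b = of_int r / real M"
  have kb: "real k * b = of_int p / of_int q"
  proof -
    have "real_of_int (int M * d) = real k * of_int q" "real_of_int (r * d) = of_int p"
      by (simp_all only: Md rd of_int_mult of_int_of_nat_eq)
    then have "(real k * of_int q) * (of_int r * of_int d) = (real M * of_int d) * of_int p"
      by simp
    then have "real k * of_int r * of_int q * of_int d = of_int p * real M * of_int d"
      by (simp only: ac_simps)
    then have "real k * of_int r * of_int q = of_int p * real M"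
      using d by simp
    then show ?thesis
      using assms(2) M_pos by (simp add: b_def field_simps)
  qed
  define W where "W = {\<lceil>real M * (1 / real k - 3 * \<eta>)\<rceil>..\<lfloor>real M * (1 / real k - \<eta>)\<rfloor>}"
  define T where "T = PiE {..<k - 1} (\<lambda>_. W)"
  define vec where "vec t = (\<lambda>i. of_int (t i) / real M)" for t :: "nat \<Rightarrow> int"
  \<comment> \<open>An interval of length \<open>2 * (\<eta> * real M)\<close> contains at least
    that number minus one of integers, and \<open>1 \<le> \<eta> * real M\<close>.\<close>
  have card_W: "\<eta> * real M \<le> real (card W)"
  proof -
    have "real M * (1 / real k - \<eta>) - real M * (1 / real k - 3 * \<eta>) = 2 * (\<eta> * real M)"
      by (simp add: algebra_simps)
    moreover have "1 \<le> \<eta> * real M"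
      using \<eta>(1,3) mult_left_mono[OF q_le, of \<eta>] by linarith
    ultimately show ?thesis
      unfolding W_def by simp linarith
  qed
  have gaps: "vec t \<in> gaps k \<eta>" if "t \<in> T" for t
    unfolding gaps_def
  proof (intro CollectI allI impI)
    fix i assume "i < k - 1"
    then have "t i \<in> W"
      using that by (auto simp: T_def)
    then have "real M * (1 / real k - 3 * \<eta>) \<le> of_int (t i)" "of_int (t i) \<le> real M * (1 / real k - \<eta>)"
      by (auto simp: W_def ceiling_le_iff le_floor_iff)
    then show "vec t i \<in> {1 / real k - 3 * \<eta>..1 / real k - \<eta>}"
      using M_pos by (simp add: vec_def le_divide_eq divide_le_eq mult.commute)
  qed
  have lattice: "\<exists>m. cuts k (vec t) n = of_int m / real M" for t n
    using M_pos by (intro exI[of _ "int M * (n div int k) + (\<Sum>i<nat (n mod int k). t i)"])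
      (simp add: cuts_def vec_def add_divide_distrib sum_divide_distrib)
  have coding: "coding g G xm (cuts k (vec t)) k b a1 a2 (3 * real k * \<eta>)" if "t \<in> T" for t
    using slope by (intro coding_cuts slopes assms(1) gaps[OF that] \<eta>) (simp_all add: kb)
  define F where "F t = coding.rational_orbit G xm (cuts k (vec t)) b M" for t
  have "F ` T \<subseteq> S"
  proof (rule image_subsetI)
    fix t assume "t \<in> T"
    then interpret coding g G xm "cuts k (vec t)" k b a1 a2 "3 * real k * \<eta>"
      by (rule coding)
    show "F t \<in> S"
      unfolding F_def S_def kb[symmetric]
      by (rule rational_orbit[OF M_pos coprime b_def])
  qed
  moreover have "inj_on F T"
  proof (rule inj_onI)
    fix t t' assume t: "t \<in> T" "t' \<in> T" "F t = F t'"
    have "vec t i = vec t' i" if "i < k - 1" for i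
      using t(3) unfolding F_def
      by (rule rational_orbit_inj[OF coding[OF t(1)] coding[OF t(2)] assms(1) gaps[OF t(1)] gaps[OF t(2)]
        \<eta>(1,2) M_pos coprime b_def lattice lattice _ that])
    then have "t i = t' i" if "i \<in> {..<k - 1}" for i
      using M_pos that by (simp add: vec_def)
    with t(1,2) show "t = t'"
      unfolding T_def by (rule PiE_ext)
  qed
  moreover have "finite S"
    unfolding S_def by (rule card_kfsm_periodic_orbits_le(1)[OF assms(1-3)])
  ultimately have "card T \<le> card S"
    by (intro card_inj_on_le)
  moreover have "card T = card W ^ (k - 1)"
    by (simp add: T_def card_PiE)
  ultimately have "real (card W) ^ (k - 1) \<le> real (card S)"
    by (metis of_nat_le_iff of_nat_power)
  moreover have "(\<eta> * of_int q) ^ (k - 1) \<le> real (card W) ^ (k - 1)"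
  proof (rule power_mono)
    have "\<eta> * of_int q \<le> \<eta> * real M"
      using q_le \<eta>(1) by (intro mult_left_mono) auto
    with card_W show "\<eta> * of_int q \<le> real (card W)"
      by linarith
  qed (use \<eta>(1) assms(2) in simp)
  ultimately have "(\<eta> * of_int q) ^ (k - 1) \<le> real (card S)"
    by linarith
  then show ?thesis
    unfolding S_def power_mult_distrib .
qed

text \<open>The slopes lie at distance \<open>\<epsilon> / 2\<close> from \<open>\<alpha>\<close>,
  strictly between two rotation numbers at distance \<open>\<epsilon>\<close>. The factor 24 makes
  the coding margin \<open>\<epsilon> / 4\<close>, which leaves room to replace
  \<open>\<alpha>\<close> by nearby rationals.\<close>

lemma coding_constants:
  assumes "\<alpha> \<in> interior (rotation_set G)" "k > 0"
  obtains a1 a2 \<eta> where "slopes a1 a2" "\<eta> > 0" "3 * real k * \<eta> < 1"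
    "a1 < \<alpha> - 6 * (real k)\<^sup>2 * \<eta>" "\<alpha> + 6 * (real k)\<^sup>2 * \<eta> < a2"
proof -
  obtain \<epsilon> where \<epsilon>: "\<epsilon> > 0" "cball \<alpha> \<epsilon> \<subseteq> rotation_set G"
    using assms(1) unfolding mem_interior_cball by blast
  have w: "\<alpha> - \<epsilon> \<in> rotation_set G" "\<alpha> + \<epsilon> \<in> rotation_set G"
    using \<epsilon> by (auto simp: dist_real_def subset_iff)
  define a1 a2 \<eta> where "a1 = \<alpha> - \<epsilon> / 2" and "a2 = \<alpha> + \<epsilon> / 2" and "\<eta> = \<epsilon> / (24 * (real k)\<^sup>2)"
  have "\<epsilon> \<le> 1"
    using rotation_set_bounds[OF w(1)] rotation_set_bounds[OF w(2)] by linarith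
  have k1: "1 \<le> real k"
    using assms by simp
  have "6 * (real k)\<^sup>2 * \<eta> = \<epsilon> / 4"
    using k1 by (simp add: \<eta>_def)
  show thesis
  proof (rule that)
    have "G 0 \<le> code (\<lambda>n. \<lfloor>real (Suc n) * a1\<rfloor>)"
      using \<epsilon>(1) by (intro code_floor_ge[OF w(1)]) (simp add: a1_def)
    moreover have "code (\<lambda>n. \<lceil>real (Suc n) * a2\<rceil>) \<le> G xm"
      using \<epsilon>(1) by (intro code_ceiling_le[OF w(2)]) (simp add: a2_def)
    moreover have "0 \<le> a1" "a2 \<le> 1"
      using rotation_set_bounds[OF w(1)] rotation_set_bounds[OF w(2)] \<epsilon>(1) by (simp_all add: a1_def a2_def)
    ultimately show "slopes a1 a2"
      unfolding slopes_def by blast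
    show "\<eta> > 0"
      using \<epsilon>(1) k1 by (simp add: \<eta>_def)
    have "3 * real k * \<eta> = \<epsilon> / (8 * real k)"
      using k1 by (simp add: \<eta>_def power2_eq_square)
    also have "\<dots> \<le> 1 / 8"
      using \<open>\<epsilon> \<le> 1\<close> k1 \<epsilon>(1) by (intro frac_le) auto
    finally show "3 * real k * \<eta> < 1"
      by simp
    show "a1 < \<alpha> - 6 * (real k)\<^sup>2 * \<eta>" "\<alpha> + 6 * (real k)\<^sup>2 * \<eta> < a2"
      using \<epsilon>(1) \<open>6 * (real k)\<^sup>2 * \<eta> = \<epsilon> / 4\<close> by (simp_all add: a1_def a2_def)
  qed
qed

end

text \<open>If \<open>q n = d\<close>, then \<open>d * p n / q n\<close> is an integer. The integers
  are closed and miss \<open>d * \<alpha>\<close>, so each \<open>d\<close> occurs only finitely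
  often.\<close>

lemma denominators_unbounded:
  fixes p q :: "nat \<Rightarrow> int"
  assumes "\<And>n. q n > 0" "(\<lambda>n. real_of_int (p n) / real_of_int (q n)) \<longlonglongrightarrow> \<alpha>" "\<alpha> \<notin> \<rat>"
  shows "\<forall>\<^sub>F n in sequentially. Q < q n"
proof -
  have single: "\<forall>\<^sub>F n in sequentially. q n \<noteq> d" if "d > 0" for d
  proof -
    have irr: "of_int d * \<alpha> \<notin> \<int>"
    proof
      assume "of_int d * \<alpha> \<in> \<int>"
      then obtain m where "of_int d * \<alpha> = of_int m"
        by (auto elim: Ints_cases)
      then have "\<alpha> = of_int m / of_int d"
        using that by (simp add: field_simps)
      then show False
        using assms(3) by simp
    qed
    have "(\<lambda>n. of_int d * (of_int (p n) / of_int (q n))) \<longlonglongrightarrow> of_int d * \<alpha>"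
      by (intro tendsto_intros assms)
    moreover have "open (- (\<int> :: real set))"
      using closed_Ints by (simp add: open_Compl)
    ultimately have "\<forall>\<^sub>F n in sequentially. of_int d * (of_int (p n) / of_int (q n)) \<in> - (\<int> :: real set)"
      using irr by (auto dest: topological_tendstoD)
    then show ?thesis
      by eventually_elim (use that in auto)
  qed
  have "\<forall>\<^sub>F n in sequentially. \<forall>d\<in>{1..Q}. q n \<noteq> d"
    using single by (intro eventually_ball_finite) auto
  then show ?thesis
  proof eventually_elim
    case (elim n)
    with assms(1)[of n] show ?case
      by (cases "q n \<le> Q") auto
  qed
qed

theorem (in circle_map) kfsm_periodic_orbits_growth:
  fixes p q :: "nat \<Rightarrow> int"
  assumes "\<alpha> \<notin> \<rat>" "\<alpha> \<in> interior (rotation_set G)" "k > 0"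
    and pq: "\<And>n. q n > 0" "\<And>n. coprime (p n) (q n)"
    and lim: "(\<lambda>n. real_of_int (p n) / real_of_int (q n)) \<longlonglongrightarrow> \<alpha>"
  shows "(\<lambda>n. real (card (kfsm_periodic_orbits g G xm k (real_of_int (p n) / real_of_int (q n)))))
    \<in> \<Theta>(\<lambda>n. real_of_int (q n) ^ (k - 1))"
proof -
  define N where "N n = real (card (kfsm_periodic_orbits g G xm k (real_of_int (p n) / real_of_int (q n))))" for n
  obtain a1 a2 \<eta> where c: "slopes a1 a2" "\<eta> > 0" "3 * real k * \<eta> < 1"
    "a1 < \<alpha> - 6 * (real k)\<^sup>2 * \<eta>" "\<alpha> + 6 * (real k)\<^sup>2 * \<eta> < a2"
    using coding_constants[OF assms(2,3)] by blast
  have "\<forall>\<^sub>F n in sequentially. \<lceil>1 / \<eta>\<rceil> < q n"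
    by (rule denominators_unbounded[OF pq(1) lim assms(1)])
  moreover have "\<forall>\<^sub>F n in sequentially. a1 + 6 * (real k)\<^sup>2 * \<eta> < of_int (p n) / of_int (q n)"
    using c(4) by (intro order_tendstoD(1)[OF lim]) simp
  moreover have "\<forall>\<^sub>F n in sequentially. of_int (p n) / of_int (q n) < a2 - 6 * (real k)\<^sup>2 * \<eta>"
    using c(5) by (intro order_tendstoD(2)[OF lim]) simp
  ultimately have ge: "\<forall>\<^sub>F n in sequentially. \<eta> ^ (k - 1) * of_int (q n) ^ (k - 1) \<le> N n"
  proof eventually_elim
    case (elim n)
    have "1 / \<eta> \<le> of_int (q n)"
      using elim(1) by linarith
    then have "1 \<le> \<eta> * of_int (q n)"
      using c(2) by (simp add: field_simps)
    then show ?case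
      unfolding N_def using elim by (intro card_kfsm_periodic_orbits_ge[OF assms(3) pq c(1-3)]) auto
  qed
  show ?thesis
    unfolding N_def[symmetric]
  proof (rule bigthetaI')
    show "0 < \<eta> ^ (k - 1)" "0 < (real k + 1) ^ (k - 1)"
      using c(2) by simp_all
    show "\<forall>\<^sub>F n in sequentially. \<eta> ^ (k - 1) * norm (real_of_int (q n) ^ (k - 1)) \<le> norm (N n) \<and>
        norm (N n) \<le> (real k + 1) ^ (k - 1) * norm (real_of_int (q n) ^ (k - 1))"
      using ge
    proof eventually_elim
      case (elim n)
      have "norm (real_of_int (q n) ^ (k - 1)) = real_of_int (q n) ^ (k - 1)"
        using pq(1)[of n] by simp
      with elim card_kfsm_periodic_orbits_le(2)[OF assms(3) pq(1)[of n] pq(2)[of n]] show ?case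
        by (simp add: N_def)
    qed
  qed
qed

section \<open>Minimal sets of irrational slope\<close>

text \<open>Disjoint neighbourhoods are pulled back from the plane along the continuous injection
  \<open>E\<close> onto the unit circle.\<close>

instance circle :: t2_space
proof
  fix x y :: circle assume "x \<noteq> y"
  obtain s t where st: "x = circle_proj s" "y = circle_proj t"
    by (metis circle_proj_rep)
  define E where "E z = (cos (2 * pi * circle_rep z), sin (2 * pi * circle_rep z))" for z
  have E: "E (circle_proj u) = (cos (2 * pi * u), sin (2 * pi * u))" for u
  proof -
    obtain l where "circle_rep (circle_proj u) = u + of_int l"
      by (rule circle_rep_projE)
    then have "2 * pi * circle_rep (circle_proj u) = 2 * pi * (u + of_int l)"
      by (rule arg_cong)
    then have "2 * pi * circle_rep (circle_proj u) = 2 * pi * u + 2 * pi * of_int l"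
      by (simp only: distrib_left)
    then have "\<exists>l::int. 2 * pi * circle_rep (circle_proj u) = 2 * pi * u + 2 * pi * of_int l"
      by (rule exI)
    then have "sin (2 * pi * circle_rep (circle_proj u)) = sin (2 * pi * u) \<and>
        cos (2 * pi * circle_rep (circle_proj u)) = cos (2 * pi * u)"
      by (simp only: sin_cos_eq_iff)
    then show ?thesis
      by (simp add: E_def)
  qed
  have "continuous_on UNIV E"
    by (rule continuous_circle_lift) (auto simp: E intro!: continuous_intros)
  have "E x \<noteq> E y"
  proof
    assume "E x = E y"
    then obtain n :: int where "2 * pi * s = 2 * pi * t + 2 * pi * of_int n"
      using sin_cos_eq_iff[of "2 * pi * s" "2 * pi * t"] by (simp add: st E) blast
    then have "2 * pi * s = 2 * pi * (t + of_int n)"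
      by (simp add: distrib_left)
    then have "s = t + of_int n"
      by simp
    with \<open>x \<noteq> y\<close> show False
      by (simp add: st)
  qed
  from hausdorff[OF this]
  obtain U V where UV: "open U" "open V" "E x \<in> U" "E y \<in> V" "U \<inter> V = {}"
    by blast
  have "open (E -` U)" "open (E -` V)"
    using \<open>continuous_on UNIV E\<close> UV(1,2) by (auto simp: continuous_on_open_vimage)
  with UV show "\<exists>U V. open U \<and> open V \<and> x \<in> U \<and> y \<in> V \<and> U \<inter> V = {}"
    by (intro exI[of _ "E -` U"] exI[of _ "E -` V"]) auto
qed

lemma compact_circle: "compact (UNIV :: circle set)"
proof -
  have "z \<in> circle_proj ` {0..1}" for z
  proof
    have "circle_proj (frac (circle_rep z)) = circle_proj (circle_rep z)"
      by (simp only: circle_proj_eq_iff) (simp add: frac_def)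
    then show "z = circle_proj (frac (circle_rep z))"
      by simp
    show "frac (circle_rep z) \<in> {0..1}"
      using frac_lt_1[of "circle_rep z"] by (simp add: frac_ge_0)
  qed
  then have eq: "UNIV = circle_proj ` {0..1}"
    by blast
  show ?thesis
    by (subst eq) (intro compact_continuous_image continuous_on_subset[OF continuous_circle_proj]
      compact_Icc subset_UNIV)
qed

lemma irrational_orbit_dense:
  fixes b s t d :: real
  assumes "b \<notin> \<rat>" "d > 0"
  obtains n :: nat and m :: int where "s < t + real n * b + of_int m" "t + real n * b + of_int m < s + d"
proof -
  define x where "x = s + d / 2 - t"
  obtain n where "\<bar>frac (real n * b) - frac x\<bar> < d / 2"
    using Kronecker_approx_1_explicit[OF assms(1), of "frac x" "d / 2"] assms(2)
    by (auto simp: frac_ge_0 frac_lt_1 less_imp_le)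
  then have close: "\<bar>real n * b + of_int (\<lfloor>x\<rfloor> - \<lfloor>real n * b\<rfloor>) - x\<bar> < d / 2"
    by (simp add: frac_def algebra_simps)
  show thesis
  proof (rule that)
    show "s < t + real n * b + of_int (\<lfloor>x\<rfloor> - \<lfloor>real n * b\<rfloor>)"
      "t + real n * b + of_int (\<lfloor>x\<rfloor> - \<lfloor>real n * b\<rfloor>) < s + d"
      using close x_def by linarith+
  qed
qed

section \<open>The phase of a point and the closure of the coded points\<close>

locale irrational_coding = coding +
  assumes irrational: "b \<notin> \<rat>"
begin

text \<open>Density of the rotation orbit moves a cut between the images of the two phases; there
  the piece indices differ, hence so do the points.\<close>

lemma X_strict_mono: assumes "s < t" shows "X s < X t"
proof -
  obtain n m where nm: "c 0 - t < 0 + real n * b + of_int m" "0 + real n * b + of_int m < c 0 - t + (t - s)"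
    using irrational_orbit_dense[OF irrational, of "t - s" "c 0 - t" 0] assms by auto
  have "J (s + real n * b + of_int m) < 0" "0 \<le> J (t + real n * b + of_int m)"
    using le_J_iff[of 0 "s + real n * b + of_int m"] le_J_iff[of 0 "t + real n * b + of_int m"] nm
    by auto
  then have "J (s + real n * b) < J (t + real n * b)"
    by (simp add: J_add_int)
  then have "X (s + real n * b) \<noteq> X (t + real n * b)"
    using floor_X[of "s + real n * b"] floor_X[of "t + real n * b"] by auto
  then have "X s \<noteq> X t"
    using G_pow_X[of n s] G_pow_X[of n t] by auto
  with X_mono[of s t] assms show ?thesis
    by simp
qed

lemma X_le_iff [simp]: "X s \<le> X t \<longleftrightarrow> s \<le> t"
  using X_strict_mono[of t s] X_mono[of s t] by (cases "s \<le> t") auto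

lemma X_less_iff [simp]: "X s < X t \<longleftrightarrow> s < t"
  using X_le_iff[of t s] by linarith

text \<open>Monotone left inverse of \<open>X\<close> that assigns one phase to a whole jump. On
  \<open>lifted_set\<close> it semiconjugates \<open>G\<close> to translation by \<open>b\<close>,
  see \<open>Theta_G\<close>.\<close>

definition \<Theta> :: "real \<Rightarrow> real"
  where "\<Theta> w = Sup {t. X t \<le> w}"

lemma Theta_set: "{t. X t \<le> w} \<noteq> {}" "bdd_above {t. X t \<le> w}"
proof -
  have k: "0 < real k"
    using k_pos by simp
  have "X ((w - 1) / real k - e) \<le> w"
    using X_affine_bounds(2)[of "(w - 1) / real k - e"] k by simp
  then show "{t. X t \<le> w} \<noteq> {}"
    by blast
  have "t \<le> (w + 1) / real k + e" if "X t \<le> w" for t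
  proof -
    have "real k * (t - e) \<le> w + 1"
      using X_affine_bounds(1)[of t] that by simp
    then show ?thesis
      using k by (simp add: field_simps)
  qed
  then show "bdd_above {t. X t \<le> w}"
    by (auto simp: bdd_above_def)
qed

lemma le_Theta: "X t \<le> w \<Longrightarrow> t \<le> \<Theta> w"
  unfolding \<Theta>_def using Theta_set(2) by (intro cSup_upper) auto

lemma Theta_greater: assumes "t < \<Theta> w" shows "X t \<le> w"
proof -
  obtain s where "X s \<le> w" "t < s"
    using assms less_cSup_iff[OF Theta_set(1,2), of t w] by (auto simp: \<Theta>_def)
  then show ?thesis
    by (intro order_trans[OF X_mono[of t s]]) auto
qed

lemma Theta_le: "w < X t \<Longrightarrow> \<Theta> w \<le> t"
  using Theta_greater[of t w] by force

lemma Theta_less: "\<Theta> w < t \<Longrightarrow> w < X t"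
  using le_Theta[of t w] by force

lemma Theta_X [simp]: "\<Theta> (X t) = t"
proof (rule antisym)
  show "\<Theta> (X t) \<le> t"
    by (rule dense_ge) (simp add: Theta_le)
qed (simp add: le_Theta)

lemma Theta_mono: "w \<le> w' \<Longrightarrow> \<Theta> w \<le> \<Theta> w'"
  unfolding \<Theta>_def using Theta_set by (intro cSup_subset_mono) auto

lemma Theta_add: "\<Theta> (w + real k * of_int m) = \<Theta> w + of_int m"
proof -
  have le: "\<Theta> w + of_int m \<le> \<Theta> (w + real k * of_int m)" for w m
  proof (rule dense_le)
    fix t assume "t < \<Theta> w + of_int m"
    then have "X (t + of_int (- m)) \<le> w"
      by (intro Theta_greater) simp
    then show "t \<le> \<Theta> (w + real k * of_int m)"
      unfolding X_add_int by (intro le_Theta) simp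
  qed
  show ?thesis
    using le[of w m] le[of "w + real k * of_int m" "- m"] by simp
qed

text \<open>Since \<open>X\<close> is increasing and right continuous, the closure adds only the
  left limits at its jumps.\<close>

definition lifted_set :: "real set"
  where "lifted_set = closure (range X)"

definition denjoy_set :: "circle set"
  where "denjoy_set = circle_proj ` lifted_set"

lemma X_in_lifted_set [simp]: "X t \<in> lifted_set"
  unfolding lifted_set_def by (intro subsetD[OF closure_subset] rangeI)

lemma closed_lifted_set: "closed lifted_set"
  by (simp add: lifted_set_def)

lemma lifted_set_meets:
  assumes "w \<in> lifted_set" "open U" "w \<in> U"
  obtains t where "X t \<in> U"
proof -
  have "U \<inter> closure (range X) \<noteq> {}"
    using assms by (auto simp: lifted_set_def)
  then have "U \<inter> range X \<noteq> {}"
    by (simp only: open_Int_closure_eq_empty[OF assms(2)] not_False_eq_True)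
  with that show thesis
    by auto
qed

lemma G_lifted_set: "w \<in> lifted_set \<Longrightarrow> G w \<in> lifted_set"
proof -
  have "G ` closure (range X) \<subseteq> closure (range X)"
  proof (rule image_closure_subset)
    show "G ` range X \<subseteq> closure (range X)"
      using X_in_lifted_set by (auto simp: G_X lifted_set_def)
  qed (auto intro: continuous_on_subset[OF G_cont])
  then show "w \<in> lifted_set \<Longrightarrow> G w \<in> lifted_set"
    by (auto simp: lifted_set_def)
qed

lemma lifted_set_add: "w \<in> lifted_set \<Longrightarrow> w + real k * of_int m \<in> lifted_set"
proof -
  have "(\<lambda>w. w + real k * of_int m) ` closure (range X) \<subseteq> closure (range X)"
  proof (rule image_closure_subset)
    show "(\<lambda>w. w + real k * of_int m) ` range X \<subseteq> closure (range X)"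
      using X_in_lifted_set by (auto simp: lifted_set_def simp flip: X_add_int)
  qed (auto intro!: continuous_intros)
  then show "w \<in> lifted_set \<Longrightarrow> w + real k * of_int m \<in> lifted_set"
    by (auto simp: lifted_set_def)
qed

lemma G_mono_lifted_set:
  assumes "w \<in> lifted_set" "w' \<in> lifted_set" "w \<le> w'"
  shows "G w \<le> G w'"
proof (cases "w = w'")
  case False
  with assms have "w < w'"
    by simp
  obtain s where s: "\<And>n. s n \<in> range X" "s \<longlonglongrightarrow> w"
    using assms(1) by (auto simp: lifted_set_def closure_sequential)
  obtain t where t: "\<And>n. t n \<in> range X" "t \<longlonglongrightarrow> w'"
    using assms(2) by (auto simp: lifted_set_def closure_sequential)
  have "(\<lambda>n. t n - s n) \<longlonglongrightarrow> w' - w"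
    by (intro tendsto_intros s t)
  then have "\<forall>\<^sub>F n in sequentially. 0 < t n - s n"
    using \<open>w < w'\<close> by (intro order_tendstoD(1)) auto
  then have ev: "\<forall>\<^sub>F n in sequentially. G (s n) \<le> G (t n)"
  proof eventually_elim
    case (elim n)
    obtain u v where "s n = X u" "t n = X v"
      using s(1)[of n] t(1)[of n] by auto
    with elim show ?case
      by (simp add: G_X)
  qed
  have "(\<lambda>n. G (s n)) \<longlonglongrightarrow> G w" "(\<lambda>n. G (t n)) \<longlonglongrightarrow> G w'"
    by (intro continuous_on_tendsto_compose[OF G_cont] s t; simp)+
  then show ?thesis
    using ev by (intro tendsto_le[OF sequentially_bot])
qed simp

text \<open>The phase controls \<open>w\<close> only through \<open>X\<close> at strictly smaller or
  strictly larger phases, so each inequality is obtained by approximation.\<close>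

lemma Theta_G: assumes "w \<in> lifted_set" shows "\<Theta> (G w) = \<Theta> w + b"
proof (rule antisym)
  show "\<Theta> w + b \<le> \<Theta> (G w)"
  proof (rule dense_le)
    fix t assume "t < \<Theta> w + b"
    then have "X (t - b) \<le> w"
      by (intro Theta_greater) simp
    then have "G (X (t - b)) \<le> G w"
      using assms by (intro G_mono_lifted_set) auto
    then show "t \<le> \<Theta> (G w)"
      by (intro le_Theta) (simp add: G_X)
  qed
  show "\<Theta> (G w) \<le> \<Theta> w + b"
  proof (rule dense_ge)
    fix t assume "\<Theta> w + b < t"
    then obtain s where s: "\<Theta> w + b < s" "s < t"
      using dense by blast
    then have "w < X (s - b)"
      by (intro Theta_less) simp
    then have "G w \<le> G (X (s - b))"
      using assms by (intro G_mono_lifted_set) auto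
    also have "\<dots> < X t"
      using s by (simp add: G_X)
    finally show "\<Theta> (G w) \<le> t"
      by (rule Theta_le)
  qed
qed

lemma G_pow_lifted_set: "w \<in> lifted_set \<Longrightarrow> (G ^^ n) w \<in> lifted_set"
  by (induction n) (auto intro: G_lifted_set)

lemma Theta_G_pow: "w \<in> lifted_set \<Longrightarrow> \<Theta> ((G ^^ n) w) = \<Theta> w + real n * b"
  by (induction n) (auto simp: Theta_G G_pow_lifted_set algebra_simps)

text \<open>Replaces \<open>floor_X\<close> at points outside the range of \<open>X\<close>: at a
  jump, the index may belong to either side.\<close>

lemma floor_bounds:
  assumes "0 < d"
  shows "J (\<Theta> w - d) \<le> \<lfloor>w\<rfloor>" "\<lfloor>w\<rfloor> \<le> J (\<Theta> w + d)"
proof -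
  have "X (\<Theta> w - d) \<le> w" "w \<le> X (\<Theta> w + d)"
    using assms Theta_greater[of "\<Theta> w - d" w] Theta_less[of w "\<Theta> w + d"] by auto
  then show "J (\<Theta> w - d) \<le> \<lfloor>w\<rfloor>" "\<lfloor>w\<rfloor> \<le> J (\<Theta> w + d)"
    using floor_mono[of "X (\<Theta> w - d)" w] floor_mono[of w "X (\<Theta> w + d)"] by (simp_all add: floor_X)
qed

text \<open>The space between \<open>[j, j + xm]\<close> and the next such interval is open and
  misses the range of \<open>X\<close>, hence also its closure.\<close>

lemma lifted_set_unit: assumes "w \<in> lifted_set" shows "w \<in> {of_int \<lfloor>w\<rfloor>..of_int \<lfloor>w\<rfloor> + xm}"
proof (rule ccontr)
  assume "\<not> ?thesis"
  then have "w \<in> {of_int \<lfloor>w\<rfloor> + xm<..<of_int \<lfloor>w\<rfloor> + 1}"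
    by simp
  then obtain t where "X t \<in> {of_int \<lfloor>w\<rfloor> + xm<..<of_int \<lfloor>w\<rfloor> + 1}"
    by (rule lifted_set_meets[OF assms open_greaterThanLessThan])
  then have t: "of_int \<lfloor>w\<rfloor> + xm < X t" "X t < of_int \<lfloor>w\<rfloor> + 1"
    by auto
  then have "real_of_int (J t) < of_int \<lfloor>w\<rfloor> + 1"
    using X_bounds(1)[of t] by simp
  then have "J t \<le> \<lfloor>w\<rfloor>"
    by linarith
  then show False
    using t(1) X_bounds(2)[of t] by simp
qed

text \<open>Density of the rotation orbit gives minimality, in a form that also covers the quotients of
  the line other than the circle itself.\<close>

lemma lifted_set_minimal:
  assumes Y: "Y \<subseteq> lifted_set" "closed Y" "Y \<noteq> {}"
    and inv: "\<And>w. w \<in> Y \<Longrightarrow> G w \<in> Y" "\<And>w m. w \<in> Y \<Longrightarrow> w + real k * of_int m \<in> Y"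
  shows "Y = lifted_set"
proof -
  obtain y where y: "y \<in> Y"
    using Y by blast
  have "X t \<in> Y" for t
  proof -
    have "X t \<in> closure Y"
      unfolding closure_approachable
    proof (intro allI impI)
      fix \<epsilon> :: real assume "0 < \<epsilon>"
      then obtain d where d: "0 < d" "\<And>s. t \<le> s \<Longrightarrow> s < t + d \<Longrightarrow> \<bar>X s - X t\<bar> < \<epsilon>"
        using X_right_cont by blast
      \<comment> \<open>The phase of \<open>w\<close> is placed strictly to the right of
        \<open>t\<close>, where right continuity applies; \<open>X t \<le> w < X s\<close> then
        forces \<open>w\<close> close to \<open>X t\<close>.\<close>
      obtain n m where nm: "t < \<Theta> y + real n * b + of_int m" "\<Theta> y + real n * b + of_int m < t + d"
        using irrational_orbit_dense[OF irrational d(1)] by blast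
      define w where "w = (G ^^ n) y + real k * of_int m"
      have "(G ^^ n) y \<in> Y"
        using y by (induction n) (auto intro: inv)
      then have "w \<in> Y"
        unfolding w_def by (rule inv)
      have \<Theta>w: "\<Theta> w = \<Theta> y + real n * b + of_int m"
        using y Y(1) by (auto simp: w_def Theta_add Theta_G_pow)
      then obtain s where s: "\<Theta> w < s" "s < t + d"
        using nm dense by metis
      have "X t \<le> w" "w < X s"
        using nm s by (auto simp: \<Theta>w[symmetric] intro: Theta_greater Theta_less)
      moreover have "\<bar>X s - X t\<bar> < \<epsilon>"
        using nm s by (intro d(2)) (auto simp: \<Theta>w)
      ultimately show "\<exists>w\<in>Y. dist w (X t) < \<epsilon>"
        using \<open>w \<in> Y\<close> by (intro bexI[of _ w]) (auto simp: dist_real_def)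
    qed
    then show ?thesis
      using Y(2) by simp
  qed
  then have "lifted_set \<subseteq> Y"
    unfolding lifted_set_def using Y(2) by (intro closure_minimal) auto
  with Y(1) show ?thesis
    by blast
qed

text \<open>\<open>lifted_set\<close> is unbounded, but a function of period \<open>k\<close> takes
  all its values there on the compact part in \<open>{0..real k}\<close>.\<close>

lemma image_lifted_set_period:
  assumes "\<And>w m. f (w + real k * of_int m) = f w"
  shows "f ` lifted_set = f ` (lifted_set \<inter> {0..real k})"
proof (intro equalityI image_subsetI)
  fix w assume w: "w \<in> lifted_set"
  define m where "m = - \<lfloor>w / real k\<rfloor>"
  have "0 \<le> w / real k + of_int m" "w / real k + of_int m \<le> 1"
    unfolding m_def by linarith+
  then have "0 \<le> real k * (w / real k + of_int m)" "real k * (w / real k + of_int m) \<le> real k * 1"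
    by (intro mult_nonneg_nonneg mult_left_mono; simp)+
  then have "w + real k * of_int m \<in> lifted_set \<inter> {0..real k}"
    using lifted_set_add[OF w, of m] k_pos by (simp add: distrib_left)
  then show "f w \<in> f ` (lifted_set \<inter> {0..real k})"
    by (intro image_eqI[of _ _ "w + real k * of_int m"]) (simp add: assms)
qed auto

lemma compact_image_lifted_set:
  assumes "\<And>w m. f (w + real k * of_int m) = f w" "continuous_on UNIV f"
  shows "compact (f ` lifted_set)"
  unfolding image_lifted_set_period[of f, OF assms(1)]
  by (intro compact_continuous_image continuous_on_subset[OF assms(2)] closed_Int_compact
    closed_lifted_set compact_Icc) auto

lemma proj_period: "circle_proj (w + real k * of_int m) = circle_proj w"
  using circle_proj_add_int[of w "int k * m"] by simp

lemma proj_scaled_period: "circle_proj ((w + real k * of_int m) / real k) = circle_proj (w / real k)"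
  using k_pos by (simp add: add_divide_distrib)

lemma compact_denjoy_set: "compact denjoy_set"
  unfolding denjoy_set_def
  by (intro compact_image_lifted_set proj_period continuous_circle_proj)

lemma kfsm_denjoy_set: "kfsm g G xm k denjoy_set"
  unfolding kfsm_def
proof (intro conjI exI)
  show "compact denjoy_set"
    by (rule compact_denjoy_set)
  show "g ` denjoy_set \<subseteq> denjoy_set"
    by (auto simp: denjoy_set_def G_lifted_set simp flip: proj_G)
  have "circle_proj w \<in> circle_proj ` {0..xm}" if "w \<in> lifted_set" for w
  proof
    show "circle_proj w = circle_proj (w - of_int \<lfloor>w\<rfloor>)"
      by (simp add: circle_proj_eq_iff)
    show "w - of_int \<lfloor>w\<rfloor> \<in> {0..xm}"
      using lifted_set_unit[OF that] by simp
  qed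
  then show "denjoy_set \<subseteq> positive_slope_region g xm"
    by (auto simp: positive_slope_region_def denjoy_set_def G_pow_lifted_set simp flip: proj_G_pow)
  show "G ` lifted_set \<subseteq> lifted_set"
    using G_lifted_set by blast
  show "circle_proj ` lifted_set = denjoy_set"
    by (simp add: denjoy_set_def)
  show "(\<lambda>x. x + real k) ` lifted_set = lifted_set"
  proof (intro equalityI subsetI)
    fix x assume "x \<in> lifted_set"
    then have "x - real k \<in> lifted_set"
      using lifted_set_add[of x "-1"] by simp
    then show "x \<in> (\<lambda>x. x + real k) ` lifted_set"
      by (intro image_eqI[of _ _ "x - real k"]) auto
  qed (use lifted_set_add[of _ 1] in auto)
  show "\<forall>z1\<in>lifted_set. \<forall>z2\<in>lifted_set. z1 < z2 \<longrightarrow> G z1 \<le> G z2"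
    by (auto intro: G_mono_lifted_set)
qed

text \<open>Closed invariant subsets of the image pull back to \<open>lifted_set\<close>. Used with
  \<open>circle_proj\<close> for the set itself and with
  \<open>w \<mapsto> circle_proj (w / real k)\<close> for its monotone model.\<close>

lemma minimal_image_lifted_set:
  assumes period: "\<And>w m. f (w + real k * of_int m) = f w" and cont: "continuous_on UNIV f"
    and conj: "\<And>w. w \<in> lifted_set \<Longrightarrow> h (f w) = f (G w)"
  shows "minimal_set h (f ` lifted_set)"
  unfolding minimal_set_def
proof (intro conjI allI impI)
  show "f ` lifted_set \<noteq> {}"
    using X_in_lifted_set by blast
  show "compact (f ` lifted_set)"
    by (rule compact_image_lifted_set[OF period cont])
  show "h ` f ` lifted_set \<subseteq> f ` lifted_set"
    by (auto simp: conj G_lifted_set)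
  fix Y assume Y: "Y \<noteq> {} \<and> compact Y \<and> Y \<subseteq> f ` lifted_set \<and> h ` Y \<subseteq> Y"
  have "lifted_set \<inter> f -` Y = lifted_set"
  proof (rule lifted_set_minimal)
    show "closed (lifted_set \<inter> f -` Y)"
      using Y cont by (intro closed_Int closed_lifted_set closed_vimage compact_imp_closed) auto
    show "lifted_set \<inter> f -` Y \<noteq> {}"
      using Y by blast
    show "G w \<in> lifted_set \<inter> f -` Y" if "w \<in> lifted_set \<inter> f -` Y" for w
      using that Y conj[of w] by (auto simp: G_lifted_set)
    show "w + real k * of_int m \<in> lifted_set \<inter> f -` Y" if "w \<in> lifted_set \<inter> f -` Y" for w m
      using that by (auto simp: lifted_set_add period)
  qed auto
  then show "Y = f ` lifted_set"
    using Y by blast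
qed

lemma minimal_denjoy_set: "minimal_set g denjoy_set"
  unfolding denjoy_set_def
  by (intro minimal_image_lifted_set proj_period continuous_circle_proj) (simp add: proj_G)

lemma lifted_set_rotation:
  assumes "w \<in> lifted_set"
  shows "(\<lambda>n. ((G ^^ n) w - w) / real n) \<longlonglongrightarrow> real k * b"
proof (rule LIMSEQ_affine_sandwich)
  fix n
  have "X (\<Theta> w + real n * b - 1) \<le> (G ^^ n) w" "(G ^^ n) w \<le> X (\<Theta> w + real n * b + 1)"
    using Theta_G_pow[OF assms, of n] Theta_greater[of "\<Theta> w + real n * b - 1" "(G ^^ n) w"]
      Theta_less[of "(G ^^ n) w" "\<Theta> w + real n * b + 1"] by auto
  then have "real k * (\<Theta> w + real n * b - 1 - e) - 1 - w \<le> (G ^^ n) w - w"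
    "(G ^^ n) w - w \<le> real k * (\<Theta> w + real n * b + 1 + e) + 1 - w"
    using X_affine_bounds(1)[of "\<Theta> w + real n * b - 1"]
      X_affine_bounds(2)[of "\<Theta> w + real n * b + 1"] by linarith+
  then show "(real k * (\<Theta> w - 1 - e) - 1 - w) + real n * (real k * b) \<le> (G ^^ n) w - w"
    "(G ^^ n) w - w \<le> (real k * (\<Theta> w + 1 + e) + 1 - w) + real n * (real k * b)"
    by (simp_all add: algebra_simps)
qed

lemma denjoy_set_rotation: "set_has_rotation_number G denjoy_set (real k * b)"
  using lifted_set_rotation
  by (auto simp: set_has_rotation_number_def has_rotation_number_def denjoy_set_def)

end

section \<open>Conjugacy to a monotone circle map\<close>

context irrational_coding
begin

text \<open>On the unit interval number \<open>j\<close> the map \<open>G\<close> is cut off at the images of the first points of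
  \<open>lifted_set\<close> in this and the next interval, which makes it monotone and continuous.\<close>

definition base :: "real \<Rightarrow> real"
  where "base t = G (min t xm) + max 0 (t - xm) / (1 - xm)"

definition lo :: "int \<Rightarrow> real"
  where "lo j = X (c j + b)"

definition piece :: "int \<Rightarrow> real \<Rightarrow> real"
  where "piece j x = max (lo j) (min (lo (j + 1)) (base (x - of_int j) + of_int j))"

definition G_mon :: "real \<Rightarrow> real"
  where "G_mon x = piece \<lfloor>x\<rfloor> x"

lemma base_cont: "continuous_on UNIV base"
  unfolding base_def using xm_less_1
  by (intro continuous_intros continuous_on_compose2[OF G_cont]) auto

lemma base_mono: "0 \<le> s \<Longrightarrow> s \<le> t \<Longrightarrow> base s \<le> base t"
  unfolding base_def using xm_pos xm_less_1
  by (intro add_mono G_mono divide_right_mono) auto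

lemma lo_mono: "i \<le> j \<Longrightarrow> lo i \<le> lo j"
  unfolding lo_def using strict_mono_less_eq[OF c_mono] by simp

lemma lo_eq: "lo j = G (X (c j) - of_int j) + of_int j" "X (c j) - of_int j \<in> {0..xm}"
proof -
  show "lo j = G (X (c j) - of_int j) + of_int j"
    using G_add_int[of "X (c j) - of_int j" j] by (simp add: lo_def G_X)
  show "X (c j) - of_int j \<in> {0..xm}"
    using X_bounds[of "c j"] by (simp add: J_c)
qed

text \<open>\<open>base\<close> starts at \<open>G 0\<close>, not above \<open>lo j\<close>, and its
  ramp of height one over \<open>[xm, 1]\<close> lifts the right end to \<open>G xm + 1\<close>, not
  below \<open>lo (j + 1)\<close>. So both clamps are attained and neighbouring pieces fit
  together.\<close>

lemma piece_ends: "piece j (of_int j) = lo j" "piece j (of_int j + 1) = lo (j + 1)"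
proof -
  have "base 0 + of_int j \<le> lo j"
    using lo_eq[of j] xm_pos G_mono[of 0 "X (c j) - of_int j"] by (simp add: base_def)
  then show "piece j (of_int j) = lo j"
    using lo_mono[of j "j + 1"] by (simp add: piece_def)
  have "lo (j + 1) \<le> base 1 + of_int j"
    using lo_eq[of "j + 1"] xm_pos xm_less_1 G_mono[of "X (c (j + 1)) - of_int (j + 1)" xm]
    by (simp add: base_def)
  then show "piece j (of_int j + 1) = lo (j + 1)"
    using lo_mono[of j "j + 1"] by (simp add: piece_def)
qed

lemma piece_cont: "continuous_on UNIV (piece j)"
  unfolding piece_def
  by (intro continuous_intros continuous_on_compose2[OF base_cont]) auto

lemma piece_mono: "of_int j \<le> x \<Longrightarrow> x \<le> y \<Longrightarrow> piece j x \<le> piece j y"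
  unfolding piece_def by (intro max.mono min.mono add_mono base_mono) auto

lemma piece_bounds: "lo j \<le> piece j x" "piece j x \<le> lo (j + 1)"
  using lo_mono[of j "j + 1"] by (auto simp: piece_def)

lemma G_mon_eq_piece:
  assumes "x \<in> {of_int j..of_int j + 1}"
  shows "G_mon x = piece j x"
proof (cases "x = of_int j + 1")
  case True
  then have "\<lfloor>x\<rfloor> = j + 1"
    by simp
  then show ?thesis
    using piece_ends(1)[of "j + 1"] piece_ends(2)[of j] True by (simp add: G_mon_def)
next
  case False
  then have "\<lfloor>x\<rfloor> = j"
    using assms by (intro floor_unique) auto
  then show ?thesis
    by (simp add: G_mon_def)
qed

lemma G_mon_cont: "continuous_on UNIV G_mon"
proof -
  have "isCont G_mon x" for x
  proof -
    define j where "j = \<lfloor>x\<rfloor>"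
    have piece: "continuous_on {of_int i..of_int i + 1} G_mon" for i
    proof (rule continuous_on_eq)
      show "continuous_on {of_int i..of_int i + 1} (piece i)"
        by (rule continuous_on_subset[OF piece_cont]) simp
      show "piece i y = G_mon y" if "y \<in> {of_int i..of_int i + 1}" for y
        using G_mon_eq_piece[OF that] by simp
    qed
    have "continuous_on ({of_int (j - 1)..of_int (j - 1) + 1} \<union> {of_int j..of_int j + 1}) G_mon"
      by (intro continuous_on_closed_Un piece closed_atLeastAtMost)
    then have "continuous_on {of_int j - 1<..<of_int j + 1} G_mon"
      by (rule continuous_on_subset) auto
    moreover have "x \<in> {of_int j - 1<..<of_int j + 1}"
      unfolding j_def by (simp; linarith)
    ultimately show ?thesis
      by (simp add: continuous_on_eq_continuous_at)
  qed
  then show ?thesis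
    by (simp add: continuous_at_imp_continuous_on)
qed

lemma G_mon_mono: assumes "x \<le> y" shows "G_mon x \<le> G_mon y"
proof (cases "\<lfloor>x\<rfloor> = \<lfloor>y\<rfloor>")
  case True
  have "piece \<lfloor>y\<rfloor> x \<le> piece \<lfloor>y\<rfloor> y"
    using assms True of_int_floor_le[of x] by (intro piece_mono) simp_all
  then show ?thesis
    by (simp add: G_mon_def True)
next
  case False
  then have "\<lfloor>x\<rfloor> + 1 \<le> \<lfloor>y\<rfloor>"
    using floor_mono[OF assms] by linarith
  then show ?thesis
    using piece_bounds(2)[of "\<lfloor>x\<rfloor>" x] piece_bounds(1)[of "\<lfloor>y\<rfloor>" y] lo_mono[of "\<lfloor>x\<rfloor> + 1" "\<lfloor>y\<rfloor>"]
    by (simp add: G_mon_def)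
qed

lemma G_mon_add: "G_mon (x + real k * of_int m) = G_mon x + real k * of_int m"
proof -
  have lo: "lo (j + int k * m) = lo j + real k * of_int m" for j
  proof -
    have "c (j + int k * m) + b = c j + b + of_int m"
      by (simp add: c_add_mult)
    then show ?thesis
      by (simp only: lo_def X_add_int)
  qed
  have floor: "\<lfloor>x + real k * of_int m\<rfloor> = \<lfloor>x\<rfloor> + int k * m"
    using floor_add_int[of x "int k * m"] by simp
  have lo1: "lo (\<lfloor>x\<rfloor> + int k * m + 1) = lo (\<lfloor>x\<rfloor> + 1) + real k * of_int m"
    using lo[of "\<lfloor>x\<rfloor> + 1"] by (simp add: algebra_simps)
  show ?thesis
    unfolding G_mon_def piece_def floor lo lo1 by (simp add: max_def min_def)
qed

text \<open>\<open>X (c j)\<close> is the first point of \<open>lifted_set\<close> in interval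
  number \<open>j\<close>, and \<open>X (c (j + 1))\<close> lies beyond that interval; monotonicity
  of \<open>G\<close> on \<open>lifted_set\<close> makes both cut-offs inactive.\<close>

lemma G_mon_eq_G: assumes "w \<in> lifted_set" shows "G_mon w = G w"
proof -
  define j where "j = \<lfloor>w\<rfloor>"
  have w: "w \<in> {of_int j..of_int j + xm}"
    unfolding j_def by (rule lifted_set_unit[OF assms])
  have "base (w - of_int j) + of_int j = G (w - of_int j) + of_int j"
    using w by (simp add: base_def min_def max_def)
  also have "\<dots> = G w"
    using G_add_int[of "w - of_int j" j] by simp
  finally have base: "base (w - of_int j) + of_int j = G w" .
  have "w \<le> X (c (j + 1))"
    using w xm_less_1 X_bounds(1)[of "c (j + 1)"] by (simp add: J_c)
  then have hi: "G w \<le> lo (j + 1)"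
    using G_mono_lifted_set[OF assms X_in_lifted_set] by (simp add: lo_def G_X)
  have "X (c j) \<le> w"
  proof (rule ccontr)
    assume "\<not> X (c j) \<le> w"
    then have "w \<in> {of_int j - 1 + xm<..<X (c j)}"
      using w xm_less_1 by simp
    then obtain t where "X t \<in> {of_int j - 1 + xm<..<X (c j)}"
      by (rule lifted_set_meets[OF assms open_greaterThanLessThan])
    then have t: "of_int j - 1 + xm < X t" "t < c j"
      by simp_all
    then have "\<not> j \<le> J t"
      unfolding le_J_iff by simp
    then have "real_of_int (J t) \<le> of_int j - 1"
      by linarith
    then show False
      using t(1) X_bounds(2)[of t] by simp
  qed
  then have "lo j \<le> G w"
    using G_mono_lifted_set[OF X_in_lifted_set assms] by (simp add: lo_def G_X)
  with hi base show ?thesis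
    unfolding G_mon_def j_def[symmetric] piece_def by simp
qed

text \<open>Division by \<open>k\<close> turns period \<open>k\<close> into period one, so the
  \<open>k\<close>-fold cover becomes the circle on which the model map lives.\<close>

definition H :: "real \<Rightarrow> real"
  where "H t = G_mon (real k * t) / real k"

definition h :: "circle \<Rightarrow> circle"
  where "h z = circle_proj (H (circle_rep z))"

lemma H_add_int: "H (t + of_int m) = H t + of_int m"
  using G_mon_add[of "real k * t" m] k_pos by (simp add: H_def distrib_left add_divide_distrib)

lemma h_proj: "h (circle_proj t) = circle_proj (H t)"
proof -
  obtain l where "circle_rep (circle_proj t) = t + of_int l"
    by (rule circle_rep_projE)
  then show ?thesis
    by (simp add: h_def H_add_int)
qed

lemma degree_one_lift_H: "degree_one_lift h H"
  unfolding degree_one_lift_def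
proof (intro conjI allI)
  show "continuous_on UNIV H"
    unfolding H_def using k_pos
    by (intro continuous_intros continuous_on_compose2[OF G_mon_cont]) auto
qed (use H_add_int[of _ 1] in \<open>auto simp: h_proj\<close>)

lemma mono_H: "mono H"
  unfolding H_def by (intro monoI divide_right_mono G_mon_mono mult_left_mono) auto

lemma H_pow: "(H ^^ n) t = (G_mon ^^ n) (real k * t) / real k"
  using k_pos by (induction n) (auto simp: H_def)

lemma G_mon_pow_mono: "x \<le> y \<Longrightarrow> (G_mon ^^ n) x \<le> (G_mon ^^ n) y"
  by (induction n) (auto intro: G_mon_mono)

lemma G_mon_pow_X: "(G_mon ^^ n) (X t) = X (t + real n * b)"
  by (induction n) (auto simp: G_mon_eq_G G_X algebra_simps)

text \<open>Monotonicity traps every orbit of \<open>G_mon\<close> between two coded orbits whose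
  phases differ by 2.\<close>

lemma H_rotation: "set_has_rotation_number H UNIV b"
  unfolding set_has_rotation_number_def has_rotation_number_def
proof (intro ballI exI conjI)
  fix z
  show "circle_proj (circle_rep z) = z"
    by simp
  define t where "t = circle_rep z"
  define s where "s = \<Theta> (real k * t)"
  have k: "0 < real k"
    using k_pos by simp
  have bounds: "(s - 1 - e - 1 / real k - t) + real n * b \<le> (H ^^ n) t - t"
    "(H ^^ n) t - t \<le> (s + 1 + e + 1 / real k - t) + real n * b" for n
  proof -
    have "X (s - 1) \<le> real k * t" "real k * t \<le> X (s + 1)"
      using Theta_greater[of "s - 1" "real k * t"] Theta_less[of "real k * t" "s + 1"] by (auto simp: s_def)
    then have "X (s - 1 + real n * b) \<le> (G_mon ^^ n) (real k * t)"
      "(G_mon ^^ n) (real k * t) \<le> X (s + 1 + real n * b)"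
      unfolding G_mon_pow_X[symmetric] by (auto intro: G_mon_pow_mono)
    then have "real k * (s - 1 + real n * b - e) - 1 \<le> real k * (H ^^ n) t"
      "real k * (H ^^ n) t \<le> real k * (s + 1 + real n * b + e) + 1"
      using X_affine_bounds(1)[of "s - 1 + real n * b"] X_affine_bounds(2)[of "s + 1 + real n * b"] k
      by (auto simp: H_pow)
    then have "real k * (s - 1 + real n * b - e - 1 / real k) \<le> real k * (H ^^ n) t"
      "real k * (H ^^ n) t \<le> real k * (s + 1 + real n * b + e + 1 / real k)"
      using k by (simp_all add: right_diff_distrib distrib_left)
    then show "(s - 1 - e - 1 / real k - t) + real n * b \<le> (H ^^ n) t - t"
      "(H ^^ n) t - t \<le> (s + 1 + e + 1 / real k - t) + real n * b"
      using k by (simp_all add: mult_le_cancel_left_pos)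
  qed
  show "(\<lambda>n. ((H ^^ n) (circle_rep z) - circle_rep z) / real n) \<longlonglongrightarrow> b"
    unfolding t_def[symmetric] by (rule LIMSEQ_affine_sandwich[OF bounds])
qed

text \<open>Multiplication by \<open>k\<close> maps the minimal set of the model onto
  \<open>denjoy_set\<close>. Hypothesis \<open>inj\<close> makes it injective there, and compactness
  turns it into a homeomorphism.\<close>

lemma semi_Denjoy_denjoy_set:
  assumes inj: "\<And>w w' l. w \<in> lifted_set \<Longrightarrow> w' \<in> lifted_set \<Longrightarrow> w' = w + of_int l \<Longrightarrow> int k dvd l"
  shows "semi_Denjoy_minimal_set g denjoy_set"
proof -
  define scaled where "scaled w = circle_proj (w / real k)" for w
  define M where "M = scaled ` lifted_set"
  define mulk where "mulk z = circle_proj (real k * circle_rep z)" for z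
  have k: "real k \<noteq> 0"
    using k_pos by simp
  have scaled_cont: "continuous_on UNIV scaled"
    unfolding scaled_def
    using k by (intro continuous_on_compose2[OF continuous_circle_proj] continuous_intros) auto
  have scaled_period: "scaled (w + real k * of_int m) = scaled w" for w m
    by (simp add: scaled_def proj_scaled_period)
  have mulk_proj: "mulk (circle_proj t) = circle_proj (real k * t)" for t
  proof -
    obtain l where "circle_rep (circle_proj t) = t + of_int l"
      by (rule circle_rep_projE)
    then show ?thesis
      by (simp add: mulk_def distrib_left proj_period)
  qed
  have mulk_scaled: "mulk (scaled w) = circle_proj w" for w
    using k by (simp add: scaled_def mulk_proj)
  have "continuous_on UNIV mulk"
    by (rule continuous_circle_lift)
      (auto simp: mulk_proj intro!: continuous_on_compose2[OF continuous_circle_proj] continuous_intros)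
  then have mulk_cont: "continuous_on M mulk"
    by (rule continuous_on_subset) simp
  have h_scaled: "h (scaled w) = scaled (G w)" if "w \<in> lifted_set" for w
    using k that by (simp add: scaled_def h_proj H_def G_mon_eq_G)
  have "minimal_set h M"
    unfolding M_def by (rule minimal_image_lifted_set[OF scaled_period scaled_cont h_scaled])
  have "compact M"
    unfolding M_def by (rule compact_image_lifted_set[OF scaled_period scaled_cont])
  have "mulk ` M = denjoy_set"
    by (simp add: M_def denjoy_set_def image_image mulk_scaled)
  have "inj_on mulk M"
  proof (rule inj_onI)
    fix m m' assume "m \<in> M" "m' \<in> M" "mulk m = mulk m'"
    then obtain w w' where w: "w \<in> lifted_set" "m = scaled w" "w' \<in> lifted_set" "m' = scaled w'"
      by (auto simp: M_def)
    with \<open>mulk m = mulk m'\<close> have "circle_proj w = circle_proj w'"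
      by (simp add: mulk_scaled)
    then obtain l where l: "w' = w + of_int l"
      by (rule circle_proj_eqE)
    obtain i where "l = int k * i"
      using inj[OF w(1,3) l] by (rule dvdE)
    then have "w' = w + real k * of_int i"
      using l by simp
    then show "m = m'"
      using w by (simp add: scaled_period)
  qed
  obtain \<phi> where "homeomorphism M denjoy_set mulk \<phi>"
    using homeomorphism_compact[OF \<open>compact M\<close> mulk_cont \<open>mulk ` M = denjoy_set\<close> \<open>inj_on mulk M\<close>] by blast
  then have hom: "homeomorphism denjoy_set M \<phi> mulk"
    by (rule homeomorphism_symD)
  have "\<phi> (g z) = h (\<phi> z)" if z: "z \<in> denjoy_set" for z
  proof -
    obtain w where w: "w \<in> lifted_set" "z = circle_proj w"
      using z by (auto simp: denjoy_set_def)
    have \<phi>: "\<phi> (circle_proj w) = scaled w" if "w \<in> lifted_set" for w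
      using homeomorphism_apply2[OF hom, of "scaled w"] that by (simp add: M_def mulk_scaled)
    have "\<phi> (g z) = scaled (G w)"
      using w \<phi>[OF G_lifted_set] by (simp flip: proj_G)
    then show ?thesis
      using w by (simp add: \<phi> h_scaled)
  qed
  then have "degree_one_lift h H \<and> mono H \<and> b \<notin> \<rat> \<and> set_has_rotation_number H UNIV b \<and>
      minimal_set h M \<and> homeomorphism denjoy_set M \<phi> mulk \<and> (\<forall>z\<in>denjoy_set. \<phi> (g z) = h (\<phi> z))"
    using degree_one_lift_H mono_H irrational H_rotation \<open>minimal_set h M\<close> hom by simp
  then show ?thesis
    unfolding semi_Denjoy_minimal_set_def using minimal_denjoy_set by blast
qed

end

section \<open>Recovering the parameters from a single orbit\<close>

text \<open>The floors along the orbits of \<open>y\<close> and \<open>y'\<close> differ by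
  \<open>l\<close>. Density brings the phase of some iterate of \<open>y\<close> just above
  \<open>s\<close>, where these floors compare the two index functions up to an arbitrarily small
  error.\<close>

lemma J_shift_le:
  assumes "irrational_coding g G xm c k b a1 a2 e" "irrational_coding g G xm c' k b a1 a2 e"
    and y: "y \<in> irrational_coding.lifted_set G xm c b" "y' \<in> irrational_coding.lifted_set G xm c' b"
    and shift: "y' = y + of_int l"
  shows "partition.J c s + l \<le>
    partition.J c' (s + (irrational_coding.\<Theta> G xm c' b y' - irrational_coding.\<Theta> G xm c b y))"
proof -
  interpret v: irrational_coding g G xm c k b a1 a2 e
    by fact
  interpret v': irrational_coding g G xm c' k b a1 a2 e
    by fact
  define \<delta> where "\<delta> = v'.\<Theta> y' - v.\<Theta> y"
  have "v.J s + l \<le> v'.J (s + \<delta> + \<epsilon>)" if "0 < \<epsilon>" for \<epsilon>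
  proof -
    define d where "d = \<epsilon> / 3"
    have d: "0 < d"
      using that by (simp add: d_def)
    obtain n m where nm: "s + d < v.\<Theta> y + real n * b + of_int m" "v.\<Theta> y + real n * b + of_int m < s + d + d"
      using irrational_orbit_dense[OF v.irrational d] by blast
    have pow: "(G ^^ n) y' = (G ^^ n) y + of_int l"
      unfolding shift by (rule v.G_pow_add_int)
    have "v.J s \<le> v.J (v.\<Theta> ((G ^^ n) y) - d + of_int m)"
      using nm by (intro v.J_mono) (simp add: v.Theta_G_pow[OF y(1)])
    also have "\<dots> \<le> \<lfloor>(G ^^ n) y\<rfloor> + int k * m"
      using v.floor_bounds(1)[OF d, of "(G ^^ n) y"] by (simp add: v.J_add_int)
    finally have "v.J s + l \<le> \<lfloor>(G ^^ n) y'\<rfloor> + int k * m"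
      by (simp add: pow)
    also have "\<dots> \<le> v'.J (v'.\<Theta> ((G ^^ n) y') + d + of_int m)"
      using v'.floor_bounds(2)[OF d, of "(G ^^ n) y'"] by (simp add: v'.J_add_int)
    also have "\<dots> \<le> v'.J (s + \<delta> + \<epsilon>)"
      using nm by (intro v'.J_mono) (simp add: v'.Theta_G_pow[OF y(2)] \<delta>_def d_def)
    finally show ?thesis .
  qed
  \<comment> \<open>Stated for the cut, the bound is a weak inequality and survives the limit in
    \<open>\<epsilon>\<close>.\<close>
  then have "c' (v.J s + l) \<le> s + \<delta>"
    unfolding v'.le_J_iff by (rule field_le_epsilon)
  then show ?thesis
    unfolding v'.le_J_iff \<delta>_def .
qed

locale denjoy_coding = irrational_coding g G xm "cuts k v" k b a1 a2 e
  for g :: "circle \<Rightarrow> circle" and G :: "real \<Rightarrow> real" and xm :: real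
    and v :: "nat \<Rightarrow> real" and k :: nat and b a1 a2 e :: real +
  fixes \<eta> :: real
  assumes gaps: "v \<in> gaps k \<eta>" and eta_pos: "\<eta> > 0" and eta_small: "3 * real k * \<eta> < 1"

text \<open>Two applications of \<open>J_shift_le\<close> give equality of the shifted codings. With
  \<open>v' = v\<close>, the first conclusion is injectivity of the projection from the
  \<open>k\<close>-fold cover; the second recovers the parameters.\<close>

lemma lifted_sets_unique:
  assumes "denjoy_coding g G xm v k b a1 a2 e \<eta>" "denjoy_coding g G xm v' k b a1 a2 e \<eta>"
    and y: "y \<in> irrational_coding.lifted_set G xm (cuts k v) b"
      "y' \<in> irrational_coding.lifted_set G xm (cuts k v') b"
    and shift: "y' = y + of_int l"
  shows "int k dvd l" and "\<And>i. i < k - 1 \<Longrightarrow> v i = v' i"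
proof -
  interpret v: denjoy_coding g G xm v k b a1 a2 e \<eta>
    by fact
  interpret v': denjoy_coding g G xm v' k b a1 a2 e \<eta>
    by fact
  define \<delta> where "\<delta> = v'.\<Theta> y' - v.\<Theta> y"
  have "v'.J (s + \<delta>) = v.J s + l" for s
  proof (rule antisym)
    show "v.J s + l \<le> v'.J (s + \<delta>)"
      unfolding \<delta>_def by (rule J_shift_le[OF v.irrational_coding_axioms v'.irrational_coding_axioms y shift])
    have "v'.J (s + \<delta>) + (- l) \<le> v.J (s + \<delta> + (v.\<Theta> y - v'.\<Theta> y'))"
      by (rule J_shift_le[OF v'.irrational_coding_axioms v.irrational_coding_axioms y(2,1)]) (simp add: shift)
    then show "v'.J (s + \<delta>) \<le> v.J s + l"
      by (simp add: \<delta>_def)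
  qed
  from coding_shift_unique[OF v.k_pos v.gaps v'.gaps v.eta_pos v.eta_small this]
  show "int k dvd l" "\<And>i. i < k - 1 \<Longrightarrow> v i = v' i"
    by blast+
qed

lemma (in denjoy_coding) lifted_set_inj:
  "w \<in> lifted_set \<Longrightarrow> w' \<in> lifted_set \<Longrightarrow> w' = w + of_int l \<Longrightarrow> int k dvd l"
  by (rule lifted_sets_unique(1)[OF denjoy_coding_axioms denjoy_coding_axioms])

lemma (in denjoy_coding) denjoy_set_in_kfsm: "denjoy_set \<in> kfsm_semi_Denjoy g G xm k"
  using semi_Denjoy_denjoy_set[OF lifted_set_inj] kfsm_denjoy_set by (simp add: kfsm_semi_Denjoy_def)

section \<open>The invariant measure\<close>

text \<open>Lebesgue measure of the circle, carried by \<open>[0, 1)\<close> on the line so that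
  distribution functions can identify it.\<close>

definition unif :: "real measure"
  where "unif = uniform_measure lborel {0..<1}"

lemma sets_unif [simp, measurable_cong]: "sets unif = sets borel"
  by (simp add: unif_def)

lemma space_unif [simp]: "space unif = UNIV"
  by (simp add: unif_def)

interpretation unif: real_distribution unif
proof -
  interpret prob_space unif
    unfolding unif_def by (rule prob_space_uniform_measure) auto
  show "real_distribution unif"
    by unfold_locales auto
qed

lemma measure_unif: "A \<in> sets borel \<Longrightarrow> measure unif A = measure lborel ({0..<1} \<inter> A)"
  unfolding unif_def by (subst measure_uniform_measure) auto

lemma AE_unif_countable: assumes "countable D" shows "AE t in unif. t \<notin> D"
proof -
  have "AE t in lborel. t \<notin> D"
    using countable_imp_null_set_lborel[OF assms] by (rule AE_not_in)
  then show ?thesis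
    unfolding unif_def by (intro AE_uniform_measureI) auto
qed

lemma cdf_unif: "0 \<le> x \<Longrightarrow> x < 1 \<Longrightarrow> cdf unif x = x"
proof -
  assume "0 \<le> x" "x < 1"
  then have "{0..<1} \<inter> {..x} = {0..x}"
    by auto
  with \<open>0 \<le> x\<close> show ?thesis
    by (simp add: cdf_def measure_unif)
qed

lemma measure_outside_unit:
  assumes "prob_space m" "sets m = sets borel" "measure m {0..<1::real} = 1"
  shows "x < 0 \<Longrightarrow> measure m {..x} = 0" "1 \<le> x \<Longrightarrow> measure m {..x} = 1" "measure m {..<0} = 0"
    "measure m {..<1} = 1"
proof -
  interpret prob_space m
    by fact
  have space: "space m = UNIV"
    using sets_eq_imp_space_eq[OF assms(2)] by simp
  have le: "measure m A \<le> measure m (UNIV - {0..<1})" if "A \<subseteq> UNIV - {0..<1}" for A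
    using that assms(2) by (intro finite_measure_mono) auto
  have "measure m (UNIV - {0..<1}) = 0"
    using prob_compl[of "{0..<1}"] assms by (simp add: space)
  with le have null: "measure m A = 0" if "A \<subseteq> UNIV - {0..<1}" for A
    using that measure_nonneg[of m A] by (metis order.antisym)
  show "x < 0 \<Longrightarrow> measure m {..x} = 0" "measure m {..<0} = 0"
    by (intro null; auto)+
  have ge: "measure m A = 1" if "{0..<1} \<subseteq> A" "A \<in> sets borel" for A
    using finite_measure_mono[OF that(1)] that(2) assms(2,3) prob_le_1[of A] by simp
  show "1 \<le> x \<Longrightarrow> measure m {..x} = 1" "measure m {..<1} = 1"
    by (intro ge; auto)+
qed

lemma unif_eqI:
  assumes "prob_space m" "sets m = sets borel" "measure m {0..<1} = 1"
    and "\<And>x. 0 \<le> x \<Longrightarrow> x < 1 \<Longrightarrow> measure m {..x} = x"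
  shows "m = unif"
proof (rule cdf_unique)
  interpret prob_space m
    by fact
  have space: "space m = UNIV"
    using sets_eq_imp_space_eq[OF assms(2)] by simp
  show "real_distribution m"
    by unfold_locales (auto simp: assms(2) space)
  show "real_distribution unif" ..
  have unif: "measure unif {0..<1} = 1"
    by (simp add: measure_unif)
  show "cdf m = cdf unif"
  proof
    fix x :: real
    consider "x < 0" | "0 \<le> x" "x < 1" | "1 \<le> x"
      by linarith
    then show "cdf m x = cdf unif x"
    proof cases
      case 2
      then show ?thesis
        using cdf_unif assms(4) by (simp add: cdf_def)
    qed (use measure_outside_unit[OF assms(1-3)]
        measure_outside_unit[OF unif.prob_space_axioms sets_unif unif] in \<open>simp_all add: cdf_def\<close>)
  qed
qed

lemma frac_add_cases:
  fixes b t :: real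
  assumes "0 \<le> t" "t < 1" "0 < b" "b < 1"
  shows "frac (t + b) = (if t + b < 1 then t + b else t + b - 1)"
proof -
  have "\<lfloor>t + b\<rfloor> = (if t + b < 1 then 0 else 1)"
    using assms by (auto intro!: floor_unique)
  then show ?thesis
    by (simp add: frac_def)
qed

lemma measurable_rotation [measurable]: "(\<lambda>t::real. frac (t + b)) \<in> borel_measurable borel"
  unfolding frac_def by measurable

lemma distr_unif_rotation:
  assumes "0 < b" "b < 1"
  shows "distr unif borel (\<lambda>t. frac (t + b)) = unif"
proof (rule unif_eqI)
  show "prob_space (distr unif borel (\<lambda>t. frac (t + b)))"
    by (intro unif.prob_space_distr) simp
  have eq: "measure (distr unif borel (\<lambda>t. frac (t + b))) A = measure lborel ({0..<1} \<inter> {t. frac (t + b) \<in> A})"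
    if "A \<in> sets borel" for A
  proof -
    have "{t. frac (t + b) \<in> A} \<in> sets borel"
      using measurable_sets[OF measurable_rotation that, of b] by (simp add: vimage_def)
    then show ?thesis
      using that by (simp add: measure_distr measure_unif vimage_def)
  qed
  have "{0..<1} \<inter> {t. frac (t + b) \<in> {0..<1}} = {0..<1::real}"
    by (auto simp: frac_ge_0 frac_lt_1)
  then show "measure (distr unif borel (\<lambda>t. frac (t + b))) {0..<1} = 1"
    by (simp add: eq)
  fix x :: real assume x: "0 \<le> x" "x < 1"
  show "measure (distr unif borel (\<lambda>t. frac (t + b))) {..x} = x"
  proof (cases "x < b")
    case True
    have "{0..<1} \<inter> {t. frac (t + b) \<in> {..x}} = {1 - b..x + 1 - b}"
      using True x assms by (auto simp: frac_add_cases split: if_splits)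
    then show ?thesis
      using x by (simp add: eq)
  next
    case False
    have "{0..<1} \<inter> {t. frac (t + b) \<in> {..x}} = {0..x - b} \<union> {1 - b..<1}"
      using False x assms by (auto simp: frac_add_cases split: if_splits)
    moreover have "measure lborel ({0..x - b} \<union> {1 - b..<1}) = measure lborel {0..x - b} + measure lborel {1 - b..<1}"
      using False x assms by (intro measure_Union) auto
    ultimately show ?thesis
      using False x assms by (simp add: eq)
  qed
qed simp

text \<open>The distribution function of a rotation invariant measure commutes with the rotation, so it
  agrees with the identity on a dense orbit.\<close>

lemma rotation_invariant_unique:
  assumes m: "prob_space m" "sets m = sets borel" "measure m {0..<1} = 1"
    and inv: "distr m borel (\<lambda>t. frac (t + b)) = m"
    and b: "b \<notin> \<rat>" "0 < b" "b < 1"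
  shows "m = unif"
proof -
  interpret prob_space m
    by fact
  have space: "space m = UNIV"
    using sets_eq_imp_space_eq[OF m(2)] by simp
  have meas [simp]: "A \<in> sets borel \<Longrightarrow> A \<in> events" for A
    by (simp add: m)
  define P where "P t = prob {..<t}" for t
  \<comment> \<open>The distribution function continued to the line with
    \<open>F (t + 1) = F t + 1\<close>; invariance becomes
    \<open>F (t + b) = F t + F b\<close>.\<close>
  define F where "F t = of_int \<lfloor>t\<rfloor> + P (frac t)" for t :: real
  have P0: "P 0 = 0" and P1: "P 1 = 1"
    using measure_outside_unit[OF m] by (simp_all add: P_def)
  have P_mono: "P s \<le> P t" if "s \<le> t" for s t
    unfolding P_def using that by (intro finite_measure_mono) auto
  have P_diff: "prob {s..<t} = P t - P s" if "s \<le> t" for s t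
  proof -
    have "prob ({..<t} - {..<s}) = prob {..<t} - prob {..<s}"
      using that by (intro finite_measure_Diff) auto
    moreover have "{..<t} - {..<s} = {s..<t}"
      by auto
    ultimately show ?thesis
      by (simp add: P_def)
  qed
  have P_bounds: "0 \<le> P t" "P t \<le> 1" for t
    by (simp_all add: P_def)
  have F_mono: "F s \<le> F t" if "s \<le> t" for s t
  proof (cases "\<lfloor>s\<rfloor> = \<lfloor>t\<rfloor>")
    case True
    then have "frac s \<le> frac t"
      using that by (simp add: frac_def)
    then show ?thesis
      using P_mono True by (simp add: F_def)
  next
    case False
    then have "real_of_int \<lfloor>s\<rfloor> + 1 \<le> of_int \<lfloor>t\<rfloor>"
      using floor_mono[OF that] by linarith
    then show ?thesis
      using P_bounds(2)[of "frac s"] P_bounds(1)[of "frac t"] by (simp add: F_def)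
  qed
  have F_int: "F (t + of_int l) = F t + of_int l" for t l
    by (simp add: F_def frac_def)
  have F_unit: "F t = P t" if "0 \<le> t" "t < 1" for t
    using that by (simp add: F_def frac_eq floor_eq_iff[of t 0] frac_unique_iff)
  have rot: "prob {t. frac (t + b) \<in> A} = prob A" if "A \<in> sets borel" for A
  proof -
    have "measure (distr m borel (\<lambda>t. frac (t + b))) A = prob {t. frac (t + b) \<in> A}"
      using that m(2) measurable_rotation[of b]
      by (subst measure_distr) (auto simp: vimage_def space measurable_cong_sets[OF m(2) refl])
    then show ?thesis
      by (simp add: inv)
  qed
  have restrict: "prob A = prob (A \<inter> {0..<1})" if "A \<in> sets borel" for A
  proof -
    have "prob A = prob (A \<inter> {0..<1}) + prob (A - {0..<1})"
      using finite_measure_Union[of "A \<inter> {0..<1}" "A - {0..<1}"] that by (simp add: Int_Diff_Un Int_Diff_disjoint)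
    moreover have "prob (A - {0..<1}) \<le> prob (UNIV - {0..<1})"
      using that by (intro finite_measure_mono) auto
    moreover have "prob (UNIV - {0..<1}) = 0"
      using prob_compl[of "{0..<1}"] m by (simp add: space)
    ultimately show ?thesis
      using measure_nonneg[of m "A - {0..<1}"] by linarith
  qed
  have frac_cases: "frac (x + b) = (if x + b < 1 then x + b else x + b - 1)" if "0 \<le> x" "x < 1" for x
    using that b(2,3) by (rule frac_add_cases)
  have F_b0: "F (t + b) = F t + F b" if t: "0 \<le> t" "t < 1" for t
  proof (cases "t + b < 1")
    case True
    have "P t = prob ({..<t} \<inter> {0..<1})"
      unfolding P_def by (rule restrict) simp
    also have "{..<t} \<inter> {0..<1} = {t'. frac (t' + b) \<in> {b..<t + b}} \<inter> {0..<1}"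
      using True t b(2,3) by (auto simp: frac_cases split: if_splits)
    also have "prob \<dots> = prob {t'. frac (t' + b) \<in> {b..<t + b}}"
      using measurable_sets[OF measurable_rotation[of b], of "{b..<t + b}"]
      by (intro restrict[symmetric]) (simp add: vimage_def)
    also have "\<dots> = P (t + b) - P b"
      using t by (subst rot) (auto simp: P_diff)
    finally show ?thesis
      using True t b by (simp add: F_unit)
  next
    case False
    have "P t = prob ({..<t} \<inter> {0..<1})"
      unfolding P_def by (rule restrict) simp
    also have "{..<t} \<inter> {0..<1} = {t'. frac (t' + b) \<in> {b..<1} \<union> {0..<t + b - 1}} \<inter> {0..<1}"
      using False t b(2,3) by (auto simp: frac_cases split: if_splits)
    also have "prob \<dots> = prob {t'. frac (t' + b) \<in> {b..<1} \<union> {0..<t + b - 1}}"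
      using measurable_sets[OF measurable_rotation[of b], of "{b..<1} \<union> {0..<t + b - 1}"]
      by (intro restrict[symmetric]) (simp add: vimage_def)
    also have "\<dots> = prob ({b..<1} \<union> {0..<t + b - 1})"
      by (rule rot) simp
    also have "\<dots> = prob {b..<1} + prob {0..<t + b - 1}"
      using t b by (intro finite_measure_Union) auto
    also have "\<dots> = 1 - P b + P (t + b - 1)"
      using False b by (simp add: P_diff P0 P1)
    finally have "P t = 1 - P b + P (t + b - 1)" .
    moreover have "F (t + b) = F (t + b - 1) + 1"
      using F_int[of "t + b - 1" 1] by simp
    ultimately show ?thesis
      using False t b by (simp add: F_unit)
  qed
  have F_b: "F (t + b) = F t + F b" for t
  proof -
    have "F (frac t + b) = F (frac t) + F b"
      by (rule F_b0) (auto simp: frac_ge_0 frac_lt_1)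
    moreover have "t = frac t + of_int \<lfloor>t\<rfloor>"
      by (simp add: frac_def)
    ultimately show ?thesis
      using F_int[of "frac t + b" "\<lfloor>t\<rfloor>"] F_int[of "frac t" "\<lfloor>t\<rfloor>"] by (simp add: algebra_simps)
  qed
  have F0: "F 0 = 0"
    by (simp add: F_unit P0)
  have F_nb: "F (real n * b) = real n * F b" for n
  proof (induction n)
    case (Suc n)
    have "real (Suc n) * b = real n * b + b"
      by (simp add: algebra_simps)
    then have "F (real (Suc n) * b) = F (real n * b) + F b"
      by (simp only: F_b)
    with Suc show ?case
      by (simp add: algebra_simps)
  qed (simp add: F0)
  have F_near: "\<bar>F t - t\<bar> \<le> 1" for t
    using P_bounds[of "frac t"] unfolding F_def by linarith
  \<comment> \<open>\<open>F (n b) = n F b\<close> stays within distance 1 of \<open>n b\<close> for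
    every \<open>n\<close>.\<close>
  have Fb: "F b = b"
  proof (rule ccontr)
    assume "F b \<noteq> b"
    then have "0 < \<bar>F b - b\<bar>"
      by simp
    then obtain n :: nat where "1 < real n * \<bar>F b - b\<bar>"
      using reals_Archimedean3 by blast
    also have "\<dots> = \<bar>F (real n * b) - real n * b\<bar>"
      by (simp add: F_nb abs_mult flip: right_diff_distrib)
    finally show False
      using F_near[of "real n * b"] by simp
  qed
  have F_orbit: "F (0 + real n * b + of_int l) = 0 + real n * b + of_int l" for n l
    using F_int[of "real n * b" l] by (simp add: F_nb Fb)
  have F_id: "F t = t" for t
  proof (rule antisym)
    show "F t \<le> t"
    proof (rule field_le_epsilon)
      fix \<epsilon> :: real assume "0 < \<epsilon>"
      then obtain n l where nl: "t < 0 + real n * b + of_int l" "0 + real n * b + of_int l < t + \<epsilon>"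
        using irrational_orbit_dense[OF b(1)] by blast
      then show "F t \<le> t + \<epsilon>"
        using F_mono[OF less_imp_le[OF nl(1)]] unfolding F_orbit by simp
    qed
    show "t \<le> F t"
    proof (rule field_le_epsilon)
      fix \<epsilon> :: real assume "0 < \<epsilon>"
      then obtain n l where nl: "t - \<epsilon> < 0 + real n * b + of_int l" "0 + real n * b + of_int l < t - \<epsilon> + \<epsilon>"
        using irrational_orbit_dense[OF b(1)] by blast
      then have "F (0 + real n * b + of_int l) \<le> F t"
        by (intro F_mono) simp
      with nl show "t \<le> F t + \<epsilon>"
        unfolding F_orbit by simp
    qed
  qed
  show ?thesis
  proof (rule unif_eqI[OF m])
    fix x :: real assume x: "0 \<le> x" "x < 1"
    have P_eq: "P t = t" if "0 \<le> t" "t < 1" for t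
      using F_id[of t] F_unit[OF that] by simp
    show "prob {..x} = x"
    proof (rule antisym)
      have "x = P x"
        using P_eq x by simp
      also have "\<dots> \<le> prob {..x}"
        unfolding P_def by (intro finite_measure_mono) auto
      finally show "x \<le> prob {..x}" .
      show "prob {..x} \<le> x"
      proof (rule dense_ge_bounded[OF x(2)])
        fix y assume y: "x < y" "y < 1"
        then have "prob {..x} \<le> P y"
          unfolding P_def by (intro finite_measure_mono) auto
        with y x show "prob {..x} \<le> y"
          by (simp add: P_eq)
      qed
    qed
  qed
qed

section \<open>Unique ergodicity of the coded minimal set\<close>

context denjoy_coding
begin

lemma b_bounds: "0 < b" "b < 1"
proof -
  have k: "1 \<le> real k"
    using k_pos by simp
  have ke: "0 \<le> 2 * real k * e"
    using e_nonneg k by simp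
  have "0 \<le> real k * b" "real k * b \<le> 1"
    using slope a1_nonneg a2_le_1 ke by linarith+
  moreover have "b \<noteq> 0" "b \<noteq> 1"
    using irrational by auto
  ultimately have "0 \<le> b"
    using k by (simp add: zero_le_mult_iff)
  moreover from k this have "1 * b \<le> real k * b"
    by (rule mult_right_mono)
  ultimately have "0 < b" "b \<le> 1"
    using \<open>real k * b \<le> 1\<close> \<open>b \<noteq> 0\<close> by linarith+
  with \<open>b \<noteq> 1\<close> show "0 < b" "b < 1"
    by simp_all
qed

definition param :: "real \<Rightarrow> circle"
  where "param t = circle_proj (X t)"

definition \<mu> :: "circle measure"
  where "\<mu> = distr unif borel param"

lemma param_measurable [measurable]: "param \<in> borel_measurable borel"
proof -
  have [measurable]: "X \<in> borel_measurable borel"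
    by (intro borel_measurable_mono monoI X_mono)
  have [measurable]: "circle_proj \<in> borel_measurable borel"
    by (intro borel_measurable_continuous_onI continuous_circle_proj)
  show ?thesis
    unfolding param_def by measurable
qed

lemma g_measurable [measurable]: "g \<in> borel_measurable borel"
proof (intro borel_measurable_continuous_onI continuous_circle_lift)
  show "continuous_on UNIV (\<lambda>x. g (circle_proj x))"
    unfolding proj_G[symmetric]
    by (intro continuous_on_compose2[OF continuous_circle_proj G_cont]) auto
qed

lemma param_add_int: "param (t + of_int m) = param t"
  by (simp add: param_def X_add_int proj_period)

lemma param_frac: "param (frac t) = param t"
  using param_add_int[of "frac t" "\<lfloor>t\<rfloor>"] by (simp add: frac_def)

lemma g_param: "g (param t) = param (frac (t + b))"
  by (simp add: param_frac) (simp add: param_def G_X flip: proj_G)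

lemma param_in_denjoy_set: "param t \<in> denjoy_set"
  by (simp add: param_def denjoy_set_def)

lemma denjoy_set_borel [measurable]: "denjoy_set \<in> sets borel"
  by (intro borel_closed compact_imp_closed compact_denjoy_set)

lemma mu_prob_measure: "\<mu> \<in> prob_measures"
proof -
  have "prob_space (distr unif borel param)"
    by (intro unif.prob_space_distr) measurable
  then show ?thesis
    by (simp add: prob_measures_def \<mu>_def)
qed

lemma mu_denjoy_set: "measure \<mu> denjoy_set = 1"
proof -
  have "param -` denjoy_set \<inter> space unif = space unif"
    using param_in_denjoy_set by auto
  then show ?thesis
    unfolding \<mu>_def by (subst measure_distr) (auto simp: unif.prob_space simp del: space_unif)
qed

lemma mu_invariant: "distr \<mu> borel g = \<mu>"
proof -
  have "distr \<mu> borel g = distr unif borel (g \<circ> param)"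
    unfolding \<mu>_def by (rule distr_distr) measurable
  also have "g \<circ> param = param \<circ> (\<lambda>t. frac (t + b))"
    by (auto simp: g_param)
  also have "distr unif borel (param \<circ> (\<lambda>t. frac (t + b))) = distr (distr unif borel (\<lambda>t. frac (t + b))) borel param"
    by (rule distr_distr[symmetric]) measurable
  also have "\<dots> = \<mu>"
    by (simp add: distr_unif_rotation[OF b_bounds] \<mu>_def)
  finally show ?thesis .
qed

text \<open>Phase modulo one. It does not depend on the chosen lift, since two lifts in
  \<open>lifted_set\<close> differ by a multiple of \<open>k\<close>; 0 is a default value off the
  set.\<close>

definition angle :: "circle \<Rightarrow> real"
  where "angle z = (if z \<in> denjoy_set then frac (\<Theta> (SOME w. w \<in> lifted_set \<and> circle_proj w = z)) else 0)"

lemma angle_proj: assumes "w \<in> lifted_set" shows "angle (circle_proj w) = frac (\<Theta> w)"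
proof -
  define w' where "w' = (SOME w'. w' \<in> lifted_set \<and> circle_proj w' = circle_proj w)"
  have "w' \<in> lifted_set \<and> circle_proj w' = circle_proj w"
    unfolding w'_def by (rule someI[of _ w]) (simp add: assms)
  then have w': "w' \<in> lifted_set" "circle_proj w = circle_proj w'"
    by simp_all
  obtain l where l: "w' = w + of_int l"
    using w'(2) by (rule circle_proj_eqE)
  obtain i where "l = int k * i"
    using lifted_set_inj[OF assms w'(1) l] by (rule dvdE)
  then have "w' = w + real k * of_int i"
    using l by simp
  then have "\<Theta> w' = \<Theta> w + of_int i"
    by (simp add: Theta_add)
  then have "frac (\<Theta> w') = frac (\<Theta> w)"
    by (simp add: frac_def)
  moreover have "circle_proj w \<in> denjoy_set"
    using assms by (simp add: denjoy_set_def)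
  ultimately show ?thesis
    by (simp add: angle_def w'_def)
qed

lemma angle_bounds: "0 \<le> angle z" "angle z < 1"
  by (simp_all add: angle_def frac_ge_0 frac_lt_1)

lemma angle_level:
  assumes "0 \<le> a" "a < 1"
  shows "{z \<in> denjoy_set. angle z \<le> a} = circle_proj ` {w \<in> lifted_set. 0 \<le> \<Theta> w \<and> \<Theta> w \<le> a}"
proof (intro equalityI subsetI)
  fix z assume z: "z \<in> {z \<in> denjoy_set. angle z \<le> a}"
  then obtain w where w: "w \<in> lifted_set" "z = circle_proj w"
    by (auto simp: denjoy_set_def)
  define w' where "w' = w + real k * of_int (- \<lfloor>\<Theta> w\<rfloor>)"
  have "w' \<in> lifted_set"
    unfolding w'_def by (rule lifted_set_add[OF w(1)])
  moreover have "\<Theta> w' = frac (\<Theta> w)"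
    unfolding w'_def Theta_add by (simp add: frac_def)
  moreover have "z = circle_proj w'"
    unfolding w'_def proj_period by (rule w)
  moreover have "frac (\<Theta> w) \<le> a"
    using z w by (simp add: angle_proj)
  ultimately show "z \<in> circle_proj ` {w \<in> lifted_set. 0 \<le> \<Theta> w \<and> \<Theta> w \<le> a}"
    by (simp add: frac_ge_0)
next
  fix z assume "z \<in> circle_proj ` {w \<in> lifted_set. 0 \<le> \<Theta> w \<and> \<Theta> w \<le> a}"
  then obtain w where w: "w \<in> lifted_set" "0 \<le> \<Theta> w" "\<Theta> w \<le> a" "z = circle_proj w"
    by blast
  then have "frac (\<Theta> w) = \<Theta> w"
    using assms by (simp add: frac_eq)
  with w show "z \<in> {z \<in> denjoy_set. angle z \<le> a}"
    by (simp add: angle_proj denjoy_set_def)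
qed

text \<open>Each bound on the phase is an intersection of closed half-lines bounded by values of
  \<open>X\<close> at strictly larger or smaller phases.\<close>

lemma compact_Theta_level: "compact {w \<in> lifted_set. 0 \<le> \<Theta> w \<and> \<Theta> w \<le> a}"
proof -
  have 1: "\<Theta> w \<le> a \<longleftrightarrow> (\<forall>s>a. w \<le> X s)" for w
  proof
    show "\<forall>s>a. w \<le> X s" if "\<Theta> w \<le> a"
      using that by (auto intro!: less_imp_le Theta_less)
    show "\<Theta> w \<le> a" if *: "\<forall>s>a. w \<le> X s"
    proof (rule dense_ge)
      fix s assume "a < s"
      then have "\<Theta> w \<le> \<Theta> (X s)"
        using * by (intro Theta_mono) simp
      then show "\<Theta> w \<le> s"
        by simp
    qed
  qed
  have 2: "0 \<le> \<Theta> w \<longleftrightarrow> (\<forall>s<0. X s \<le> w)" for w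
  proof
    show "\<forall>s<0. X s \<le> w" if "0 \<le> \<Theta> w"
      using that by (auto intro!: Theta_greater)
    show "0 \<le> \<Theta> w" if *: "\<forall>s<0. X s \<le> w"
      by (rule dense_le) (use * in \<open>auto intro: le_Theta\<close>)
  qed
  have eq: "{w \<in> lifted_set. 0 \<le> \<Theta> w \<and> \<Theta> w \<le> a} =
      {X (- 1)..X (a + 1)} \<inter> (lifted_set \<inter> (\<Inter>s\<in>{..<0}. {X s..}) \<inter> (\<Inter>s\<in>{a<..}. {..X s}))"
    by (auto simp: 1 2)
  show ?thesis
    unfolding eq
    by (intro compact_Int_closed compact_Icc closed_Int closed_lifted_set closed_INT) auto
qed

lemma angle_measurable [measurable]: "angle \<in> borel_measurable borel"
proof (rule borel_measurableI_le)
  fix a :: real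
  consider "a < 0" | "0 \<le> a" "a < 1" | "1 \<le> a"
    by linarith
  then show "{z \<in> space borel. angle z \<le> a} \<in> sets borel"
  proof cases
    case 1
    then have "{z \<in> space borel. angle z \<le> a} = {}"
      using angle_bounds(1) by (auto simp: not_le intro: less_le_trans)
    then show ?thesis
      by (simp only: sets.empty_sets)
  next
    case 2
    have "{z \<in> space borel. angle z \<le> a} = (- denjoy_set) \<union> {z \<in> denjoy_set. angle z \<le> a}"
      using 2 by (auto simp: angle_def)
    moreover have "compact {z \<in> denjoy_set. angle z \<le> a}"
      unfolding angle_level[OF 2]
      by (intro compact_continuous_image compact_Theta_level continuous_on_subset[OF continuous_circle_proj]) simp
    then have "{z \<in> denjoy_set. angle z \<le> a} \<in> sets borel"
      by (intro borel_closed compact_imp_closed)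
    ultimately show ?thesis
      using borel_comp[OF denjoy_set_borel] by simp
  next
    case 3
    then have "{z \<in> space borel. angle z \<le> a} = space borel"
      using angle_bounds(2) by (auto intro: less_imp_le less_le_trans)
    then show ?thesis
      by (simp only: sets.top)
  qed
qed

lemma angle_g: assumes "z \<in> denjoy_set" shows "angle (g z) = frac (angle z + b)"
proof -
  obtain w where w: "w \<in> lifted_set" "z = circle_proj w"
    using assms by (auto simp: denjoy_set_def)
  have "angle (g z) = frac (\<Theta> w + b)"
    using w angle_proj[OF G_lifted_set[OF w(1)]] by (simp add: Theta_G flip: proj_G)
  also have "\<dots> = frac (angle z + b)"
  proof -
    have "\<Theta> w + b = (frac (\<Theta> w) + b) + of_int \<lfloor>\<Theta> w\<rfloor>"
      by (simp add: frac_def)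
    moreover have "frac (y + of_int l) = frac y" for y :: real and l
      by (simp add: frac_def)
    ultimately have "frac (\<Theta> w + b) = frac (frac (\<Theta> w) + b)"
      by metis
    then show ?thesis
      using w by (simp add: angle_proj)
  qed
  finally show ?thesis .
qed

text \<open>Right continuity gives \<open>w \<le> X t\<close>; the converse needs left continuity,
  which can fail only at the countably many jumps of a monotone function.\<close>

lemma param_angle:
  assumes "z \<in> denjoy_set" "angle z \<notin> frac ` {t. \<not> isCont X t}"
  shows "param (angle z) = z"
proof -
  obtain w where w: "w \<in> lifted_set" "z = circle_proj w"
    using assms by (auto simp: denjoy_set_def)
  define t where "t = \<Theta> w"
  have angle: "angle z = frac t"
    using w by (simp add: angle_proj t_def)
  then have "isCont X t"
    using assms(2) by auto
  have "w \<le> X t"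
  proof (rule field_le_epsilon)
    fix \<epsilon> :: real assume "0 < \<epsilon>"
    then obtain d where d: "0 < d" "\<And>s. t \<le> s \<Longrightarrow> s < t + d \<Longrightarrow> \<bar>X s - X t\<bar> < \<epsilon>"
      using X_right_cont by blast
    have "w < X (t + d / 2)"
      using d(1) by (intro Theta_less) (simp add: t_def)
    with d(1) d(2)[of "t + d / 2"] show "w \<le> X t + \<epsilon>"
      by simp
  qed
  moreover have "X t \<le> w"
  proof (rule tendsto_upperbound)
    show "(X \<longlongrightarrow> X t) (at_left t)"
      using \<open>isCont X t\<close> by (simp add: continuous_within filterlim_at_split isCont_def)
    show "\<forall>\<^sub>F s in at_left t. X s \<le> w"
      unfolding eventually_at_filter by (intro always_eventually) (auto simp: t_def intro: Theta_greater)
  qed simp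
  ultimately have "w = X t"
    by simp
  then show ?thesis
    unfolding angle param_frac by (simp add: param_def w)
qed

text \<open>The phase carries \<open>M\<close> to a rotation invariant measure, hence to
  \<open>unif\<close>, which does not charge the phases of jumps. So \<open>param\<close> inverts
  \<open>angle\<close> almost everywhere and \<open>M\<close> is recovered from
  \<open>unif\<close>.\<close>

lemma mu_unique:
  assumes M: "M \<in> prob_measures" "measure M denjoy_set = 1" "distr M borel g = M"
  shows "M = \<mu>"
proof -
  interpret M: prob_space M
    using M by (simp add: prob_measures_def)
  have sets [simp, measurable_cong]: "sets M = sets borel"
    using M by (simp add: prob_measures_def)
  have space [simp]: "space M = UNIV"
    using sets_eq_imp_space_eq[OF sets] by simp
  have AE: "AE z in M. z \<in> denjoy_set"
    using M.AE_prob_1[OF M(2)] .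
  define m where "m = distr M borel angle"
  have "m = unif"
  proof (rule rotation_invariant_unique[OF _ _ _ _ irrational b_bounds])
    show "prob_space m"
      unfolding m_def by (intro M.prob_space_distr) measurable
    show "sets m = sets borel"
      by (simp add: m_def)
    have "angle -` {0..<1} \<inter> space M = space M"
      using angle_bounds by auto
    then show "measure m {0..<1} = 1"
      unfolding m_def by (subst measure_distr) (auto simp: M.prob_space simp del: space)
    have "distr m borel (\<lambda>t. frac (t + b)) = distr M borel ((\<lambda>t. frac (t + b)) \<circ> angle)"
      unfolding m_def by (rule distr_distr) measurable
    also have "\<dots> = distr M borel (angle \<circ> g)"
    proof (rule distr_cong_AE)
      show "AE z in M. ((\<lambda>t. frac (t + b)) \<circ> angle) z = (angle \<circ> g) z"
        using AE by eventually_elim (simp add: angle_g)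
    qed measurable
    also have "\<dots> = distr (distr M borel g) borel angle"
      by (rule distr_distr[symmetric]) measurable
    also have "\<dots> = m"
      by (simp add: M(3) m_def)
    finally show "distr m borel (\<lambda>t. frac (t + b)) = m" .
  qed
  have "countable (frac ` {t. \<not> isCont X t})"
    by (intro countable_image mono_ctble_discont monoI X_mono)
  then have "AE t in m. t \<notin> frac ` {t. \<not> isCont X t}"
    unfolding \<open>m = unif\<close> by (rule AE_unif_countable)
  then have "AE z in M. angle z \<notin> frac ` {t. \<not> isCont X t}"
    unfolding m_def by (rule AE_distrD[rotated]) measurable
  with AE have "AE z in M. param (angle z) = z"
    by eventually_elim (rule param_angle)
  then have "distr M borel (param \<circ> angle) = distr M borel (\<lambda>z. z)"
    by (intro distr_cong_AE) auto
  also have "\<dots> = M"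
    by (rule distr_id2) simp
  also have "distr M borel (param \<circ> angle) = distr m borel param"
    unfolding m_def by (rule distr_distr[symmetric]) measurable
  finally show ?thesis
    by (simp add: \<open>m = unif\<close> \<mu>_def)
qed

lemma invariant_measure_denjoy_set: "invariant_measure g denjoy_set = \<mu>"
  unfolding invariant_measure_def
proof (rule the_equality)
  show "\<mu> \<in> prob_measures \<and> measure \<mu> denjoy_set = 1 \<and> distr \<mu> borel g = \<mu>"
    using mu_prob_measure mu_denjoy_set mu_invariant by simp
  show "M = \<mu>" if "M \<in> prob_measures \<and> measure M denjoy_set = 1 \<and> distr M borel g = M" for M
    using that by (intro mu_unique) auto
qed

lemma integral_mu:
  fixes u :: "circle \<Rightarrow> real"
  assumes "continuous_on UNIV u"
  shows "integral\<^sup>L \<mu> u = (LINT t|unif. u (param t))"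
  unfolding \<mu>_def using borel_measurable_continuous_onI[OF assms] by (intro integral_distr) measurable

end

section \<open>The disk of minimal sets\<close>

text \<open>The inverse of \<open>f\<close> is \<open>h\<close> followed by the inverse of the
  composition. This allows the disk to be tested in the product space of integrals.\<close>

lemma embedding_map_factor:
  assumes f: "continuous_map X Y f" and h: "continuous_map Y Z h" and emb: "embedding_map X Z (h \<circ> f)"
  shows "embedding_map X Y f"
proof -
  obtain r where r: "homeomorphic_maps X (subtopology Z ((h \<circ> f) ` topspace X)) (h \<circ> f) r"
    using emb by (auto simp: embedding_map_def homeomorphic_map_maps)
  have "homeomorphic_maps X (subtopology Y (f ` topspace X)) f (r \<circ> h)"
    unfolding homeomorphic_maps_def
  proof (intro conjI ballI)
    show "continuous_map X (subtopology Y (f ` topspace X)) f"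
      using f by (simp add: continuous_map_in_subtopology)
    have "continuous_map (subtopology Y (f ` topspace X)) (subtopology Z ((h \<circ> f) ` topspace X)) h"
      using h by (auto simp: continuous_map_in_subtopology continuous_map_from_subtopology)
    moreover have "continuous_map (subtopology Z ((h \<circ> f) ` topspace X)) X r"
      using r by (simp add: homeomorphic_maps_def)
    ultimately show "continuous_map (subtopology Y (f ` topspace X)) X (r \<circ> h)"
      by (rule continuous_map_compose)
    show "(r \<circ> h) (f x) = x" if "x \<in> topspace X" for x
      using r that by (simp add: homeomorphic_maps_def)
    fix y assume "y \<in> topspace (subtopology Y (f ` topspace X))"
    then obtain x where "x \<in> topspace X" "y = f x"
      by auto
    then show "f ((r \<circ> h) y) = y"
      using r by (simp add: homeomorphic_maps_def)
  qed
  then show ?thesis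
    by (auto simp: embedding_map_def homeomorphic_map_maps)
qed

lemma closed_disk_eq:
  "closed_disk d = top_of_set {x :: nat \<Rightarrow> real. (\<forall>i\<ge>d. x i = 0) \<and> (\<Sum>i<d. (x i)\<^sup>2) \<le> 1}"
  unfolding closed_disk_def Euclidean_space_def euclidean_product_topology subtopology_subtopology
  by (simp add: Collect_conj_eq)

lemma closed_disk_coord:
  assumes "x \<in> topspace (closed_disk d)"
  shows "x i \<in> {- 1..1}"
proof (cases "i < d")
  case True
  then have "(x i)\<^sup>2 \<le> (\<Sum>i<d. (x i)\<^sup>2)"
    by (intro member_le_sum) auto
  also have "\<dots> \<le> 1"
    using assms by (simp add: closed_disk_eq)
  finally show ?thesis
    by (simp add: abs_square_le_1 abs_le_iff)
qed (use assms in \<open>simp add: closed_disk_eq\<close>)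

text \<open>The disk is a closed subset of a product of compact intervals.\<close>

lemma compact_space_closed_disk: "compact_space (closed_disk d)"
proof -
  define S where "S = {x :: nat \<Rightarrow> real. (\<forall>i\<ge>d. x i = 0) \<and> (\<Sum>i<d. (x i)\<^sup>2) \<le> 1}"
  have "compactin (product_topology (\<lambda>_. euclidean) UNIV) (PiE UNIV (\<lambda>_::nat. {- 1..1::real}))"
    by (simp add: compactin_PiE)
  then have "compact (PiE UNIV (\<lambda>_::nat. {- 1..1::real}))"
    by (simp add: euclidean_product_topology)
  moreover have "closed S"
  proof -
    have "S = (\<Inter>i\<in>{d..}. {x. x i = 0}) \<inter> {x. (\<Sum>i<d. (x i)\<^sup>2) \<le> 1}"
      by (auto simp: S_def)
    also have "closed \<dots>"
      by (intro closed_Int closed_INT ballI closed_Collect_eq closed_Collect_le continuous_intros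
        continuous_on_product_coordinates)
    finally show ?thesis .
  qed
  moreover have "S \<subseteq> PiE UNIV (\<lambda>_. {- 1..1})"
    using closed_disk_coord[of _ d] by (auto simp: closed_disk_eq S_def)
  ultimately have "compact S"
    by (metis compact_Int_closed inf.absorb_iff2)
  then show ?thesis
    unfolding closed_disk_eq S_def by (simp add: compact_space_subtopology)
qed

lemma (in partition) J_eventually:
  assumes lim: "\<And>j. (\<lambda>n. cs n j) \<longlonglongrightarrow> c j" and part: "\<And>n. partition (cs n) k"
    and not_cut: "\<And>j. t \<noteq> c j"
  shows "\<forall>\<^sub>F n in sequentially. partition.J (cs n) t = J t"
proof -
  have "c (J t) < t" "t < c (J t + 1)"
    using J_bounds[of t] not_cut[of "J t"] by simp_all
  then have "\<forall>\<^sub>F n in sequentially. cs n (J t) < t" "\<forall>\<^sub>F n in sequentially. t < cs n (J t + 1)"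
    by (auto intro: order_tendstoD lim)
  then show ?thesis
    by eventually_elim (intro partition.J_eqI[OF part] less_imp_le)
qed

text \<open>If the rotation orbit of \<open>t\<close> avoids all cuts, any finite number of indices
  is stable under small changes of the cuts, and \<open>code_close\<close> controls the
  rest.\<close>

lemma (in coding) X_eventually:
  assumes lim: "\<And>j. (\<lambda>n. cs n j) \<longlonglongrightarrow> c j" and cod: "\<And>n. coding g G xm (cs n) k b a1 a2 e"
    and not_cut: "\<And>i j. t + real i * b \<noteq> c j"
  shows "(\<lambda>n. coding.X G xm (cs n) b t) \<longlonglongrightarrow> X t"
proof (rule tendstoI)
  fix \<epsilon> :: real assume "0 < \<epsilon>"
  then obtain N where N:
    "\<And>a b. unit_steps a \<Longrightarrow> unit_steps b \<Longrightarrow> (\<And>i. i \<le> N \<Longrightarrow> a i = b i) \<Longrightarrow> \<bar>code a - code b\<bar> < \<epsilon>"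
    using code_close by blast
  have part: "partition (cs n) k" for n
    using cod[of n] by (simp add: coding_def)
  have "\<forall>\<^sub>F n in sequentially. \<forall>i\<in>{..N}. partition.J (cs n) (t + real i * b) = J (t + real i * b)"
    by (intro eventually_ball_finite ballI J_eventually lim part not_cut) simp
  then show "\<forall>\<^sub>F n in sequentially. dist (coding.X G xm (cs n) b t) (X t) < \<epsilon>"
  proof eventually_elim
    case (elim n)
    interpret n: coding g G xm "cs n" k b a1 a2 e
      by (rule cod)
    have "\<bar>n.X t - X t\<bar> < \<epsilon>"
      unfolding n.X_def X_def using elim by (intro N unit_steps_J n.unit_steps_J) auto
    then show ?case
      by (simp add: dist_real_def)
  qed
qed

text \<open>The distance to a periodic set descends to the circle, giving a continuous function that
  vanishes exactly on a prescribed nonempty closed set.\<close>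

lemma continuous_infdist_lift:
  assumes "A = circle_proj -` Z"
  shows "continuous_on UNIV (\<lambda>z. infdist (circle_rep z) A)" "infdist (circle_rep (circle_proj x)) A = infdist x A"
proof -
  have A_add: "a + of_int l \<in> A" if "a \<in> A" for a l
    using that by (simp add: assms)
  have le: "infdist (x + of_int l) A \<le> infdist x A" for x l
  proof (cases "A = {}")
    case False
    then show ?thesis
      unfolding infdist_notempty[OF False, of x]
    proof (rule cINF_greatest)
      fix a assume "a \<in> A"
      then have "infdist (x + of_int l) A \<le> dist (x + of_int l) (a + of_int l)"
        by (intro infdist_le A_add)
      then show "infdist (x + of_int l) A \<le> dist x a"
        by simp
    qed
  qed (simp add: infdist_def)
  have period: "infdist (x + of_int l) A = infdist x A" for x l
    using le[of x l] le[of "x + of_int l" "- l"] by simp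
  have proj: "infdist (circle_rep (circle_proj x)) A = infdist x A" for x
  proof -
    obtain l where "circle_rep (circle_proj x) = x + of_int l"
      by (rule circle_rep_projE)
    then show ?thesis
      by (simp add: period)
  qed
  then show "infdist (circle_rep (circle_proj x)) A = infdist x A" .
  show "continuous_on UNIV (\<lambda>z. infdist (circle_rep z) A)"
    by (rule continuous_circle_lift) (simp add: proj continuous_on_infdist continuous_on_id)
qed

context circle_map
begin

text \<open>Affine in each coordinate: \<open>[-1, 1]\<close> is mapped onto the window of
  \<open>gaps\<close>, with centre \<open>1 / k - 2 \<eta>\<close>.\<close>

definition disk_vec :: "nat \<Rightarrow> real \<Rightarrow> (nat \<Rightarrow> real) \<Rightarrow> nat \<Rightarrow> real"
  where "disk_vec k \<eta> x i = 1 / real k - \<eta> * (2 - x i)"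

lemma disk_vec_gaps:
  assumes "x \<in> topspace (closed_disk (k - 1))" "\<eta> > 0"
  shows "disk_vec k \<eta> x \<in> gaps k \<eta>"
  unfolding gaps_def
proof (intro CollectI allI impI)
  fix i
  have "\<eta> * 1 \<le> \<eta> * (2 - x i)" "\<eta> * (2 - x i) \<le> \<eta> * 3"
    using closed_disk_coord[OF assms(1), of i] assms(2) by (intro mult_left_mono; simp)+
  then show "disk_vec k \<eta> x i \<in> {1 / real k - 3 * \<eta>..1 / real k - \<eta>}"
    by (simp add: disk_vec_def)
qed

theorem disk_of_denjoy_sets:
  assumes "\<alpha> \<notin> \<rat>" "\<alpha> \<in> interior (rotation_set G)" "k > 0"
  shows "\<exists>D. embedding_map (closed_disk (k - 1)) (kfsm_semi_Denjoy_topology g G xm k) D \<and>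
    (\<forall>x\<in>topspace (closed_disk (k - 1)). set_has_rotation_number G (D x) \<alpha>)"
proof -
  obtain a1 a2 \<eta> where const: "slopes a1 a2" "\<eta> > 0" "3 * real k * \<eta> < 1"
    "a1 < \<alpha> - 6 * (real k)\<^sup>2 * \<eta>" "\<alpha> + 6 * (real k)\<^sup>2 * \<eta> < a2"
    using coding_constants[OF assms(2,3)] by blast
  define b where "b = \<alpha> / real k"
  define e where "e = 3 * real k * \<eta>"
  define v where "v = disk_vec k \<eta>"
  define S where "S = topspace (closed_disk (k - 1))"
  define Par where "Par x = denjoy_coding.param G xm (v x) k b" for x
  define D where "D x = irrational_coding.denjoy_set G xm (cuts k (v x)) b" for x
  have kb: "real k * b = \<alpha>"
    using assms(3) by (simp add: b_def)
  have b_irrational: "b \<notin> \<rat>"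
  proof
    assume "b \<in> \<rat>"
    then have "real k * b \<in> \<rat>"
      by (intro Rats_mult) auto
    with kb assms(1) show False
      by simp
  qed
  have dc: "denjoy_coding g G xm (v x) k b a1 a2 e \<eta>" if "x \<in> S" for x
  proof -
    have gaps: "v x \<in> gaps k \<eta>"
      using that const(2) unfolding v_def S_def by (rule disk_vec_gaps)
    interpret coding g G xm "cuts k (v x)" k b a1 a2 e
      unfolding e_def using const(4,5) by (intro coding_cuts const(1-3) assms(3) gaps) (simp_all add: kb)
    show ?thesis
      by unfold_locales fact+
  qed
  have lattice: "irrational_coding g G xm (cuts k (v x)) k b a1 a2 e" "coding g G xm (cuts k (v x)) k b a1 a2 e"
    if "x \<in> S" for x
    using dc[OF that] by (simp_all add: denjoy_coding_def irrational_coding_def)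
  have inv: "invariant_measure g (D x) = denjoy_coding.\<mu> G xm (v x) k b" "D x \<in> kfsm_semi_Denjoy g G xm k"
    "invariant_measure g (D x) \<in> prob_measures" "set_has_rotation_number G (D x) \<alpha>"
    "Par x t \<in> D x" "compact (D x)" "Par x \<in> borel_measurable borel"
    "continuous_on UNIV u \<Longrightarrow> integral\<^sup>L (invariant_measure g (D x)) u = (LINT t|unif. u (Par x t))"
    if "x \<in> S" for x t and u :: "circle \<Rightarrow> real"
  proof -
    interpret denjoy_coding g G xm "v x" k b a1 a2 e \<eta>
      by (rule dc[OF that])
    show "invariant_measure g (D x) = \<mu>"
      unfolding D_def by (rule invariant_measure_denjoy_set)
    then show "invariant_measure g (D x) \<in> prob_measures"
      by (simp add: mu_prob_measure)
    show "D x \<in> kfsm_semi_Denjoy g G xm k"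
      unfolding D_def by (rule denjoy_set_in_kfsm)
    show "set_has_rotation_number G (D x) \<alpha>"
      unfolding D_def kb[symmetric] by (rule denjoy_set_rotation)
    show "Par x t \<in> D x"
      unfolding D_def Par_def by (rule param_in_denjoy_set)
    show "compact (D x)"
      unfolding D_def by (rule compact_denjoy_set)
    show "Par x \<in> borel_measurable borel"
      unfolding Par_def by (rule param_measurable)
    show "integral\<^sup>L (invariant_measure g (D x)) u = (LINT t|unif. u (Par x t))" if "continuous_on UNIV u"
      unfolding \<open>invariant_measure g (D x) = \<mu>\<close> Par_def by (rule integral_mu[OF that])
  qed
  define C where "C = {u :: circle \<Rightarrow> real. continuous_on UNIV u}"
  define T where "T = product_topology (\<lambda>_. euclideanreal) C"
  define \<Phi> where "\<Phi> M = (\<lambda>u\<in>C. integral\<^sup>L M u)" for M :: "circle measure"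
  define I where "I = (\<Phi> \<circ> invariant_measure g)"
  have weak: "weak_topology = pullback_topology prob_measures \<Phi> T"
    by (simp add: weak_topology_def T_def \<Phi>_def[abs_def] C_def)
  have I_cont: "continuous_map (kfsm_semi_Denjoy_topology g G xm k) T I"
    unfolding kfsm_semi_Denjoy_topology_def weak I_def
    by (intro continuous_map_pullback) (use continuous_map_pullback[of T T id] in \<open>simp add: continuous_map_id[unfolded id_def] id_def o_def\<close>)
  have par_lim: "AE t in unif. (\<lambda>n. Par (xs n) t) \<longlonglongrightarrow> Par x t"
    if xs: "\<And>n. xs n \<in> S" "x \<in> S" "xs \<longlonglongrightarrow> x" for xs x
  proof -
    interpret x: denjoy_coding g G xm "v x" k b a1 a2 e \<eta>
      by (rule dc[OF xs(2)])
    \<comment> \<open>Phases whose rotation orbit meets a cut, where continuity in the cuts may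
      fail. They are countable, hence null.\<close>
    define B where "B = (\<Union>i j. {cuts k (v x) j - real i * b})"
    have "countable B"
      unfolding B_def by (intro countable_UN) auto
    have "(\<lambda>n. xs n i) \<longlonglongrightarrow> x i" for i
      using continuous_on_tendsto_compose[OF continuous_on_product_coordinates[of i] xs(3)] by simp
    then have cuts_lim: "(\<lambda>n. cuts k (v (xs n)) j) \<longlonglongrightarrow> cuts k (v x) j" for j
      unfolding cuts_def v_def disk_vec_def by (intro tendsto_intros)
    have lim: "(\<lambda>n. Par (xs n) t) \<longlonglongrightarrow> Par x t" if "t \<notin> B" for t
    proof -
      have not_cut: "t + real i * b \<noteq> cuts k (v x) j" for i j
      proof
        assume "t + real i * b = cuts k (v x) j"
        then have "t = cuts k (v x) j - real i * b"
          by simp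
        with that show False
          by (auto simp: B_def)
      qed
      have "(\<lambda>n. coding.X G xm (cuts k (v (xs n))) b t) \<longlonglongrightarrow> x.X t"
        using lattice(2)[OF xs(1)] by (intro x.X_eventually cuts_lim not_cut)
      then have "(\<lambda>n. circle_proj (coding.X G xm (cuts k (v (xs n))) b t)) \<longlonglongrightarrow> circle_proj (x.X t)"
        by (intro continuous_on_tendsto_compose[OF continuous_circle_proj]) auto
      then show ?thesis
        by (simp add: Par_def x.param_def denjoy_coding.param_def[OF dc[OF xs(1)]])
    qed
    from AE_unif_countable[OF \<open>countable B\<close>] show ?thesis
      by eventually_elim (rule lim)
  qed
  have int_cont: "continuous_on S (\<lambda>x. LINT t|unif. u (Par x t))" if u: "continuous_on UNIV u" for u :: "circle \<Rightarrow> real"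
    unfolding continuous_on_sequentially
  proof (intro allI ballI impI, elim conjE)
    fix xs x assume xs: "\<forall>n. xs n \<in> S" "x \<in> S" "xs \<longlonglongrightarrow> x"
    have [measurable]: "u \<in> borel_measurable borel"
      by (rule borel_measurable_continuous_onI[OF u])
    have [measurable]: "Par (xs n) \<in> borel_measurable borel" "Par x \<in> borel_measurable borel" for n
      using inv(7) xs by auto
    have "bounded (range u)"
      by (intro compact_imp_bounded compact_continuous_image u compact_circle)
    then obtain K where K: "\<And>z. norm (u z) \<le> K"
      by (auto simp: bounded_iff)
    have "(\<lambda>n. LINT t|unif. u (Par (xs n) t)) \<longlonglongrightarrow> (LINT t|unif. u (Par x t))"
    proof (rule integral_dominated_convergence)
      show "AE t in unif. (\<lambda>n. u (Par (xs n) t)) \<longlonglongrightarrow> u (Par x t)"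
      proof -
        have "AE t in unif. (\<lambda>n. Par (xs n) t) \<longlonglongrightarrow> Par x t"
          using xs by (intro par_lim) auto
        then show ?thesis
          by eventually_elim (rule continuous_on_tendsto_compose[OF u], auto)
      qed
      show "integrable unif (\<lambda>t. K)"
        by simp
      show "AE t in unif. norm (u (Par (xs n) t)) \<le> K" for n
        using K by simp
    qed measurable
    then show "((\<lambda>x. LINT t|unif. u (Par x t)) \<circ> xs) \<longlonglongrightarrow> (LINT t|unif. u (Par x t))"
      by (simp add: o_def)
  qed
  have ID: "I (D x) = (\<lambda>u\<in>C. LINT t|unif. u (Par x t))" if "x \<in> S" for x
    unfolding I_def \<Phi>_def o_def by (rule restrict_ext) (simp add: inv(8)[OF that] C_def)
  have ID_cont: "continuous_map (closed_disk (k - 1)) T (I \<circ> D)"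
  proof -
    have "closed_disk (k - 1) = top_of_set S"
      by (simp add: S_def closed_disk_eq)
    moreover have "continuous_map (top_of_set S) T (\<lambda>x. \<lambda>u\<in>C. LINT t|unif. u (Par x t))"
      unfolding T_def continuous_map_componentwise using int_cont by (auto simp: C_def)
    ultimately show ?thesis
      by (auto intro: continuous_map_eq simp: ID)
  qed
  have ID_inj: "inj_on (I \<circ> D) S"
  proof (rule inj_onI)
    fix x x' assume x: "x \<in> S" "x' \<in> S" "(I \<circ> D) x = (I \<circ> D) x'"
    define A where "A = circle_proj -` D x'"
    \<comment> \<open>A bounded test function vanishing exactly on \<open>D x'\<close>. Equal
      integrals force it to vanish almost everywhere along \<open>Par x\<close>, so
      \<open>D x\<close> and \<open>D x'\<close> share a point, and a single common point determines
      the parameters.\<close>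
    define u where "u z = min 1 (infdist (circle_rep z) A)" for z
    have u_cont: "continuous_on UNIV u"
      unfolding u_def by (intro continuous_intros continuous_infdist_lift(1)[OF A_def])
    have [measurable]: "u \<in> borel_measurable borel"
      by (rule borel_measurable_continuous_onI[OF u_cont])
    have [measurable]: "Par x \<in> borel_measurable borel"
      by (rule inv(7)[OF x(1)])
    have "closed A"
      unfolding A_def using continuous_circle_proj compact_imp_closed[OF inv(6)[OF x(2)]]
      by (intro closed_vimage) auto
    have zero_iff: "u z = 0 \<longleftrightarrow> z \<in> D x'" for z
    proof -
      have "A \<noteq> {}"
        using inv(5)[OF x(2), of 0] by (metis A_def circle_proj_rep empty_iff vimageI)
      then have "infdist (circle_rep z) A = 0 \<longleftrightarrow> circle_rep z \<in> A"
        using in_closed_iff_infdist_zero[OF \<open>closed A\<close>] by simp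
      then show ?thesis
        using infdist_nonneg[of "circle_rep z" A] by (auto simp: u_def A_def min_def split: if_splits)
    qed
    have "u (Par x' t) = 0" for t
      by (simp add: zero_iff inv(5)[OF x(2)])
    then have "(LINT t|unif. u (Par x' t)) = 0"
      by simp
    moreover have "(LINT t|unif. u (Par x t)) = (LINT t|unif. u (Par x' t))"
      using fun_cong[OF x(3), of u] x(1,2) u_cont by (simp add: ID C_def)
    ultimately have int0: "(LINT t|unif. u (Par x t)) = 0"
      by simp
    have "integrable unif (\<lambda>t. u (Par x t))"
    proof (rule unif.integrable_const_bound[of _ 1])
      show "AE t in unif. norm (u (Par x t)) \<le> 1"
        by (simp add: u_def infdist_nonneg)
    qed measurable
    then have AE0: "AE t in unif. u (Par x t) = 0"
      using int0 integral_nonneg_eq_0_iff_AE[of unif "\<lambda>t. u (Par x t)"] by (simp add: u_def infdist_nonneg)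
    have "\<exists>t. u (Par x t) = 0"
    proof (rule ccontr)
      assume "\<nexists>t. u (Par x t) = 0"
      then have "AE t in unif. u (Par x t) \<noteq> 0"
        by simp
      with AE0 show False
        by (rule unif.AE_contr)
    qed
    then obtain t where "u (Par x t) = 0" ..
    then have "Par x t \<in> D x'"
      by (simp add: zero_iff)
    interpret x: denjoy_coding g G xm "v x" k b a1 a2 e \<eta>
      by (rule dc[OF x(1)])
    interpret x': denjoy_coding g G xm "v x'" k b a1 a2 e \<eta>
      by (rule dc[OF x(2)])
    have "circle_proj (x.X t) \<in> circle_proj ` x'.lifted_set"
      using \<open>Par x t \<in> D x'\<close> by (simp add: Par_def x.param_def D_def x'.denjoy_set_def)
    then obtain w' where w': "w' \<in> x'.lifted_set" "circle_proj (x.X t) = circle_proj w'"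
      by blast
    obtain l where l: "w' = x.X t + of_int l"
      using w'(2) by (rule circle_proj_eqE)
    have v_eq: "v x i = v x' i" if "i < k - 1" for i
      using lifted_sets_unique(2)[OF dc[OF x(1)] dc[OF x(2)] x.X_in_lifted_set w'(1) l that] .
    show "x = x'"
    proof
      fix i
      show "x i = x' i"
      proof (cases "i < k - 1")
        case True
        then show ?thesis
          using v_eq[OF True] const(2) by (simp add: v_def disk_vec_def)
      next
        case False
        then show ?thesis
          using x(1,2) by (simp add: S_def closed_disk_eq)
      qed
    qed
  qed
  have "Hausdorff_space T"
    unfolding T_def by (simp add: Hausdorff_space_product_topology)
  then have "embedding_map (closed_disk (k - 1)) T (I \<circ> D)"
    using ID_cont ID_inj compact_space_closed_disk
    by (intro continuous_imp_embedding_map) (auto simp: S_def)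
  moreover have "continuous_map (closed_disk (k - 1)) (kfsm_semi_Denjoy_topology g G xm k) D"
    unfolding kfsm_semi_Denjoy_topology_def weak
  proof (rule continuous_map_pullback')
    show "continuous_map (closed_disk (k - 1)) (pullback_topology prob_measures \<Phi> T) (invariant_measure g \<circ> D)"
    proof (rule continuous_map_pullback')
      show "continuous_map (closed_disk (k - 1)) T (\<Phi> \<circ> (invariant_measure g \<circ> D))"
        using ID_cont by (simp only: I_def comp_assoc)
    qed (use inv(3) in \<open>auto simp: S_def\<close>)
  qed (use inv(2) in \<open>auto simp: S_def\<close>)
  ultimately have "embedding_map (closed_disk (k - 1)) (kfsm_semi_Denjoy_topology g G xm k) D"
    using I_cont by (metis embedding_map_factor)
  moreover have "\<forall>x\<in>topspace (closed_disk (k - 1)). set_has_rotation_number G (D x) \<alpha>"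
    using inv(4) by (simp add: S_def)
  ultimately show ?thesis
    by (intro exI[of _ D] conjI)
qed

end

theorem theorem1p2:
  fixes g :: "circle \<Rightarrow> circle" and G :: "real \<Rightarrow> real" and xm \<alpha> :: real and k :: nat
  assumes "class_G g G xm"
    and "\<alpha> \<notin> \<rat>"
    and "\<alpha> \<in> interior (rotation_set G)"
    and "k > 0"
  shows "(\<exists>D :: (nat \<Rightarrow> real) \<Rightarrow> circle set.
            embedding_map (closed_disk (k - 1)) (kfsm_semi_Denjoy_topology g G xm k) D \<and>
            (\<forall>x \<in> topspace (closed_disk (k - 1)). set_has_rotation_number G (D x) \<alpha>))
       \<and> (\<forall>(p :: nat \<Rightarrow> int) (q :: nat \<Rightarrow> int).
            (\<forall>n. q n > 0 \<and> coprime (p n) (q n)) \<and>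
            (\<lambda>n. real_of_int (p n) / real_of_int (q n)) \<longlonglongrightarrow> \<alpha> \<longrightarrow>
            (\<forall>n. finite (kfsm_periodic_orbits g G xm k (real_of_int (p n) / real_of_int (q n)))) \<and>
            (\<lambda>n. real (card (kfsm_periodic_orbits g G xm k (real_of_int (p n) / real_of_int (q n)))))
              \<in> \<Theta>(\<lambda>n. real_of_int (q n) ^ (k - 1)))"
proof -
  interpret circle_map g G xm
    by unfold_locales (rule assms(1))
  show ?thesis
    by (intro conjI allI impI disk_of_denjoy_sets[OF assms(2-4)]
      card_kfsm_periodic_orbits_le(1)[OF assms(4)] kfsm_periodic_orbits_growth[OF assms(2-4)]) auto
qed

end
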